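(* Let $(E,\mathbb{L},\rho,\sigma,\alpha)$ be a trialitarian algebra over an algebraically closed field $\mathbb{F}$, $\mathrm{char}\,\mathbb{F}\ne2,3$. Suppose $E$ is given a Type III grading by an abelian group $G$. Then there exists a cyclic composition algebra $(V,\mathbb{L},\rho,*,Q)$ with a $G$-grading such that $E$ is isomorphic to $\mathrm{End}_{\mathbb{L}}(V)$ as a $G$-graded trialitarian algebra.
   Context: Throughout $\mathbb{L}=\mathbb{F}\times\mathbb{F}\times\mathbb{F}$ with $\rho(\lambda_1,\lambda_2,\lambda_3)=(\lambda_2,\lambda_3,\lambda_1)$. Cyclic composition algebras. A cyclic composition algebra over $(\mathbb{L},\rho)$ is a free $\mathbb{L}$-module $V$ with a nonsingular $\mathbb{L}$-valued quadratic form $Q$, with polar form $b_Q(x,y)=Q(x+y)-Q(x)-Q(y)$, and an $\mathbb{F}$-bilinear multiplication $*$ on $V$, $\rho$-semilinear in the first and $\rho^2$-semilinear in the second argument, such that $Q(x*y)=\rho(Q(x))\rho^2(Q(y))$ and $b_Q(x*y,z)=\rho(b_Q(y*z,x))=\rho^2(b_Q(z*x,y))$. Its rank is the $\mathbb{L}$-rank of $V$. A $G$-grading on it consists of a $G$-grading on the $\mathbb{F}$-algebra $(V,* )$ and a $G$-grading on the algebra $\mathbb{L}$ (with $\rho$ degree-preserving) such that $V$ is a graded $\mathbb{L}$-module and $b_Q\colon V\times V\to\mathbb{L}$ is degree-preserving ($b_Q(V_a,V_b)\subset\mathbb{L}_{ab}$). Trialitarian algebras. For a cyclic composition algebra $V$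 of rank $8$, let $E=\mathrm{End}_{\mathbb{L}}(V)$ and let $\sigma$ be the involution of $E$ adjoint to $b_Q$. The even Clifford algebra $\mathrm{Cl}(E,\sigma)$ of the algebra with involution is the quotient of the tensor algebra (over $\mathbb{L}$) of the $\mathbb{L}$-module $E$ by the two-sided ideal generated by the elements $[x\,b_Q(x,\cdot)]-Q(x)1$ and $[x\,b_Q(y,\cdot)]\otimes[y\,b_Q(z,\cdot)]-Q(y)[x\,b_Q(z,\cdot)]$ for $x,y,z\in V$, where $[x\,b_Q(y,\cdot)]$ is the operator $v\mapsto x\,b_Q(y,v)$ regarded as an element of degree one in the tensor algebra; this ideal depends only on $(E,\sigma)$. The algebra $\mathrm{Cl}(E,\sigma)$ comes with a canonical $\mathbb{L}$-linear map $\kappa\colon E\to\mathrm{Cl}(E,\sigma)$ (induced by the inclusion of $E$ in its tensor algebra) whose image generates it, carries a canonical involution (the one sending $\kappa(a)$ to $\kappa(\sigma(a))$ for $a\in E$), and is functorial for isomorphisms of algebras with involution (an isomorphism $\varphi\colon(E,\sigma)\to(E',\sigma')$ induces the isomorphism $\mathrm{Cl}(\varphi)$ sending $\kappa(a)$ to $\kappa'(\varphi(a))$, where $\kappa'$ is the canonical map for $(E',\sigma')$); it is identified with the even Clifford algebra $\mathrm{Cl}_0(V,Q)$ so that $\kappa(x\,b_Q(y,\cdot))$ corresponds to the Clifford product $x\cdot y$, for $x,y\in V$. Let $l_x(y)=x*y=r_y(x)$. There is an isomorphism of $\mathbb{L}$-algebras with involution $\alpha\colon\mathrm{Cl}(E,\sigma)\to{}^{\rho}E\times{}^{\rho^2}E$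 determined by $\kappa(x\,b_Q(y,\cdot))\mapsto(l_xr_y,r_xl_y)$, where ${}^{\rho}E$ is $E$ with $\mathbb{L}$-module structure $\ell\cdot a=\rho(\ell)a$ (similarly ${}^{\rho^2}E$). A trialitarian algebra here is a structure $(E,\mathbb{L},\rho,\sigma,\alpha)$ isomorphic to one arising in this way. An isomorphism $(E,\mathbb{L},\rho,\sigma,\alpha)\to(E',\mathbb{L}',\rho',\sigma',\alpha')$ is an isomorphism $\varphi\colon(E,\sigma)\to(E',\sigma')$ of $\mathbb{F}$-algebras with involution such that $\alpha'\circ\mathrm{Cl}(\varphi)=(\varphi\otimes\Delta(\varphi))\circ\alpha$, where ${}^\rho E\times{}^{\rho^2}E=E\otimes(\mathbb{F}\times\mathbb{F})$ as $\mathbb{F}$-algebras (similarly for $E'$) and $\Delta(\varphi)$ is the identity of $\mathbb{F}\times\mathbb{F}$ if $\varphi|_{\mathbb{L}}$ conjugates $\rho$ to $\rho'$, and the flip if it conjugates $\rho$ to $\rho'^{-1}$. Gradings. A $G$-grading on $(E,\mathbb{L},\rho,\sigma,\alpha)$ is a $G$-grading on the $\mathbb{F}$-algebra $E$ such that $\sigma$ and $\alpha$ preserve degree (with $\mathrm{Cl}(E,\sigma)$ given the unique algebra grading for which $\kappa$ preserves degree). It is of Type III if its restriction to the center $\mathbb{L}=Z(E)$ has three one-dimensional homogeneous components: $\mathbb{L}=\mathbb{F}1\oplus\mathbb{F}\xi\oplus\mathbb{F}\xi^2$, $\xi=(1,\omega,\omega^2)$, $\omega$ a primitive cube root of unity,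 with $\deg\xi=h$ of order $3$. A $G$-grading on $V$ induces the $G$-grading on $\mathrm{End}_{\mathbb{L}}(V)$ in which $a$ has degree $g$ iff $a(V_k)\subset V_{gk}$ for all $k\in G$. Isomorphism of graded trialitarian algebras means a degree-preserving isomorphism. *)

theory Defs
  imports "HOL-Algebra.Algebra" "HOL-Algebra.Algebraic_Closure_Type"
    "HOL-Library.Poly_Mapping" "HOL-Library.Product_Plus"
begin

section \<open>The split cubic algebra\<close>

instantiation prod :: (times, times) times
begin
definition times_prod_def: "x * y = (fst x * fst y, snd x * snd y)"
instance ..
end

instantiation prod :: (one, one) one
begin
definition one_prod_def: "1 = (1, 1)"
instance ..
end

instance prod :: (comm_ring_1, comm_ring_1) comm_ring_1
  by standard (auto simp: times_prod_def one_prod_def prod_eq_iff algebra_simps)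

type_synonym 'k triple = "'k \<times> 'k \<times> 'k"

fun rho :: "'k triple \<Rightarrow> 'k triple" where
  "rho (a, b, c) = (b, c, a)"

definition diag :: "'k \<Rightarrow> 'k triple" where
  "diag c = (c, c, c)"

abbreviation triple_ring :: "('k::field) triple ring" where
  "triple_ring \<equiv> ring_of_type_algebra"

text \<open>The algebra \<open>\<bbbL>\<close> as a module over itself. Throughout, an \<open>\<bbbL>\<close>-module with a multiplication is a
  record of type \<open>('k triple, 'a) module\<close>, and its \<open>\<bbbF>\<close>-structure is obtained through \<^const>\<open>diag\<close>.\<close>

definition triple_alg :: "('k::field triple, 'k triple) module" where
  "triple_alg = ring.extend triple_ring \<lparr> module.smult = (*) \<rparr>"

section \<open>Modules and algebras over \<open>\<bbbL>\<close>\<close>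

definition L_algebra :: "('k::field triple, 'a) module \<Rightarrow> bool" where
  "L_algebra A \<longleftrightarrow> ring A \<and> Module.module triple_ring A \<and>
     (\<forall>l. \<forall>x\<in>carrier A. \<forall>y\<in>carrier A.
        (l \<odot>\<^bsub>A\<^esub> x) \<otimes>\<^bsub>A\<^esub> y = l \<odot>\<^bsub>A\<^esub> (x \<otimes>\<^bsub>A\<^esub> y) \<and>
        x \<otimes>\<^bsub>A\<^esub> (l \<odot>\<^bsub>A\<^esub> y) = l \<odot>\<^bsub>A\<^esub> (x \<otimes>\<^bsub>A\<^esub> y))"

definition alg_iso ::
    "('k::field triple, 'a) module \<Rightarrow> ('k triple, 'b) module \<Rightarrow> ('a \<Rightarrow> 'b) set" where
  "alg_iso A B = {f \<in> ring_iso A B. \<forall>l. \<forall>x\<in>carrier A. f (l \<odot>\<^bsub>A\<^esub> x) = l \<odot>\<^bsub>B\<^esub> f x}"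

definition alg_involution :: "('k::field triple, 'a) module \<Rightarrow> ('a \<Rightarrow> 'a) \<Rightarrow> bool" where
  "alg_involution A s \<longleftrightarrow> s \<in> carrier A \<rightarrow> carrier A \<and>
     (\<forall>x\<in>carrier A. s (s x) = x \<and> (\<forall>l. s (l \<odot>\<^bsub>A\<^esub> x) = l \<odot>\<^bsub>A\<^esub> s x) \<and>
        (\<forall>y\<in>carrier A. s (x \<oplus>\<^bsub>A\<^esub> y) = s x \<oplus>\<^bsub>A\<^esub> s y \<and> s (x \<otimes>\<^bsub>A\<^esub> y) = s y \<otimes>\<^bsub>A\<^esub> s x))"

text \<open>Free of finite rank \<open>n\<close>. (A nonsingular form on a free module forces the rank to be finite.)\<close>

definition free_of_rank :: "('k::field triple, 'v) module \<Rightarrow> nat \<Rightarrow> bool" where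
  "free_of_rank V n \<longleftrightarrow> (\<exists>b \<in> {..<n} \<rightarrow> carrier V. \<forall>v\<in>carrier V.
     \<exists>!c. c \<in> {..<n} \<rightarrow>\<^sub>E UNIV \<and> v = (\<Oplus>\<^bsub>V\<^esub>i\<in>{..<n}. c i \<odot>\<^bsub>V\<^esub> b i))"

definition End_alg :: "('k::field triple, 'v) module \<Rightarrow> ('k triple, 'v \<Rightarrow> 'v) module" where
  "End_alg V =
    \<lparr> carrier = {f \<in> carrier V \<rightarrow>\<^sub>E carrier V.
        (\<forall>x\<in>carrier V. \<forall>y\<in>carrier V. f (x \<oplus>\<^bsub>V\<^esub> y) = f x \<oplus>\<^bsub>V\<^esub> f y) \<and>
        (\<forall>l. \<forall>x\<in>carrier V. f (l \<odot>\<^bsub>V\<^esub> x) = l \<odot>\<^bsub>V\<^esub> f x)},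
      monoid.mult = compose (carrier V),
      one = (\<lambda>v\<in>carrier V. v),
      ring.zero = (\<lambda>v\<in>carrier V. \<zero>\<^bsub>V\<^esub>),
      add = (\<lambda>f g. \<lambda>v\<in>carrier V. f v \<oplus>\<^bsub>V\<^esub> g v),
      module.smult = (\<lambda>l f. \<lambda>v\<in>carrier V. l \<odot>\<^bsub>V\<^esub> f v) \<rparr>"

definition alg_quot ::
    "('k::field triple, 'a) module \<Rightarrow> 'a set \<Rightarrow> ('k triple, 'a set) module" where
  "alg_quot A I = ring.extend (A Quot I)
     \<lparr> module.smult = (\<lambda>l c. (I +>\<^bsub>A\<^esub> (l \<odot>\<^bsub>A\<^esub> \<one>\<^bsub>A\<^esub>)) \<otimes>\<^bsub>A Quot I\<^esub> c) \<rparr>"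

section \<open>Quadratic forms\<close>

definition polar :: "('k::field triple, 'v) module \<Rightarrow> ('v \<Rightarrow> 'k triple) \<Rightarrow> 'v \<Rightarrow> 'v \<Rightarrow> 'k triple" where
  "polar V Q x y = Q (x \<oplus>\<^bsub>V\<^esub> y) - Q x - Q y"

definition quadratic_form :: "('k::field triple, 'v) module \<Rightarrow> ('v \<Rightarrow> 'k triple) \<Rightarrow> bool" where
  "quadratic_form V Q \<longleftrightarrow>
     (\<forall>l. \<forall>x\<in>carrier V. Q (l \<odot>\<^bsub>V\<^esub> x) = l * l * Q x) \<and>
     (\<forall>x\<in>carrier V. \<forall>y\<in>carrier V. \<forall>z\<in>carrier V.
        polar V Q (x \<oplus>\<^bsub>V\<^esub> y) z = polar V Q x z + polar V Q y z) \<and>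
     (\<forall>l. \<forall>x\<in>carrier V. \<forall>y\<in>carrier V. polar V Q (l \<odot>\<^bsub>V\<^esub> x) y = l * polar V Q x y)"

text \<open>Nonsingularity: \<open>x \<mapsto> b\<^sub>Q(x, \<cdot>)\<close> is a bijection from \<open>V\<close> to its \<open>\<bbbL>\<close>-dual.\<close>

definition nonsingular :: "('k::field triple, 'v) module \<Rightarrow> ('v \<Rightarrow> 'k triple) \<Rightarrow> bool" where
  "nonsingular V Q \<longleftrightarrow> (\<forall>f.
     (\<forall>x\<in>carrier V. \<forall>y\<in>carrier V. f (x \<oplus>\<^bsub>V\<^esub> y) = f x + f y) \<and>
     (\<forall>l. \<forall>x\<in>carrier V. f (l \<odot>\<^bsub>V\<^esub> x) = l * f x) \<longrightarrow>
     (\<exists>!x. x \<in> carrier V \<and> (\<forall>y\<in>carrier V. f y = polar V Q x y)))"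

definition rank_one :: "('k::field triple, 'v) module \<Rightarrow> ('v \<Rightarrow> 'k triple) \<Rightarrow> 'v \<Rightarrow> 'v \<Rightarrow> 'v \<Rightarrow> 'v" where
  "rank_one V Q x y = (\<lambda>v\<in>carrier V. polar V Q y v \<odot>\<^bsub>V\<^esub> x)"

definition adjoint :: "('k::field triple, 'v) module \<Rightarrow> ('v \<Rightarrow> 'k triple) \<Rightarrow> ('v \<Rightarrow> 'v) \<Rightarrow> 'v \<Rightarrow> 'v" where
  "adjoint V Q f = (THE g. g \<in> carrier (End_alg V) \<and>
     (\<forall>x\<in>carrier V. \<forall>y\<in>carrier V. polar V Q (f x) y = polar V Q x (g y)))"

section \<open>Cyclic composition algebras\<close>

text \<open>The product \<open>*\<close> is the \<open>mult\<close> field of the record \<open>V\<close>; its \<open>one\<close> field plays no role.\<close>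

locale cyclic_composition_algebra =
  fixes V :: "('k::field triple, 'v) module" (structure)
    and Q :: "'v \<Rightarrow> 'k triple"
  assumes module: "Module.module triple_ring V"
    and free: "\<exists>n. free_of_rank V n"
    and quadratic: "quadratic_form V Q"
    and nonsing: "nonsingular V Q"
    and mult_closed: "\<lbrakk>x \<in> carrier V; y \<in> carrier V\<rbrakk> \<Longrightarrow> x \<otimes> y \<in> carrier V"
    and mult_add_left: "\<lbrakk>x \<in> carrier V; y \<in> carrier V; z \<in> carrier V\<rbrakk>
      \<Longrightarrow> (x \<oplus> y) \<otimes> z = x \<otimes> z \<oplus> y \<otimes> z"
    and mult_add_right: "\<lbrakk>x \<in> carrier V; y \<in> carrier V; z \<in> carrier V\<rbrakk>
      \<Longrightarrow> x \<otimes> (y \<oplus> z) = x \<otimes> y \<oplus> x \<otimes> z"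
    and mult_smult_left: "\<lbrakk>x \<in> carrier V; y \<in> carrier V\<rbrakk>
      \<Longrightarrow> (l \<odot> x) \<otimes> y = rho l \<odot> (x \<otimes> y)"
    and mult_smult_right: "\<lbrakk>x \<in> carrier V; y \<in> carrier V\<rbrakk>
      \<Longrightarrow> x \<otimes> (l \<odot> y) = rho (rho l) \<odot> (x \<otimes> y)"
    and norm_mult: "\<lbrakk>x \<in> carrier V; y \<in> carrier V\<rbrakk>
      \<Longrightarrow> Q (x \<otimes> y) = rho (Q x) * rho (rho (Q y))"
    and polar_cyclic1: "\<lbrakk>x \<in> carrier V; y \<in> carrier V; z \<in> carrier V\<rbrakk>
      \<Longrightarrow> polar V Q (x \<otimes> y) z = rho (polar V Q (y \<otimes> z) x)"
    and polar_cyclic2: "\<lbrakk>x \<in> carrier V; y \<in> carrier V; z \<in> carrier V\<rbrakk>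
      \<Longrightarrow> polar V Q (x \<otimes> y) z = rho (rho (polar V Q (z \<otimes> x) y))"

section \<open>The even Clifford algebra of an algebra with involution\<close>

text \<open>Words form the free monoid under concatenation, so \<open>'e word \<Rightarrow>\<^sub>0 'k triple\<close> with the convolution
  product is the free \<open>\<bbbL>\<close>-algebra on the type \<open>'e\<close>.\<close>

datatype 'e word = Word (letters: "'e list")

instantiation word :: (type) monoid_add
begin
definition zero_word_def: "0 = Word []"
definition plus_word_def: "u + v = Word (letters u @ letters v)"
instance by standard (auto simp: zero_word_def plus_word_def word.expand)
end

definition free_alg ::
    "('k::field triple, 'e) module \<Rightarrow> ('k triple, 'e word \<Rightarrow>\<^sub>0 'k triple) module" where
  "free_alg E = ring.extend
     (ring_of_type_algebra\<lparr> carrier := {p. \<forall>w\<in>Poly_Mapping.keys p. set (letters w) \<subseteq> carrier E} \<rparr>)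
     \<lparr> module.smult = (\<lambda>l p. Poly_Mapping.single 0 l * p) \<rparr>"

definition letter :: "'e \<Rightarrow> ('e word \<Rightarrow>\<^sub>0 ('k::field) triple)" where
  "letter a = Poly_Mapping.single (Word [a]) 1"

text \<open>The tensor algebra \<open>T\<^sub>\<bbbL>(E)\<close>: the free \<open>\<bbbL>\<close>-algebra on the set \<open>E\<close> modulo the relations that make
  \<open>E \<rightarrow> T\<^sub>\<bbbL>(E)\<close> linear over \<open>\<bbbL>\<close>.\<close>

definition linear_ideal :: "('k::field triple, 'e) module \<Rightarrow> ('e word \<Rightarrow>\<^sub>0 'k triple) set" where
  "linear_ideal E = Idl\<^bsub>free_alg E\<^esub>
     ({letter (a \<oplus>\<^bsub>E\<^esub> b) - letter a - letter b | a b. a \<in> carrier E \<and> b \<in> carrier E} \<union>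
      {letter (l \<odot>\<^bsub>E\<^esub> a) - l \<odot>\<^bsub>free_alg E\<^esub> letter a | l a. a \<in> carrier E})"

definition tensor_alg ::
    "('k::field triple, 'e) module \<Rightarrow> ('k triple, ('e word \<Rightarrow>\<^sub>0 'k triple) set) module" where
  "tensor_alg E = alg_quot (free_alg E) (linear_ideal E)"

definition tensor_incl ::
    "('k::field triple, 'e) module \<Rightarrow> 'e \<Rightarrow> ('e word \<Rightarrow>\<^sub>0 'k triple) set" where
  "tensor_incl E a = linear_ideal E +>\<^bsub>free_alg E\<^esub> letter a"

text \<open>A presentation of \<open>(E, \<sigma>)\<close> as \<open>End\<^sub>\<bbbL>(W)\<close> with the involution adjoint to the polar form of a
  nonsingular quadratic form \<open>q\<close> on a free module of rank 8.\<close>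

definition is_presentation ::
    "('k::field triple, 'e) module \<Rightarrow> ('e \<Rightarrow> 'e) \<Rightarrow>
     ('k triple, 'w) module \<Rightarrow> ('w \<Rightarrow> 'k triple) \<Rightarrow> ('e \<Rightarrow> 'w \<Rightarrow> 'w) \<Rightarrow> bool" where
  "is_presentation E s W q t \<longleftrightarrow>
     Module.module triple_ring W \<and> free_of_rank W 8 \<and> quadratic_form W q \<and> nonsingular W q \<and>
     t \<in> alg_iso E (End_alg W) \<and> (\<forall>a\<in>carrier E. t (s a) = adjoint W q (t a))"

text \<open>The relations \<open>[x b(x,\<cdot>)] - q(x)1\<close> and \<open>[x b(y,\<cdot>)] \<otimes> [y b(z,\<cdot>)] - q(y)[x b(z,\<cdot>)]\<close>, transported to
  \<open>E\<close> along a presentation.\<close>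

definition clifford_relations ::
    "('k::field triple, 'e) module \<Rightarrow> ('k triple, 'w) module \<Rightarrow> ('w \<Rightarrow> 'k triple) \<Rightarrow>
     ('e \<Rightarrow> 'w \<Rightarrow> 'w) \<Rightarrow> ('e word \<Rightarrow>\<^sub>0 'k triple) set set" where
  "clifford_relations E W q t =
     (let T = tensor_alg E;
          e = (\<lambda>x y. tensor_incl E (inv_into (carrier E) t (rank_one W q x y)))
      in {e x x \<ominus>\<^bsub>T\<^esub> q x \<odot>\<^bsub>T\<^esub> \<one>\<^bsub>T\<^esub> | x. x \<in> carrier W} \<union>
         {e x y \<otimes>\<^bsub>T\<^esub> e y z \<ominus>\<^bsub>T\<^esub> q y \<odot>\<^bsub>T\<^esub> e x z | x y z.
            x \<in> carrier W \<and> y \<in> carrier W \<and> z \<in> carrier W})"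

text \<open>The ideal does not depend on the presentation; taking the relations of all presentations
  expresses it in terms of \<open>(E, \<sigma>)\<close> alone. Every free module of rank 8 over \<open>\<bbbL>\<close> is isomorphic to one
  with carrier in the type \<open>nat \<Rightarrow> 'k triple\<close>, so it suffices to consider those.\<close>

definition clifford_ideal ::
    "('k::field triple, 'e) module \<Rightarrow> ('e \<Rightarrow> 'e) \<Rightarrow> ('e word \<Rightarrow>\<^sub>0 'k triple) set set" where
  "clifford_ideal E s = Idl\<^bsub>tensor_alg E\<^esub>
     (\<Union>{clifford_relations E W q t | (W :: ('k triple, nat \<Rightarrow> 'k triple) module) q t.
           is_presentation E s W q t})"

type_synonym ('k, 'e) clifford_elem = "('e word \<Rightarrow>\<^sub>0 'k triple) set set"

definition clifford ::
    "('k::field triple, 'e) module \<Rightarrow> ('e \<Rightarrow> 'e) \<Rightarrow> ('k triple, ('k, 'e) clifford_elem) module" where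
  "clifford E s = alg_quot (tensor_alg E) (clifford_ideal E s)"

definition kappa ::
    "('k::field triple, 'e) module \<Rightarrow> ('e \<Rightarrow> 'e) \<Rightarrow> 'e \<Rightarrow> ('k, 'e) clifford_elem" where
  "kappa E s a = clifford_ideal E s +>\<^bsub>tensor_alg E\<^esub> tensor_incl E a"

definition is_canonical_involution ::
    "('k::field triple, 'e) module \<Rightarrow> ('e \<Rightarrow> 'e) \<Rightarrow>
     (('k, 'e) clifford_elem \<Rightarrow> ('k, 'e) clifford_elem) \<Rightarrow> bool" where
  "is_canonical_involution E s j \<longleftrightarrow> alg_involution (clifford E s) j \<and>
     (\<forall>a\<in>carrier E. j (kappa E s a) = kappa E s (s a))"

text \<open>\<open>f\<close> is \<open>Cl(\<phi>)\<close>, where \<open>\<phi>\<close> restricts to \<open>\<tau>\<close> on the centre \<open>\<bbbL>\<close>; in particular \<open>f\<close> is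
  \<open>\<tau>\<close>-semilinear.\<close>

definition is_clifford_map ::
    "('k::field triple, 'e) module \<Rightarrow> ('e \<Rightarrow> 'e) \<Rightarrow> ('k triple, 'f) module \<Rightarrow> ('f \<Rightarrow> 'f) \<Rightarrow>
     ('k triple \<Rightarrow> 'k triple) \<Rightarrow> ('e \<Rightarrow> 'f) \<Rightarrow>
     (('k, 'e) clifford_elem \<Rightarrow> ('k, 'f) clifford_elem) \<Rightarrow> bool" where
  "is_clifford_map E s E' s' \<tau> \<phi> f \<longleftrightarrow> f \<in> ring_iso (clifford E s) (clifford E' s') \<and>
     (\<forall>l. f (l \<odot>\<^bsub>clifford E s\<^esub> \<one>\<^bsub>clifford E s\<^esub>) = \<tau> l \<odot>\<^bsub>clifford E' s'\<^esub> \<one>\<^bsub>clifford E' s'\<^esub>) \<and>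
     (\<forall>a\<in>carrier E. f (kappa E s a) = kappa E' s' (\<phi> a))"

section \<open>Trialitarian algebras\<close>

text \<open>The \<open>\<bbbL>\<close>-algebra \<open>\<^sup>\<rho>E \<times> \<^sup>\<rho>\<^sup>2E\<close>, whose factors carry the \<open>\<bbbL>\<close>-structures twisted by \<open>\<rho>\<close> and \<open>\<rho>\<^sup>2\<close>.\<close>

definition twisted_square ::
    "('k::field triple, 'e) module \<Rightarrow> ('k triple, 'e \<times> 'e) module" where
  "twisted_square E = ring.extend (RDirProd E E)
     \<lparr> module.smult = (\<lambda>l (a, b). (rho l \<odot>\<^bsub>E\<^esub> a, rho (rho l) \<odot>\<^bsub>E\<^esub> b)) \<rparr>"

text \<open>The structure \<open>(E, \<bbbL>, \<rho>, \<sigma>, \<alpha>)\<close>; \<open>\<bbbL>\<close> sits in \<open>E\<close> through its \<open>\<bbbL>\<close>-algebra structure.\<close>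

record (overloaded) ('k, 'e) trialitarian_data =
  E_alg :: "(('k::field) triple, 'e) module"
  E_inv :: "'e \<Rightarrow> 'e"
  E_map :: "('k, 'e) clifford_elem \<Rightarrow> 'e \<times> 'e"

abbreviation Cl :: "('k::field, 'e) trialitarian_data \<Rightarrow> ('k triple, ('k, 'e) clifford_elem) module" where
  "Cl S \<equiv> clifford (E_alg S) (E_inv S)"

definition alpha_iso :: "('k::field, 'e) trialitarian_data \<Rightarrow> bool" where
  "alpha_iso S \<longleftrightarrow> E_map S \<in> alg_iso (Cl S) (twisted_square (E_alg S)) \<and>
     (\<exists>j. is_canonical_involution (E_alg S) (E_inv S) j \<and>
       (\<forall>c\<in>carrier (Cl S). E_map S (j c) = map_prod (E_inv S) (E_inv S) (E_map S c)))"

definition arises_from ::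
    "('k::field, 'v \<Rightarrow> 'v) trialitarian_data \<Rightarrow> ('k triple, 'v) module \<Rightarrow> ('v \<Rightarrow> 'k triple) \<Rightarrow> bool" where
  "arises_from S V Q \<longleftrightarrow> E_alg S = End_alg V \<and> E_inv S = adjoint V Q \<and> alpha_iso S \<and>
     (\<forall>x\<in>carrier V. \<forall>y\<in>carrier V.
        E_map S (kappa (E_alg S) (E_inv S) (rank_one V Q x y)) =
          (\<lambda>v\<in>carrier V. x \<otimes>\<^bsub>V\<^esub> (v \<otimes>\<^bsub>V\<^esub> y), \<lambda>v\<in>carrier V. (y \<otimes>\<^bsub>V\<^esub> v) \<otimes>\<^bsub>V\<^esub> x))"

text \<open>Here \<open>\<tau>\<close> is the restriction of \<open>\<phi>\<close> to \<open>\<bbbL>\<close>, \<open>rho \<circ> rho\<close> is \<open>\<rho>\<^sup>-\<^sup>1\<close>, and \<open>prod.swap\<close> is the action of the flip of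
  \<open>\<bbbF> \<times> \<bbbF>\<close> on \<open>\<^sup>\<rho>E \<times> \<^sup>\<rho>\<^sup>2E = E \<otimes> (\<bbbF> \<times> \<bbbF>)\<close>.\<close>

definition trialitarian_iso ::
    "('k::field, 'e) trialitarian_data \<Rightarrow> ('k, 'f) trialitarian_data \<Rightarrow> ('e \<Rightarrow> 'f) \<Rightarrow> bool" where
  "trialitarian_iso S S' \<phi> \<longleftrightarrow>
     \<phi> \<in> ring_iso (E_alg S) (E_alg S') \<and>
     (\<forall>c. \<forall>a\<in>carrier (E_alg S). \<phi> (diag c \<odot>\<^bsub>E_alg S\<^esub> a) = diag c \<odot>\<^bsub>E_alg S'\<^esub> \<phi> a) \<and>
     (\<forall>a\<in>carrier (E_alg S). \<phi> (E_inv S a) = E_inv S' (\<phi> a)) \<and>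
     (\<exists>\<tau> f. bij \<tau> \<and>
       (\<forall>l. \<phi> (l \<odot>\<^bsub>E_alg S\<^esub> \<one>\<^bsub>E_alg S\<^esub>) = \<tau> l \<odot>\<^bsub>E_alg S'\<^esub> \<one>\<^bsub>E_alg S'\<^esub>) \<and>
       is_clifford_map (E_alg S) (E_inv S) (E_alg S') (E_inv S') \<tau> \<phi> f \<and>
       (\<tau> \<circ> rho = rho \<circ> \<tau> \<and>
          (\<forall>c\<in>carrier (Cl S). E_map S' (f c) = map_prod \<phi> \<phi> (E_map S c)) \<or>
        \<tau> \<circ> rho = rho \<circ> rho \<circ> \<tau> \<and>
          (\<forall>c\<in>carrier (Cl S). E_map S' (f c) = prod.swap (map_prod \<phi> \<phi> (E_map S c)))))"

text \<open>As above, \<open>nat \<Rightarrow> 'k triple\<close> accommodates all free modules of rank 8 up to isomorphism.\<close>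

definition trialitarian_algebra :: "('k::field, 'e) trialitarian_data \<Rightarrow> bool" where
  "trialitarian_algebra S \<longleftrightarrow> L_algebra (E_alg S) \<and> alg_involution (E_alg S) (E_inv S) \<and> alpha_iso S \<and>
     (\<exists>(V :: ('k triple, nat \<Rightarrow> 'k triple) module) Q S' \<phi>.
        cyclic_composition_algebra V Q \<and> free_of_rank V 8 \<and> arises_from S' V Q \<and>
        trialitarian_iso S S' \<phi>)"

section \<open>Gradings\<close>

text \<open>Gradings of an \<open>\<bbbF>\<close>-algebra, not necessarily associative or unital. The subspaces need not be
  stable under \<open>\<bbbL>\<close>.\<close>

definition alg_grading ::
    "('g, 'm) monoid_scheme \<Rightarrow> ('k::field triple, 'a) module \<Rightarrow> ('g \<Rightarrow> 'a set) \<Rightarrow> bool" where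
  "alg_grading G A D \<longleftrightarrow>
     (\<forall>g\<in>carrier G. D g \<subseteq> carrier A \<and> \<zero>\<^bsub>A\<^esub> \<in> D g \<and>
        (\<forall>x\<in>D g. \<forall>y\<in>D g. x \<oplus>\<^bsub>A\<^esub> y \<in> D g) \<and> (\<forall>c. \<forall>x\<in>D g. diag c \<odot>\<^bsub>A\<^esub> x \<in> D g)) \<and>
     (\<forall>x\<in>carrier A. \<exists>!u. u \<in> (\<Pi>\<^sub>E g\<in>carrier G. D g) \<and> finite {g \<in> carrier G. u g \<noteq> \<zero>\<^bsub>A\<^esub>} \<and>
        x = (\<Oplus>\<^bsub>A\<^esub>g\<in>{g \<in> carrier G. u g \<noteq> \<zero>\<^bsub>A\<^esub>}. u g)) \<and>
     (\<forall>g\<in>carrier G. \<forall>h\<in>carrier G. \<forall>x\<in>D g. \<forall>y\<in>D h. x \<otimes>\<^bsub>A\<^esub> y \<in> D (g \<otimes>\<^bsub>G\<^esub> h))"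

definition cyclic_composition_grading ::
    "('g, 'm) monoid_scheme \<Rightarrow> ('k::field triple, 'v) module \<Rightarrow> ('v \<Rightarrow> 'k triple) \<Rightarrow>
     ('g \<Rightarrow> 'k triple set) \<Rightarrow> ('g \<Rightarrow> 'v set) \<Rightarrow> bool" where
  "cyclic_composition_grading G V Q DL DV \<longleftrightarrow>
     alg_grading G V DV \<and> alg_grading G triple_alg DL \<and>
     (\<forall>g\<in>carrier G. rho ` DL g \<subseteq> DL g) \<and>
     (\<forall>g\<in>carrier G. \<forall>h\<in>carrier G. \<forall>l\<in>DL g. \<forall>x\<in>DV h. l \<odot>\<^bsub>V\<^esub> x \<in> DV (g \<otimes>\<^bsub>G\<^esub> h)) \<and>
     (\<forall>g\<in>carrier G. \<forall>h\<in>carrier G. \<forall>x\<in>DV g. \<forall>y\<in>DV h. polar V Q x y \<in> DL (g \<otimes>\<^bsub>G\<^esub> h))"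

text \<open>The grading \<open>DC\<close> of the Clifford algebra is determined by \<open>D\<close>, since the image of \<open>\<kappa>\<close>
  generates.\<close>

definition trialitarian_grading ::
    "('g, 'm) monoid_scheme \<Rightarrow> ('k::field, 'e) trialitarian_data \<Rightarrow> ('g \<Rightarrow> 'e set) \<Rightarrow> bool" where
  "trialitarian_grading G S D \<longleftrightarrow>
     alg_grading G (E_alg S) D \<and>
     (\<forall>g\<in>carrier G. E_inv S ` D g \<subseteq> D g) \<and>
     (\<exists>DC. alg_grading G (Cl S) DC \<and>
       (\<forall>g\<in>carrier G. kappa (E_alg S) (E_inv S) ` D g \<subseteq> DC g) \<and>
       (\<forall>g\<in>carrier G. E_map S ` DC g \<subseteq> D g \<times> D g))"

definition type_III ::
    "('g, 'm) monoid_scheme \<Rightarrow> ('k::field, 'e) trialitarian_data \<Rightarrow> ('g \<Rightarrow> 'e set) \<Rightarrow> bool" where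
  "type_III G S D \<longleftrightarrow> (\<exists>\<omega> h. \<omega> ^ 3 = 1 \<and> \<omega> \<noteq> 1 \<and> h \<in> carrier G \<and> group.ord G h = 3 \<and>
     (let \<xi> = (1, \<omega>, \<omega>\<^sup>2); DL = (\<lambda>g. {l. l \<odot>\<^bsub>E_alg S\<^esub> \<one>\<^bsub>E_alg S\<^esub> \<in> D g})
      in DL \<one>\<^bsub>G\<^esub> = range diag \<and>
         DL h = range (\<lambda>c. diag c * \<xi>) \<and>
         DL (h \<otimes>\<^bsub>G\<^esub> h) = range (\<lambda>c. diag c * (\<xi> * \<xi>))))"

definition End_grading ::
    "('g, 'm) monoid_scheme \<Rightarrow> ('k::field triple, 'v) module \<Rightarrow> ('g \<Rightarrow> 'v set) \<Rightarrow> 'g \<Rightarrow> ('v \<Rightarrow> 'v) set" where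
  "End_grading G V DV g =
     {a \<in> carrier (End_alg V). \<forall>k\<in>carrier G. a ` DV k \<subseteq> DV (g \<otimes>\<^bsub>G\<^esub> k)}"

definition graded_trialitarian_iso ::
    "('g, 'm) monoid_scheme \<Rightarrow> ('k::field, 'e) trialitarian_data \<Rightarrow> ('g \<Rightarrow> 'e set) \<Rightarrow>
     ('k, 'f) trialitarian_data \<Rightarrow> ('g \<Rightarrow> 'f set) \<Rightarrow> ('e \<Rightarrow> 'f) \<Rightarrow> bool" where
  "graded_trialitarian_iso G S D S' D' \<phi> \<longleftrightarrow>
     trialitarian_iso S S' \<phi> \<and> (\<forall>g\<in>carrier G. \<phi> ` D g = D' g)"

end

theory Submission
  imports Defs "HOL-Library.Function_Algebras" "HOL-Library.Numeral_Type"
begin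

text \<open>Realize \<open>E\<close> as \<open>End(V)\<close> and identify it with \<open>V \<otimes> V\<close> over \<open>\<bbbL>\<close> through rank one operators. The maps
  \<open>\<alpha>\<^sub>1(x \<otimes> y) = l\<^sub>x r\<^sub>y\<close> and \<open>\<alpha>\<^sub>2(x \<otimes> y) = r\<^sub>x l\<^sub>y\<close> and the involution preserve degrees, and so does
  \<open>\<Phi>(x \<otimes> y, p \<otimes> q) = (x * p) \<otimes> (y * q)\<close>: expressing \<open>\<Phi>(a, \<alpha>\<^sub>2(c) d)\<close> through \<open>\<alpha>\<^sub>1\<close>, \<open>\<sigma>\<close> and \<open>\<Phi>(\<cdot>, d)\<close> leaves
  a sum over the Casimir element of \<open>E\<close>, which is homogeneous of trivial degree, and the operators
  \<open>\<alpha>\<^sub>2(c)\<close> generate \<open>E\<close>.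

  A character of \<open>G\<close> that is nontrivial on \<open>h\<close> turns the grading into an automorphism \<open>\<psi>\<close> of \<open>E\<close> that
  permutes the three factors of \<open>\<bbbL>\<close> cyclically. It is induced by a semilinear bijection \<open>u\<close> of \<open>V\<close>, and
  \<open>x \<otimes> y \<mapsto> x * u(y)\<close> carries the grading of \<open>E\<close> to a grading of \<open>V\<close> for which \<open>x \<otimes> y\<close> is homogeneous
  whenever \<open>x\<close> and \<open>y\<close> are. Up to a shift by an element of order at most 2 this is a grading of the
  composition algebra.\<close>

text \<open>A grading of a matrix algebra by an abelian group need not come from a grading of the
  space acted on: the algebra may even be a graded division algebra. So some map from E to V is
  needed along which degrees can be pushed forward, and since E is V \<otimes> V, the product of V
  suggests itself. But x \<star> y is \<rho>-semilinear in x and \<rho>^2-semilinear in y, hence not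
  balanced over L, and does not factor through V \<otimes> V. With a \<rho>^2-semilinear u the
  expression x \<star> u(y) is \<rho>-semilinear in both arguments. This is where Type III enters:
  the grading is nontrivial on L, so a character can be chosen whose automorphism acts on L exactly
  as \<rho>^2.

  A second obstacle is that degrees of operators x \<otimes> y control products in V only after
  multiplication by a value l = b(x1 \<star> y1, z1), about whose homogeneity nothing is known. The
  cyclic symmetry of b shows that l is an eigenvector of \<rho>^2, and the eigenvectors of \<rho>^2
  in L are homogeneous.\<close>

declare split_paired_All [simp del] split_paired_Ex [simp del]

section \<open>Additive maps and coordinatewise arithmetic in F x F x F\<close>

lemma additive_sum:
  fixes f :: "'a::ab_group_add \<Rightarrow> 'b::ab_group_add"
  assumes "\<And>x y. f (x + y) = f x + f y"
  shows "f (sum g A) = (\<Sum>i\<in>A. f (g i))"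
  using additive.sum[of f g A] assms by (simp add: additive_def)

lemma additive_zero:
  fixes f :: "'a::ab_group_add \<Rightarrow> 'b::ab_group_add"
  assumes "\<And>x y. f (x + y) = f x + f y"
  shows "f 0 = 0"
  using additive.zero[of f] assms by (simp add: additive_def)

lemma sum_fun_apply: "(\<Sum>i\<in>A. f i) x = (\<Sum>i\<in>A. f i x)"
  for f :: "'a \<Rightarrow> 'b \<Rightarrow> 'c::comm_monoid_add"
  by (induction A rule: infinite_finite_induct) auto

lemma triple_times [simp]: "(a, b, c) * (a', b', c') = (a * a', b * b', c * c')"
  by (simp add: times_prod_def)

lemma triple_one: "1 = (1, 1, 1)"
  by (simp add: one_prod_def)

lemma triple_zero: "0 = (0, 0, 0)"
  by (simp add: zero_prod_def)

lemma rho_add [simp]: "rho (x + y) = rho x + rho y"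
  by (cases x; cases y) auto

lemma rho_mult [simp]: "rho (x * y) = rho x * rho y"
  by (cases x; cases y) auto

lemma rho_zero [simp]: "rho 0 = 0"
  by (simp add: triple_zero)

lemma rho_one [simp]: "rho 1 = 1"
  by (simp add: triple_one)

lemma rho_rho_rho [simp]: "rho (rho (rho x)) = x"
  by (cases x) auto

lemma rho_diag [simp]: "rho (diag c) = diag c"
  by (simp add: diag_def)

lemma rho_sum: "rho (sum f A) = (\<Sum>i\<in>A. rho (f i))"
  for f :: "'a \<Rightarrow> 'k::field triple"
  by (rule additive_sum) simp

lemma diag_mult: "diag (c * d) = diag c * diag d"
  by (simp add: diag_def)

lemma diag_add: "diag (c + d) = diag c + diag d"
  by (simp add: diag_def)

lemma diag_zero [simp]: "diag 0 = 0"
  by (simp add: diag_def triple_zero)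

lemma diag_one [simp]: "diag 1 = 1"
  by (simp add: diag_def triple_one)

lemma diag_eq_iff [simp]: "diag c = diag d \<longleftrightarrow> c = d"
  by (auto simp: diag_def)

section \<open>Direct sum decompositions\<close>

text \<open>Existence of a decomposition and independence are separate assumptions because they are
  proved and transported separately. \<open>A\<close> is a set, since the operators to be graded are
  only the linear functions of a type; closure under addition is supplied case by case, as in
  \<open>part_add\<close>.\<close>

locale direct_sum =
  fixes I :: "'g set" and A :: "'a::ab_group_add set" and D :: "'g \<Rightarrow> 'a set"
  assumes D_sub: "g \<in> I \<Longrightarrow> D g \<subseteq> A"
    and D_zero: "g \<in> I \<Longrightarrow> 0 \<in> D g"
    and D_add: "g \<in> I \<Longrightarrow> x \<in> D g \<Longrightarrow> y \<in> D g \<Longrightarrow> x + y \<in> D g"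
    and D_minus: "g \<in> I \<Longrightarrow> x \<in> D g \<Longrightarrow> - x \<in> D g"
    and decomp: "x \<in> A \<Longrightarrow> \<exists>F u. finite F \<and> F \<subseteq> I \<and> (\<forall>g\<in>F. u g \<in> D g) \<and> x = sum u F"
    and indep: "finite F \<Longrightarrow> F \<subseteq> I \<Longrightarrow> (\<And>g. g \<in> F \<Longrightarrow> u g \<in> D g) \<Longrightarrow> sum u F = 0 \<Longrightarrow> g \<in> F \<Longrightarrow> u g = 0"
begin

text \<open>The components vanish off a finite subset of \<open>I\<close>, so that for
  \<open>x \<in> A\<close> the value \<open>part x g\<close> is 0 rather than arbitrary when
  \<open>g\<close> is not an index.\<close>

definition is_part :: "'a \<Rightarrow> ('g \<Rightarrow> 'a) \<Rightarrow> bool" where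
  "is_part x u \<longleftrightarrow> (\<exists>F. finite F \<and> F \<subseteq> I \<and> (\<forall>g\<in>F. u g \<in> D g) \<and> (\<forall>g. g \<notin> F \<longrightarrow> u g = 0) \<and> x = sum u F)"

definition part :: "'a \<Rightarrow> 'g \<Rightarrow> 'a" where
  "part x = (SOME u. is_part x u)"

definition supp :: "'a \<Rightarrow> 'g set" where
  "supp x = {g. part x g \<noteq> 0}"

lemma D_sum: "g \<in> I \<Longrightarrow> (\<And>i. i \<in> S \<Longrightarrow> f i \<in> D g) \<Longrightarrow> sum f S \<in> D g"
  by (induction S rule: infinite_finite_induct) (auto intro: D_zero D_add)

lemma D_diff: "g \<in> I \<Longrightarrow> x \<in> D g \<Longrightarrow> y \<in> D g \<Longrightarrow> x - y \<in> D g"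
  using D_add[of g x "- y"] D_minus by simp

lemma part_ex:
  assumes "x \<in> A"
  shows "\<exists>F. finite F \<and> F \<subseteq> I \<and> (\<forall>g\<in>F. part x g \<in> D g) \<and> (\<forall>g. g \<notin> F \<longrightarrow> part x g = 0) \<and> x = sum (part x) F"
proof -
  obtain F u where F: "finite F" "F \<subseteq> I" "\<forall>g\<in>F. u g \<in> D g" "x = sum u F"
    using decomp[OF assms] by blast
  have "is_part x (\<lambda>g. if g \<in> F then u g else 0)"
    unfolding is_part_def using F by (intro exI[of _ F]) simp
  then have "is_part x (part x)"
    unfolding part_def by (rule someI[of "is_part x"])
  then show ?thesis unfolding is_part_def .
qed

lemma part_in:
  assumes "x \<in> A" "g \<in> I"
  shows "part x g \<in> D g"
proof -
  obtain F where F: "\<forall>g\<in>F. part x g \<in> D g" "\<forall>g. g \<notin> F \<longrightarrow> part x g = 0"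
    using part_ex[OF assms(1)] by blast
  then show ?thesis by (cases "g \<in> F") (simp_all add: D_zero assms)
qed

lemma supp_fin_sub:
  assumes "x \<in> A"
  shows "finite (supp x) \<and> supp x \<subseteq> I"
proof -
  obtain F where F: "finite F" "F \<subseteq> I" "\<forall>g. g \<notin> F \<longrightarrow> part x g = 0"
    using part_ex[OF assms] by blast
  then have "supp x \<subseteq> F" by (auto simp: supp_def)
  then show ?thesis using F by (meson finite_subset order_trans)
qed

lemma supp_sub: "x \<in> A \<Longrightarrow> supp x \<subseteq> I"
  and supp_finite: "x \<in> A \<Longrightarrow> finite (supp x)"
  using supp_fin_sub by simp_all

lemma sum_part:
  assumes "x \<in> A" "finite F" "supp x \<subseteq> F"
  shows "sum (part x) F = x"
proof -
  obtain F' where F': "finite F'" "\<forall>g. g \<notin> F' \<longrightarrow> part x g = 0" "x = sum (part x) F'"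
    using part_ex[OF assms(1)] by blast
  have "sum (part x) F = sum (part x) (supp x)"
    using assms by (intro sum.mono_neutral_right) (auto simp: supp_def)
  also have "\<dots> = sum (part x) F'"
    using F' by (intro sum.mono_neutral_left) (auto simp: supp_def)
  finally show ?thesis using F' by simp
qed

lemma sum_part_supp: "x \<in> A \<Longrightarrow> sum (part x) (supp x) = x"
  by (simp add: sum_part supp_finite)

lemma A_zero: "I \<noteq> {} \<Longrightarrow> 0 \<in> A"
  using D_zero D_sub by auto

text \<open>Two decompositions of \<open>x\<close> are compared on the union of their supports,
  where the differences of components decompose 0.\<close>

lemma part_unique:
  assumes x: "x \<in> A" and F: "finite F" "F \<subseteq> I" "\<And>g. g \<in> F \<Longrightarrow> u g \<in> D g" "x = sum u F"
  shows "part x g = (if g \<in> F then u g else 0)"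
proof (cases "g \<in> F \<union> supp x")
  case False
  then show ?thesis by (auto simp: supp_def)
next
  case True
  let ?u = "\<lambda>g. if g \<in> F then u g else 0"
  let ?H = "F \<union> supp x"
  have fin: "finite ?H" using F supp_finite[OF x] by simp
  have sub: "?H \<subseteq> I" using F supp_sub[OF x] by simp
  have "sum ?u ?H = sum u F"
    using fin by (intro sum.mono_neutral_cong_right) auto
  moreover have "sum (part x) ?H = x" using x fin by (intro sum_part) auto
  ultimately have "sum (\<lambda>g. part x g - ?u g) ?H = 0"
    using F by (simp add: sum_subtractf)
  moreover have "part x g - ?u g \<in> D g" if "g \<in> ?H" for g
    using that sub F(3) part_in[OF x] D_zero by (intro D_diff) auto
  ultimately have "part x g - ?u g = 0"
    using indep[OF fin sub, of "\<lambda>g. part x g - ?u g" g] True by blast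
  then show ?thesis by simp
qed

lemma part_hom:
  assumes "g \<in> I" "x \<in> D g"
  shows "part x k = (if k = g then x else 0)"
proof -
  have "x \<in> A" using assms D_sub by blast
  then show ?thesis using part_unique[of x "{g}" "\<lambda>_. x" k] assms by simp
qed

lemma part_add:
  assumes "x \<in> A" "y \<in> A" "x + y \<in> A"
  shows "part (x + y) g = part x g + part y g"
proof -
  let ?H = "supp x \<union> supp y"
  have fin: "finite ?H" using assms supp_finite by simp
  have sub: "?H \<subseteq> I" using assms supp_sub by blast
  have "x + y = (\<Sum>g\<in>?H. part x g + part y g)"
    using assms fin by (simp add: sum.distrib sum_part)
  then have "part (x + y) g = (if g \<in> ?H then part x g + part y g else 0)"
    using assms sub by (intro part_unique fin) (auto intro!: D_add part_in)
  then show ?thesis by (auto simp: supp_def)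
qed

lemma part_zero: "I \<noteq> {} \<Longrightarrow> part 0 g = 0"
  using part_add[of 0 0 g] A_zero by simp

lemma in_D_if: "x \<in> A \<Longrightarrow> g \<in> I \<Longrightarrow> (\<And>k. k \<in> I \<Longrightarrow> k \<noteq> g \<Longrightarrow> part x k = 0) \<Longrightarrow> x \<in> D g"
proof -
  assume x: "x \<in> A" "g \<in> I" and *: "\<And>k. k \<in> I \<Longrightarrow> k \<noteq> g \<Longrightarrow> part x k = 0"
  have "supp x \<subseteq> {g}" using * supp_sub[OF x(1)] by (auto simp: supp_def)
  then have "x = part x g" using sum_part[OF x(1), of "{g}"] by simp
  then show ?thesis using part_in[OF x] by simp
qed

end

section \<open>Cyclic compositions with a dual pair of bases\<close>

text \<open>The quadratic form is replaced by its polar form, and its multiplicativity by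
  \<open>comp_id\<close>, the polarization of x \<star> (z \<star> x) = \<rho>(Q x) z. The families
  \<open>e\<close> and \<open>e'\<close> carry freeness and nonsingularity in one identity, and a
  value 1 of \<open>b\<close> makes the scalars act faithfully.\<close>

locale cyclic_comp =
  fixes sc :: "'k::field triple \<Rightarrow> 'v::ab_group_add \<Rightarrow> 'v" (infixr \<open>\<bullet>\<close> 75)
    and b :: "'v \<Rightarrow> 'v \<Rightarrow> 'k triple"
    and mul :: "'v \<Rightarrow> 'v \<Rightarrow> 'v" (infixl \<open>\<star>\<close> 72)
    and n :: nat and e e' :: "nat \<Rightarrow> 'v"
  assumes sc_add_right: "l \<bullet> (x + y) = l \<bullet> x + l \<bullet> y"
    and sc_add_left: "(l + m) \<bullet> x = l \<bullet> x + m \<bullet> x"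
    and sc_mult: "(l * m) \<bullet> x = l \<bullet> m \<bullet> x"
    and sc_one: "1 \<bullet> x = x"
    and b_sym: "b x y = b y x"
    and b_add_left: "b (x + y) z = b x z + b y z"
    and b_sc_left: "b (l \<bullet> x) y = l * b x y"
    and dual: "(\<Sum>i<n. b (e' i) v \<bullet> e i) = v"
    and unit_ex: "\<exists>x y. b x y = 1"
    and mul_add_left: "(x + y) \<star> z = x \<star> z + y \<star> z"
    and mul_add_right: "x \<star> (y + z) = x \<star> y + x \<star> z"
    and mul_sc_left: "(l \<bullet> x) \<star> y = rho l \<bullet> (x \<star> y)"
    and mul_sc_right: "x \<star> (l \<bullet> y) = rho (rho l) \<bullet> (x \<star> y)"
    and cyc: "b (x \<star> y) z = rho (b (y \<star> z) x)"
    and comp_id: "x \<star> (z \<star> y) + y \<star> (z \<star> x) = rho (b x y) \<bullet> z"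
begin

lemma b_add_right: "b x (y + z) = b x y + b x z"
  using b_add_left[of y z x] by (simp add: b_sym[of x])

lemma b_sc_right: "b x (l \<bullet> y) = l * b x y"
  using b_sc_left[of l y x] by (simp add: b_sym[of x])

lemma cyc2: "b (x \<star> y) z = rho (rho (b (z \<star> x) y))"
  using cyc[of z x y] by simp

lemma sc_sum_right: "l \<bullet> sum f A = (\<Sum>i\<in>A. l \<bullet> f i)"
  by (rule additive_sum) (rule sc_add_right)

lemma sc_zero_right [simp]: "l \<bullet> 0 = 0"
  by (rule additive_zero) (rule sc_add_right)

lemma sc_zero_left [simp]: "0 \<bullet> x = 0"
  by (rule additive_zero[of "\<lambda>l. l \<bullet> x"]) (rule sc_add_left)

lemma sc_minus_one: "(- 1) \<bullet> x = - x"
  using sc_add_left[of "- 1" 1 x] by (simp add: sc_one eq_neg_iff_add_eq_0)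

lemma b_sum_left: "b (sum f A) y = (\<Sum>i\<in>A. b (f i) y)"
  by (rule additive_sum[of "\<lambda>x. b x y"]) (rule b_add_left)

lemma b_sum_right: "b y (sum f A) = (\<Sum>i\<in>A. b y (f i))"
  by (rule additive_sum) (rule b_add_right)

lemma mul_sum_right: "y \<star> sum f A = (\<Sum>i\<in>A. y \<star> f i)"
  by (rule additive_sum) (rule mul_add_right)

lemma b_zero_left [simp]: "b 0 y = 0"
  by (rule additive_zero[of "\<lambda>x. b x y"]) (rule b_add_left)

lemma b_zero_right [simp]: "b y 0 = 0"
  by (simp add: b_sym[of y])

lemma sc_commute: "l \<bullet> m \<bullet> x = m \<bullet> l \<bullet> x"
  by (metis sc_mult mult.commute)

lemma nondeg: "(\<And>x. b x v = 0) \<Longrightarrow> v = 0"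
  using dual[of v] by simp

lemma eq_if_b_eq:
  assumes "\<And>x. b x v = b x w"
  shows "v = w"
proof -
  have "b x (v - w) = 0" for x
    using b_add_right[of x "v - w" w] assms[of x] by simp
  from nondeg[OF this] show ?thesis by simp
qed

text \<open>Pairing with an arbitrary x moves the sum to the other argument of the form, where
  \<open>dual\<close> applies to x; nondegeneracy concludes.\<close>

lemma dual': "(\<Sum>i<n. b (e i) v \<bullet> e' i) = v"
proof (rule eq_if_b_eq)
  fix x
  have "b x (\<Sum>i<n. b (e i) v \<bullet> e' i) = (\<Sum>i<n. b (e i) v * b x (e' i))"
    by (simp add: b_sum_right b_sc_right)
  also have "\<dots> = (\<Sum>i<n. b (e' i) x * b (e i) v)"
    by (rule sum.cong) (simp_all add: b_sym[of x] mult.commute)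
  also have "\<dots> = b (\<Sum>i<n. b (e' i) x \<bullet> e i) v"
    by (simp add: b_sum_left b_sc_left)
  finally show "b x (\<Sum>i<n. b (e i) v \<bullet> e' i) = b x v" by (simp add: dual)
qed

definition lin :: "('v \<Rightarrow> 'v) \<Rightarrow> bool" where
  "lin a \<longleftrightarrow> (\<forall>x y. a (x + y) = a x + a y) \<and> (\<forall>l x. a (l \<bullet> x) = l \<bullet> a x)"

definition ten :: "'v \<Rightarrow> 'v \<Rightarrow> 'v \<Rightarrow> 'v" where
  "ten x y = (\<lambda>v. b y v \<bullet> x)"

definition sca :: "'k triple \<Rightarrow> ('v \<Rightarrow> 'v) \<Rightarrow> 'v \<Rightarrow> 'v" where
  "sca l a = (\<lambda>v. l \<bullet> a v)"

lemma lin_add: "lin a \<Longrightarrow> a (x + y) = a x + a y"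
  and lin_sc: "lin a \<Longrightarrow> a (l \<bullet> x) = l \<bullet> a x"
  by (auto simp: lin_def)

lemma lin_sum: "lin a \<Longrightarrow> a (sum f A) = (\<Sum>i\<in>A. a (f i))"
  by (rule additive_sum) (rule lin_add)

lemma lin_zero: "lin a \<Longrightarrow> a 0 = 0"
  by (rule additive_zero) (rule lin_add)

lemma lin_plus: "lin a \<Longrightarrow> lin c \<Longrightarrow> lin (a + c)"
  by (simp add: lin_def sc_add_right)

lemma lin_0 [simp]: "lin 0"
  by (simp add: lin_def)

lemma lin_sumI: "(\<And>i. i \<in> A \<Longrightarrow> lin (f i)) \<Longrightarrow> lin (sum f A)"
  by (induction A rule: infinite_finite_induct) (auto intro: lin_plus)

lemma lin_comp: "lin a \<Longrightarrow> lin c \<Longrightarrow> lin (a \<circ> c)"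
  by (simp add: lin_def)

lemma lin_id [simp]: "lin id"
  by (simp add: lin_def)

lemma lin_sca: "lin a \<Longrightarrow> lin (sca l a)"
  by (simp add: lin_def sca_def sc_add_right sc_commute)

lemma lin_ten [simp]: "lin (ten x y)"
  by (simp add: lin_def ten_def b_add_right b_sc_right sc_add_left sc_mult)

lemma comp_ten: "lin a \<Longrightarrow> a \<circ> ten x y = ten (a x) y"
  by (auto simp: ten_def fun_eq_iff lin_sc)

lemma sca_ten: "sca l (ten x y) = ten (l \<bullet> x) y"
  by (auto simp: ten_def sca_def fun_eq_iff sc_commute)

lemma sca_ten': "sca l (ten x y) = ten x (l \<bullet> y)"
  by (auto simp: ten_def sca_def fun_eq_iff b_sc_left sc_mult)

lemma ten_add_left: "ten (x + y) z = ten x z + ten y z"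
  by (auto simp: ten_def fun_eq_iff sc_add_right)

lemma ten_add_right: "ten x (y + z) = ten x y + ten x z"
  by (auto simp: ten_def fun_eq_iff b_add_left sc_add_left)

lemma sca_add: "sca l (a + c) = sca l a + sca l c"
  by (auto simp: sca_def fun_eq_iff sc_add_right)

lemma sca_add_left: "sca (l + m) a = sca l a + sca m a"
  by (auto simp: sca_def fun_eq_iff sc_add_left)

lemma sca_sca: "sca l (sca m a) = sca (l * m) a"
  by (auto simp: sca_def fun_eq_iff sc_mult)

lemma sca_one [simp]: "sca 1 a = a"
  by (auto simp: sca_def fun_eq_iff sc_one)

lemma sca_zero [simp]: "sca 0 a = 0"
  by (auto simp: sca_def fun_eq_iff)

lemma sca_zero_right [simp]: "sca l 0 = 0"
  by (auto simp: sca_def fun_eq_iff)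

lemma sca_sum: "sca l (sum f A) = (\<Sum>i\<in>A. sca l (f i))"
  by (rule additive_sum[of "sca l"]) (rule sca_add)

lemma sca_sum_left: "sca (sum f A) a = (\<Sum>i\<in>A. sca (f i) a)"
  by (rule additive_sum[of "\<lambda>l. sca l a"]) (rule sca_add_left)

lemma sca_id_eq: "sca l id = sca m id \<longleftrightarrow> l = m"
proof
  assume *: "sca l id = sca m id"
  obtain x y where xy: "b x y = 1" using unit_ex by blast
  have "l \<bullet> x = m \<bullet> x" using fun_cong[OF *, of x] by (simp add: sca_def)
  then have "b (l \<bullet> x) y = b (m \<bullet> x) y" by simp
  then show "l = m" using xy by (simp add: b_sc_left)
qed simp

lemma sca_comp: "sca l a \<circ> c = sca l (a \<circ> c)"
  by (auto simp: sca_def)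

lemma comp_sca: "lin a \<Longrightarrow> a \<circ> sca l c = sca l (a \<circ> c)"
  by (auto simp: sca_def lin_sc)

lemma comp_add_distrib: "(a + c) \<circ> d = (a \<circ> d) + (c \<circ> d)" for a c d :: "'v \<Rightarrow> 'v"
  by auto

lemma comp_add_distrib_right: "lin d \<Longrightarrow> d \<circ> (a + c) = (d \<circ> a) + (d \<circ> c)"
  by (auto simp: lin_add)

text \<open>The rank one operators identify \<open>End(V)\<close> with \<open>V \<otimes> V\<close>; \<open>lift B\<close> is the map on it induced
  by a balanced biadditive \<open>B\<close>.\<close>

definition lift :: "('v \<Rightarrow> 'v \<Rightarrow> 'm::ab_group_add) \<Rightarrow> ('v \<Rightarrow> 'v) \<Rightarrow> 'm" where
  "lift B a = (\<Sum>i<n. B (a (e i)) (e' i))"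

definition balanced :: "('v \<Rightarrow> 'v \<Rightarrow> 'm::ab_group_add) \<Rightarrow> bool" where
  "balanced B \<longleftrightarrow> (\<forall>x y z. B (x + y) z = B x z + B y z) \<and> (\<forall>x y z. B x (y + z) = B x y + B x z)
     \<and> (\<forall>l x y. B (l \<bullet> x) y = B x (l \<bullet> y))"

lemma lift_add: "balanced B \<Longrightarrow> lift B (a + c) = lift B a + lift B c"
  by (simp add: lift_def balanced_def sum.distrib)

lemma lift_sum: "balanced B \<Longrightarrow> lift B (sum f A) = (\<Sum>i\<in>A. lift B (f i))"
  by (rule additive_sum[of "lift B"]) (rule lift_add)

text \<open>The coefficients b(y, e_i) are moved by balance to the second slot, where they
  reassemble y from \<open>e'\<close>.\<close>

lemma lift_ten:
  assumes "balanced B"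
  shows "lift B (ten x y) = B x y"
proof -
  have "lift B (ten x y) = (\<Sum>i<n. B x (b (e i) y \<bullet> e' i))"
    using assms by (simp add: lift_def ten_def balanced_def b_sym)
  also have "\<dots> = B x (\<Sum>i<n. b (e i) y \<bullet> e' i)"
    using assms by (intro additive_sum[of "B x", symmetric]) (simp add: balanced_def)
  finally show ?thesis by (simp add: dual')
qed

lemma ten_expand: "lin a \<Longrightarrow> (\<Sum>i<n. ten (a (e i)) (e' i)) = a"
proof
  fix v assume a: "lin a"
  have "(\<Sum>i<n. ten (a (e i)) (e' i)) v = a (\<Sum>i<n. b (e' i) v \<bullet> e i)"
    by (simp add: sum_fun_apply ten_def lin_sum[OF a] lin_sc[OF a])
  then show "(\<Sum>i<n. ten (a (e i)) (e' i)) v = a v" by (simp add: dual)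
qed

lemma ten_eq_0:
  assumes "\<And>y. ten x y = 0"
  shows "x = 0"
proof -
  obtain y v where "b y v = 1" using unit_ex by blast
  then show ?thesis using fun_cong[OF assms[of y], of v] by (simp add: ten_def sc_one)
qed

section \<open>The adjoint, the trace and the triality maps\<close>

text \<open>On V \<otimes> V the adjoint is the exchange of the two factors, applied here to the
  expansion of \<open>a\<close> in \<open>ten_expand\<close>.\<close>

definition adj :: "('v \<Rightarrow> 'v) \<Rightarrow> 'v \<Rightarrow> 'v" where
  "adj a = (\<Sum>i<n. ten (e' i) (a (e i)))"

text \<open>Contraction of V \<otimes> V by the form is the L-valued trace of the operator.\<close>

definition tr :: "('v \<Rightarrow> 'v) \<Rightarrow> 'k triple" where
  "tr = lift b"

text \<open>In terms of left and right multiplications this is l_x c r_y. Inserting \<open>c\<close>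
  lets one formula serve both for \<open>\<alpha>\<^sub>1\<close> and for the tensor square of the
  product.\<close>

definition LR :: "('v \<Rightarrow> 'v) \<Rightarrow> 'v \<Rightarrow> 'v \<Rightarrow> 'v \<Rightarrow> 'v" where
  "LR c x y = (\<lambda>v. x \<star> c (v \<star> y))"

definition RL :: "'v \<Rightarrow> 'v \<Rightarrow> 'v \<Rightarrow> 'v" where
  "RL x y = (\<lambda>v. (y \<star> v) \<star> x)"

text \<open>Only the first argument is expanded into rank one operators, so the formula makes sense
  for every function \<open>c\<close>, in particular for \<open>id\<close>. The symmetric
  description on rank one operators is \<open>\<Phi>_ten_ten\<close>.\<close>

definition \<Phi> :: "('v \<Rightarrow> 'v) \<Rightarrow> ('v \<Rightarrow> 'v) \<Rightarrow> 'v \<Rightarrow> 'v" where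
  "\<Phi> a c = lift (LR c) a"

abbreviation \<alpha>\<^sub>1 :: "('v \<Rightarrow> 'v) \<Rightarrow> 'v \<Rightarrow> 'v" where
  "\<alpha>\<^sub>1 a \<equiv> \<Phi> a id"

definition \<alpha>\<^sub>2 :: "('v \<Rightarrow> 'v) \<Rightarrow> 'v \<Rightarrow> 'v" where
  "\<alpha>\<^sub>2 a = lift RL a"

lemma balanced_b: "balanced b"
  by (simp add: balanced_def b_add_left b_add_right b_sc_left b_sc_right)

lemma balanced_ten_swap: "balanced (\<lambda>x y. ten y x)"
  by (simp add: balanced_def ten_add_left ten_add_right flip: sca_ten sca_ten')

lemma balanced_LR: "lin c \<Longrightarrow> balanced (LR c)"
  by (auto simp: balanced_def LR_def mul_add_left mul_add_right mul_sc_left mul_sc_right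
     lin_add lin_sc fun_eq_iff)

lemma balanced_RL: "balanced RL"
  by (auto simp: balanced_def RL_def mul_add_left mul_add_right mul_sc_left mul_sc_right fun_eq_iff)

lemma adj_lift: "adj a = lift (\<lambda>x y. ten y x) a"
  by (simp add: adj_def lift_def)

lemma adj_ten [simp]: "adj (ten x y) = ten y x"
  by (simp add: adj_lift lift_ten balanced_ten_swap)

lemma lin_adj [simp]: "lin (adj a)"
  by (auto simp: adj_def intro: lin_sumI)

lemma adj_add: "adj (a + c) = adj a + adj c"
  by (simp add: adj_lift lift_add balanced_ten_swap)

lemma adj_iff: "lin a \<Longrightarrow> b (a x) y = b x (adj a y)"
proof -
  assume a: "lin a"
  have "b x (adj a y) = b (a (\<Sum>i<n. b (e' i) x \<bullet> e i)) y"
    by (simp add: adj_def sum_fun_apply ten_def b_sum_right b_sc_right lin_sum[OF a] lin_sc[OF a]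
        b_sum_left b_sc_left b_sym mult.commute)
  then show ?thesis by (simp add: dual)
qed

lemma adj_unique:
  assumes a: "lin a" and "\<And>x y. b (a x) y = b x (c y)"
  shows "c = adj a"
proof
  show "c y = adj a y" for y
    by (rule eq_if_b_eq) (simp add: assms flip: adj_iff)
qed

lemma adj_adj: "lin a \<Longrightarrow> adj (adj a) = a"
  using adj_unique[of "adj a" a] adj_iff by (metis b_sym lin_adj)

lemma ten_expand_adj: "lin a \<Longrightarrow> (\<Sum>j<n. ten (e' j) (adj a (e j))) = a"
  using adj_adj[of a] by (simp add: adj_def[of "adj a"])

lemma adj_sca: "lin a \<Longrightarrow> adj (sca l a) = sca l (adj a)"
  by (rule adj_unique[symmetric]) (auto simp: sca_def b_sc_left b_sc_right adj_iff lin_sca[unfolded sca_def])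

lemma comp_ten_adj: "lin a \<Longrightarrow> ten x y \<circ> a = ten x (adj a y)"
  by (auto simp: ten_def fun_eq_iff) (metis adj_iff b_sym)

lemma tr_ten [simp]: "tr (ten x y) = b x y"
  by (simp add: tr_def lift_ten balanced_b)

lemma tr_add: "tr (a + c) = tr a + tr c"
  by (simp add: tr_def lift_add balanced_b)

lemma tr_sum: "tr (sum f A) = (\<Sum>i\<in>A. tr (f i))"
  by (rule additive_sum[of tr]) (rule tr_add)

lemma tr_sca: "lin a \<Longrightarrow> tr (sca l a) = l * tr a"
  by (simp add: tr_def lift_def sca_def b_sc_left sum_distrib_left)

lemma \<Phi>_ten: "lin c \<Longrightarrow> \<Phi> (ten x y) c = (\<lambda>v. x \<star> c (v \<star> y))"
  by (simp add: \<Phi>_def lift_ten balanced_LR) (simp add: LR_def)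

lemma \<alpha>\<^sub>2_ten: "\<alpha>\<^sub>2 (ten x y) = (\<lambda>v. (y \<star> v) \<star> x)"
  by (simp add: \<alpha>\<^sub>2_def lift_ten balanced_RL) (simp add: RL_def)

lemma \<alpha>\<^sub>2_add: "\<alpha>\<^sub>2 (a + c) = \<alpha>\<^sub>2 a + \<alpha>\<^sub>2 c"
  by (simp add: \<alpha>\<^sub>2_def lift_add balanced_RL)

lemma \<alpha>\<^sub>2_sum: "\<alpha>\<^sub>2 (sum f A) = (\<Sum>i\<in>A. \<alpha>\<^sub>2 (f i))"
  by (rule additive_sum[of \<alpha>\<^sub>2]) (rule \<alpha>\<^sub>2_add)

lemma \<Phi>_add_left: "lin c \<Longrightarrow> \<Phi> (a + a') c = \<Phi> a c + \<Phi> a' c"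
  by (simp add: \<Phi>_def lift_add balanced_LR)

lemma \<Phi>_sum_left: "lin c \<Longrightarrow> \<Phi> (sum f A) c = (\<Sum>i\<in>A. \<Phi> (f i) c)"
  by (rule additive_sum[of "\<lambda>a. \<Phi> a c"]) (rule \<Phi>_add_left)

lemma \<Phi>_add_right: "\<Phi> a (c + c') = \<Phi> a c + \<Phi> a c'"
  by (auto simp: \<Phi>_def lift_def LR_def fun_eq_iff sum_fun_apply mul_add_right sum.distrib)

lemma \<Phi>_sca_left: "\<Phi> (sca l a) c = sca (rho l) (\<Phi> a c)"
  by (auto simp: \<Phi>_def lift_def LR_def fun_eq_iff sum_fun_apply sca_def sc_sum_right mul_sc_left)

lemma \<Phi>_sca_right: "\<Phi> a (sca l c) = sca (rho (rho l)) (\<Phi> a c)"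
  by (auto simp: \<Phi>_def lift_def LR_def fun_eq_iff sum_fun_apply sca_def sc_sum_right mul_sc_right)

lemma lin_\<Phi>: "lin c \<Longrightarrow> lin (\<Phi> a c)"
  unfolding \<Phi>_def lift_def
  by (rule lin_sumI) (simp add: LR_def lin_def mul_add_left mul_add_right mul_sc_left mul_sc_right)

lemma lin_\<alpha>\<^sub>2: "lin (\<alpha>\<^sub>2 a)"
  unfolding \<alpha>\<^sub>2_def lift_def
  by (rule lin_sumI) (simp add: RL_def lin_def mul_add_left mul_add_right mul_sc_left mul_sc_right)

text \<open>The scalar b(q, v \<star> y) leaves the second argument of x \<star> as its image under
  \<rho>^2, which cyclicity turns into b(y \<star> q, v).\<close>

lemma \<Phi>_ten_ten: "\<Phi> (ten x y) (ten p q) = ten (x \<star> p) (y \<star> q)"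
proof -
  have "x \<star> (b q (v \<star> y) \<bullet> p) = b (y \<star> q) v \<bullet> (x \<star> p)" for v
    using cyc2[of y q v] by (simp add: mul_sc_right b_sym)
  then show ?thesis by (simp add: \<Phi>_ten) (simp add: ten_def)
qed

text \<open>On x \<otimes> y + y \<otimes> x this is the polarized composition law. It expresses the
  trace through \<open>\<alpha>\<^sub>1\<close> and \<open>adj\<close>, which respect degrees, and
  so makes the trace respect degrees too.\<close>

lemma trace_identity:
  assumes a: "lin a"
  shows "\<alpha>\<^sub>1 (a + adj a) = sca (rho (tr a)) id"
proof -
  have 1: "\<alpha>\<^sub>1 (ten x y + ten y x) = sca (rho (b x y)) id" for x y
    by (auto simp: \<Phi>_add_left \<Phi>_ten sca_def fun_eq_iff comp_id)
  have "a + adj a = (\<Sum>i<n. ten (a (e i)) (e' i) + ten (e' i) (a (e i)))"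
    using ten_expand[OF a] by (simp add: sum.distrib adj_def)
  then have "\<alpha>\<^sub>1 (a + adj a) = (\<Sum>i<n. sca (rho (b (a (e i)) (e' i))) id)"
    by (simp add: \<Phi>_sum_left 1)
  then show ?thesis by (simp add: tr_def lift_def rho_sum sca_sum_left)
qed

text \<open>With \<open>c\<close> expanded into rank one operators, the two traces differ by moving
  \<open>a\<close> across the form as its adjoint.\<close>

lemma tr_comp:
  assumes a: "lin a" and c: "lin c"
  shows "tr (a \<circ> c) = tr (c \<circ> a)"
proof -
  have "tr (a \<circ> c) = tr (\<Sum>i<n. a \<circ> ten (c (e i)) (e' i))"
    by (rule arg_cong[of _ _ tr], subst ten_expand[OF c, symmetric])
      (simp add: sum_fun_apply fun_eq_iff lin_sum[OF a])
  also have "\<dots> = (\<Sum>i<n. b (a (c (e i))) (e' i))"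
    by (simp add: tr_sum comp_ten[OF a])
  also have "\<dots> = (\<Sum>i<n. b (c (e i)) (adj a (e' i)))"
    by (simp add: adj_iff[OF a])
  also have "\<dots> = tr (\<Sum>i<n. ten (c (e i)) (e' i) \<circ> a)"
    by (simp add: tr_sum comp_ten_adj[OF a])
  also have "(\<Sum>i<n. ten (c (e i)) (e' i) \<circ> a) = c \<circ> a"
    by (subst (2) ten_expand[OF c, symmetric]) (simp add: sum_fun_apply fun_eq_iff)
  finally show ?thesis .
qed

end

section \<open>Type III gradings of the endomorphism algebra\<close>

declare plus_fun_apply [simp del] zero_fun_apply [simp del] o_apply [simp del] id_apply [simp del]

lemmas fun_simps = fun_eq_iff plus_fun_apply zero_fun_apply o_apply id_apply sum_fun_apply

text \<open>Sums are enough: the set whose span is taken below, \<open>tame\<close>, is itself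
  stable under homogeneous scalars.\<close>

inductive_set add_span :: "'a::ab_group_add set \<Rightarrow> 'a set" for S where
  zero: "0 \<in> add_span S"
| incl: "x \<in> S \<Longrightarrow> x \<in> add_span S"
| add: "x \<in> add_span S \<Longrightarrow> y \<in> add_span S \<Longrightarrow> x + y \<in> add_span S"

lemma add_span_sum: "(\<And>i. i \<in> F \<Longrightarrow> f i \<in> add_span S) \<Longrightarrow> sum f F \<in> add_span S"
  by (induction F rule: infinite_finite_induct) (auto intro: add_span.intros)

definition trace3 :: "'k::field triple \<Rightarrow> 'k" where
  "trace3 l = fst l + fst (snd l) + snd (snd l)"

text \<open>All indices from 2 on denote the third idempotent, so being a nonzero idempotent holds
  for every natural number; only orthogonality asks for indices below 3.\<close>

definition idem3 :: "nat \<Rightarrow> 'k::field triple" where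
  "idem3 i = (if i = 0 then (1, 0, 0) else if i = 1 then (0, 1, 0) else (0, 0, 1))"

lemma trace3_add: "trace3 (l + m) = trace3 l + trace3 m"
  by (simp add: trace3_def)

text \<open>The three idempotents form a basis that is its own dual for the trace form of L over
  F.\<close>

lemma sum_trace3_idem3: "(\<Sum>i<3. diag (trace3 (idem3 i * l)) * idem3 i) = l"
  by (cases l) (simp add: numeral_3_eq_3 idem3_def trace3_def diag_def zero_prod_def one_prod_def)

lemma idem3_idem [simp]: "idem3 i * idem3 i = idem3 i"
  by (simp add: idem3_def)

lemma sum_idem3: "(\<Sum>i<3. idem3 i) = (1 :: 'k::field triple)"
  by (simp add: numeral_3_eq_3 idem3_def triple_one)

context cyclic_comp
begin

text \<open>Additivity is asked on linear operators only, because it will be applied to homogeneous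
  components and to the automorphism \<psi>, whose additivity is available only there.\<close>

definition biadd :: "(('v \<Rightarrow> 'v) \<Rightarrow> ('v \<Rightarrow> 'v) \<Rightarrow> 'm::ab_group_add) \<Rightarrow> bool" where
  "biadd B \<longleftrightarrow> (\<forall>P P' R. lin P \<longrightarrow> lin P' \<longrightarrow> lin R \<longrightarrow> B (P + P') R = B P R + B P' R \<and> B R (P + P') = B R P + B R P')"

lemma biadd_zero: "biadd B \<Longrightarrow> lin R \<Longrightarrow> B 0 R = 0"
  unfolding biadd_def by (metis add_cancel_right_right lin_0)

lemma biadd_zero': "biadd B \<Longrightarrow> lin R \<Longrightarrow> B R 0 = 0"
  unfolding biadd_def by (metis add_cancel_right_right lin_0)

lemma biadd_sum_left:
  assumes "biadd B" "lin R" "\<And>i. i \<in> F \<Longrightarrow> lin (f i)"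
  shows "B (sum f F) R = (\<Sum>i\<in>F. B (f i) R)"
  using assms(3)
proof (induction F rule: infinite_finite_induct)
  case (insert x F)
  have "lin (sum f F)" "lin (f x)" using insert.prems by (auto intro: lin_sumI)
  then show ?case using insert assms(1,2) by (simp add: biadd_def)
qed (use assms in \<open>simp_all add: biadd_zero\<close>)

lemma biadd_sum_right:
  assumes "biadd B" "lin R" "\<And>i. i \<in> F \<Longrightarrow> lin (f i)"
  shows "B R (sum f F) = (\<Sum>i\<in>F. B R (f i))"
  using assms(3)
proof (induction F rule: infinite_finite_induct)
  case (insert x F)
  have "lin (sum f F)" "lin (f x)" using insert.prems by (auto intro: lin_sumI)
  then show ?case using insert assms(1,2) by (simp add: biadd_def)
qed (use assms in \<open>simp_all add: biadd_zero'\<close>)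

lemmas biadd_sum = biadd_sum_left biadd_sum_right

end

text \<open>\<open>gen\<close> is an induction principle: the operators
  \<open>\<alpha>\<^sub>2 a\<close> generate all linear operators as an algebra over L, expressed by
  closure under left composition. The last three assumptions are Type III, read off from the scalar
  operators.\<close>

locale graded_cyclic_comp = cyclic_comp sc b mul n e e' + G: comm_group G
    + E: direct_sum "carrier G" "Collect (cyclic_comp.lin sc)" D
  for sc :: "'k::alg_closed_field triple \<Rightarrow> 'v::ab_group_add \<Rightarrow> 'v" (infixr \<open>\<bullet>\<close> 75)
    and b and mul (infixl \<open>\<star>\<close> 72) and n e e'
    and G :: "('g, 'm) monoid_scheme" (structure) and D +
  fixes \<omega> :: 'k and h :: 'g
  assumes D_mult: "g \<in> carrier G \<Longrightarrow> k \<in> carrier G \<Longrightarrow> a \<in> D g \<Longrightarrow> c \<in> D k \<Longrightarrow> a \<circ> c \<in> D (g \<otimes> k)"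
    and D_diag: "g \<in> carrier G \<Longrightarrow> a \<in> D g \<Longrightarrow> sca (diag s) a \<in> D g"
    and D_adj: "g \<in> carrier G \<Longrightarrow> a \<in> D g \<Longrightarrow> adj a \<in> D g"
    and D_\<alpha>\<^sub>1: "g \<in> carrier G \<Longrightarrow> a \<in> D g \<Longrightarrow> \<alpha>\<^sub>1 a \<in> D g"
    and D_\<alpha>\<^sub>2: "g \<in> carrier G \<Longrightarrow> a \<in> D g \<Longrightarrow> \<alpha>\<^sub>2 a \<in> D g"
    and gen: "id \<in> B \<Longrightarrow> (\<And>a c. a \<in> B \<Longrightarrow> c \<in> B \<Longrightarrow> a + c \<in> B) \<Longrightarrow> (\<And>l a. a \<in> B \<Longrightarrow> sca l a \<in> B) \<Longrightarrow>
      (\<And>a c. lin a \<Longrightarrow> c \<in> B \<Longrightarrow> \<alpha>\<^sub>2 a \<circ> c \<in> B) \<Longrightarrow> lin a \<Longrightarrow> a \<in> B"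
    and \<omega>: "\<omega> ^ 3 = 1" "\<omega> \<noteq> 1"
    and h: "h \<in> carrier G" "group.ord G h = 3"
    and L1: "{l. sca l id \<in> D \<one>} = range diag"
    and Lh: "{l. sca l id \<in> D h} = range (\<lambda>c. diag c * (1, \<omega>, \<omega>\<^sup>2))"
    and Lhh: "{l. sca l id \<in> D (h \<otimes> h)} = range (\<lambda>c. diag c * ((1, \<omega>, \<omega>\<^sup>2) * (1, \<omega>, \<omega>\<^sup>2)))"
begin

definition LD :: "'g \<Rightarrow> 'k triple set" where
  "LD g = {l. sca l id \<in> D g}"

definition xi :: "'k triple" where
  "xi = (1, \<omega>, \<omega>\<^sup>2)"

lemma h_facts: "h \<noteq> \<one>" "h \<otimes> h \<noteq> \<one>" "h \<otimes> h \<noteq> h" "h \<otimes> h \<otimes> h = \<one>" "h \<otimes> h \<in> carrier G"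
proof -
  have *: "h [^] n = \<one> \<longleftrightarrow> 3 dvd n" for n :: nat
    using G.pow_eq_id[OF h(1), of n] h(2) by simp
  show "h \<noteq> \<one>" using *[of 1] h(1) by auto
  have "\<not> 3 dvd (2 :: nat)" by simp
  then show "h \<otimes> h \<noteq> \<one>" using *[of 2] h(1) by (auto simp: numeral_2_eq_2 simp del: One_nat_def)
  show "h \<otimes> h \<otimes> h = \<one>" using *[of 3] h(1) by (auto simp: numeral_3_eq_3)
  show "h \<otimes> h \<noteq> h" using \<open>h \<noteq> \<one>\<close> h(1) by (metis G.r_cancel_one)
  show "h \<otimes> h \<in> carrier G" using h(1) by simp
qed

lemma \<omega>_sum: "1 + \<omega> + \<omega>\<^sup>2 = 0"
proof -
  have "(\<omega> - 1) * (1 + \<omega> + \<omega>\<^sup>2) = 0"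
    using \<omega>(1) by (simp add: algebra_simps power2_eq_square power3_eq_cube)
  then show ?thesis using \<omega>(2) by simp
qed

text \<open>In characteristic 3 cubing is additive, so (\<omega> - 1)^3 = \<omega>^3 - 1 = 0 would
  give \<omega> = 1.\<close>

lemma three_nonzero: "(3 :: 'k) \<noteq> 0"
proof
  assume 3: "(3 :: 'k) = 0"
  have "(\<omega> - 1) ^ 3 = \<omega> ^ 3 - 1 - 3 * (\<omega>\<^sup>2 - \<omega>)"
    by (simp add: algebra_simps power2_eq_square power3_eq_cube)
  also have "\<dots> = 0" using 3 \<omega> by simp
  finally show False using \<omega>(2) by simp
qed

lemma D_lin: "g \<in> carrier G \<Longrightarrow> a \<in> D g \<Longrightarrow> lin a"
  using E.D_sub by blast

lemma sca_id_zero: "sca l id = 0 \<longleftrightarrow> l = 0"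
  using sca_id_eq[of l 0] unfolding sca_zero .

lemma LD_one: "LD \<one> = range diag"
  and LD_h: "LD h = range (\<lambda>c. diag c * xi)"
  and LD_hh: "LD (h \<otimes> h) = range (\<lambda>c. diag c * (xi * xi))"
  using L1 Lh Lhh by (auto simp: LD_def xi_def)

lemma L_decomp: "\<exists>c0 c1 c2. l = diag c0 + diag c1 * xi + diag c2 * (xi * xi)"
proof (cases l)
  case (fields x y z)
  \<comment> \<open>Fourier coefficients of (x, y, z) for the cyclic group of order 3; \<omega>^2
    and \<omega> occur as the inverses of \<omega> and \<omega>^2.\<close>
  define p where "p = (x + y + z) / 3"
  define q where "q = (x + \<omega>\<^sup>2 * y + \<omega> * z) / 3"
  define r where "r = (x + \<omega> * y + \<omega>\<^sup>2 * z) / 3"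
  have pqr: "3 * p = x + y + z" "3 * q = x + \<omega>\<^sup>2 * y + \<omega> * z" "3 * r = x + \<omega> * y + \<omega>\<^sup>2 * z"
    using three_nonzero by (simp_all add: p_def q_def r_def)
  have s: "1 + \<omega>\<^sup>2 + \<omega> = 0" using \<omega>_sum by (simp only: ac_simps)
  have "3 * (p + q + r) = 3 * p + 3 * q + 3 * r" by (simp only: distrib_left)
  also have "\<dots> = 3 * x + (1 + \<omega> + \<omega>\<^sup>2) * (y + z)"
    unfolding pqr by (simp add: algebra_simps)
  also have "\<dots> = 3 * x" unfolding \<omega>_sum by simp
  finally have x: "p + q + r = x" by (rule iffD1[OF mult_left_cancel[OF three_nonzero]])
  have "3 * (p + q * \<omega> + r * \<omega>\<^sup>2) = 3 * p + 3 * q * \<omega> + 3 * r * \<omega>\<^sup>2"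
    by (simp only: distrib_left mult.assoc)
  also have "\<dots> = (1 + \<omega> + \<omega>\<^sup>2) * x + (1 + 2 * \<omega> ^ 3) * y + (1 + \<omega>\<^sup>2 + \<omega> ^ 3 * \<omega>) * z"
    unfolding pqr by (simp add: algebra_simps power2_eq_square power3_eq_cube)
  also have "\<dots> = 3 * y" unfolding \<omega>_sum \<omega>(1) mult_1 s by simp
  finally have y: "p + q * \<omega> + r * \<omega>\<^sup>2 = y" by (rule iffD1[OF mult_left_cancel[OF three_nonzero]])
  have "3 * (p + q * \<omega>\<^sup>2 + r * (\<omega>\<^sup>2 * \<omega>\<^sup>2)) = 3 * p + 3 * q * \<omega>\<^sup>2 + 3 * r * (\<omega>\<^sup>2 * \<omega>\<^sup>2)"
    by (simp only: distrib_left mult.assoc)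
  also have "\<dots> = (1 + \<omega>\<^sup>2 + \<omega> ^ 3 * \<omega>) * x + (1 + \<omega> ^ 3 * \<omega> + \<omega> ^ 3 * \<omega>\<^sup>2) * y
      + (1 + \<omega> ^ 3 + \<omega> ^ 3 * \<omega> ^ 3) * z"
    unfolding pqr by (simp add: algebra_simps power2_eq_square power3_eq_cube)
  also have "\<dots> = 3 * z" unfolding \<omega>(1) mult_1 s \<omega>_sum by simp
  finally have z: "p + q * \<omega>\<^sup>2 + r * (\<omega>\<^sup>2 * \<omega>\<^sup>2) = z" by (rule iffD1[OF mult_left_cancel[OF three_nonzero]])
  have "l = diag p + diag q * xi + diag r * (xi * xi)"
    unfolding fields diag_def xi_def triple_times add_Pair mult_1_right x z using y
    by (simp only: power2_eq_square)
  then show ?thesis by blast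
qed

text \<open>By \<open>L_decomp\<close> a scalar already decomposes over the degrees 1, h and h^2;
  uniqueness of components leaves nothing for other degrees.\<close>

lemma LD_sub: "g \<in> carrier G \<Longrightarrow> g \<notin> {\<one>, h, h \<otimes> h} \<Longrightarrow> l \<in> LD g \<Longrightarrow> l = 0"
proof -
  assume g: "g \<in> carrier G" "g \<notin> {\<one>, h, h \<otimes> h}" "l \<in> LD g"
  obtain c0 c1 c2 where l: "l = diag c0 + diag c1 * xi + diag c2 * (xi * xi)" using L_decomp by blast
  define u where "u = (\<lambda>k. if k = \<one> then sca (diag c0) id else if k = h then sca (diag c1 * xi) id
     else sca (diag c2 * (xi * xi)) id)"
  have eq: "sca l id = sum u {\<one>, h, h \<otimes> h}"
    using h_facts by (simp add: u_def l sca_add_left ac_simps)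
  have u: "u k \<in> D k" if "k \<in> {\<one>, h, h \<otimes> h}" for k
    using that LD_one LD_h LD_hh h_facts by (auto simp: u_def LD_def)
  have "E.part (sca l id) g = (if g \<in> {\<one>, h, h \<otimes> h} then u g else 0)"
    by (rule E.part_unique[OF _ _ _ u eq]) (use h in \<open>auto simp: lin_sca\<close>)
  then have "E.part (sca l id) g = 0" using g by simp
  moreover have "E.part (sca l id) g = sca l id"
    using g by (subst E.part_hom[of g]) (auto simp: LD_def)
  ultimately show ?thesis by (simp add: sca_id_zero)
qed

lemma LD_cases:
  assumes "g \<in> carrier G" "l \<in> LD g" "l \<noteq> 0"
  obtains c where "g = \<one>" "l = diag c" | c where "g = h" "l = diag c * xi"
    | c where "g = h \<otimes> h" "l = diag c * (xi * xi)"
  using assms LD_sub[of g l] LD_one LD_h LD_hh by blast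

lemma LD_diag: "diag c \<in> LD \<one>"
  by (simp add: LD_one)

lemma LD_sca: "g \<in> carrier G \<Longrightarrow> k \<in> carrier G \<Longrightarrow> l \<in> LD g \<Longrightarrow> a \<in> D k \<Longrightarrow> sca l a \<in> D (g \<otimes> k)"
  using D_mult[of g k "sca l id" a] by (simp add: LD_def sca_comp)

lemma LD_mult: "g \<in> carrier G \<Longrightarrow> k \<in> carrier G \<Longrightarrow> l \<in> LD g \<Longrightarrow> m \<in> LD k \<Longrightarrow> l * m \<in> LD (g \<otimes> k)"
  using LD_sca[of g k l "sca m id"] by (simp add: LD_def sca_sca)

lemma LD_zero: "g \<in> carrier G \<Longrightarrow> 0 \<in> LD g"
  by (simp add: LD_def E.D_zero)

lemma LD_disjoint:
  assumes "g \<in> carrier G" "k \<in> carrier G" "l \<in> LD g" "l \<in> LD k" "l \<noteq> 0"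
  shows "g = k"
proof (rule ccontr)
  assume "g \<noteq> k"
  then have "sca l id = 0"
    using E.part_hom[of g "sca l id" k] E.part_hom[of k "sca l id" k] assms by (auto simp: LD_def)
  then show False using assms by (simp add: sca_id_zero)
qed

lemma rho_xi: "rho xi = diag \<omega> * xi"
  using \<omega> by (simp add: xi_def diag_def power2_eq_square power3_eq_cube mult.assoc)

text \<open>Each nonzero component of L is the line of a power of \<open>xi\<close>, and these
  powers are eigenvectors of \<rho>.\<close>

lemma LD_rho: "g \<in> carrier G \<Longrightarrow> l \<in> LD g \<Longrightarrow> rho l \<in> LD g"
proof (cases "l = 0")
  case False
  assume "g \<in> carrier G" "l \<in> LD g"
  from this False show ?thesis
  proof (cases rule: LD_cases)
    case (1 c) then show ?thesis using LD_one by simp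
  next
    case (2 c)
    then have "rho l = diag (c * \<omega>) * xi" by (simp add: rho_xi diag_mult mult.assoc)
    then show ?thesis using LD_h 2 by simp
  next
    case (3 c)
    then have "rho l = diag (c * \<omega> * \<omega>) * (xi * xi)" by (simp add: rho_xi diag_mult ac_simps)
    then show ?thesis using LD_hh 3 by simp
  qed
qed (simp add: LD_zero)

text \<open>In the nontrivial degrees the entries are, up to a common factor, 1, \<omega>,
  \<omega>^2 in some order, and these add up to 0.\<close>

lemma trace3_LD:
  assumes "g \<in> carrier G" "l \<in> LD g" "g \<noteq> \<one>"
  shows "trace3 l = 0"
proof (cases "l = 0")
  case True then show ?thesis by (simp add: trace3_def)
next
  case False
  have eq: "c + c * \<omega> + c * \<omega>\<^sup>2 = c * (1 + \<omega> + \<omega>\<^sup>2)" for c by (simp add: algebra_simps)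
  have eq': "c + c * \<omega>\<^sup>2 + c * \<omega> ^ 4 = c * (1 + \<omega> + \<omega>\<^sup>2)" for c
    using \<omega> by (simp add: distrib_left power4_eq_xxxx power3_eq_cube mult.assoc)
  from assms(1,2) False show ?thesis
  proof (cases rule: LD_cases)
    case (2 c)
    then show ?thesis using eq[of c] \<omega>_sum by (simp add: trace3_def xi_def diag_def)
  next
    case (3 c)
    then show ?thesis using eq'[of c] \<omega>_sum
      by (simp add: trace3_def xi_def diag_def power2_eq_square power4_eq_xxxx mult.assoc)
  qed (use assms in simp)
qed

text \<open>L is a graded field: its components are spanned by powers of \<open>xi\<close>, whose
  cube is 1.\<close>

lemma LD_unit:
  assumes g: "g \<in> carrier G" and l: "l \<in> LD g" "l \<noteq> 0"
  shows "\<exists>m \<in> LD (inv g). l * m = 1"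
proof -
  have inv: "inv h = h \<otimes> h" "inv (h \<otimes> h) = h"
    using h_facts h(1) G.inv_equality[of "h \<otimes> h" h] G.inv_equality[of h "h \<otimes> h"] by (simp_all add: G.m_assoc)
  have w: "\<omega> * (\<omega> * \<omega>) = 1" using \<omega> by (simp add: power3_eq_cube mult.assoc)
  have "\<omega>\<^sup>2 * (\<omega>\<^sup>2 * \<omega>\<^sup>2) = (\<omega> * (\<omega> * \<omega>)) * (\<omega> * (\<omega> * \<omega>))"
    by (simp only: power2_eq_square ac_simps)
  then have w6: "\<omega>\<^sup>2 * (\<omega>\<^sup>2 * \<omega>\<^sup>2) = 1" unfolding w by simp
  have xi3: "xi * (xi * xi) = 1" unfolding xi_def triple_one triple_times w w6 by simp
  have d: "diag c * diag (1 / c) = 1" if "c \<noteq> 0" for c :: 'k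
  proof -
    have "c * (1 / c) = 1" using that by simp
    then show ?thesis by (metis diag_mult diag_one)
  qed
  from g l show ?thesis
  proof (cases rule: LD_cases)
    case (1 c)
    then have "c \<noteq> 0" using l by auto
    then show ?thesis using 1 d[of c] LD_one by (intro bexI[of _ "diag (1 / c)"]) auto
  next
    case (2 c)
    have "l * (diag (1 / c) * (xi * xi)) = (diag c * diag (1 / c)) * (xi * (xi * xi))"
      using 2 by (simp add: ac_simps)
    moreover have "c \<noteq> 0" using l 2 by auto
    ultimately show ?thesis using 2 d[of c] LD_hh xi3 inv
      by (intro bexI[of _ "diag (1 / c) * (xi * xi)"]) auto
  next
    case (3 c)
    have "l * (diag (1 / c) * xi) = (diag c * diag (1 / c)) * (xi * (xi * xi))"
      using 3 by (simp add: ac_simps)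
    moreover have "c \<noteq> 0" using l 3 by auto
    ultimately show ?thesis using 3 d[of c] LD_h xi3 inv
      by (intro bexI[of _ "diag (1 / c) * xi"]) auto
  qed
qed

text \<open>\<open>trace_identity\<close> puts \<rho>(tr a) in degree g; two more applications of
  \<rho>, which preserves degrees, recover the trace itself.\<close>

lemma tr_LD: "g \<in> carrier G \<Longrightarrow> a \<in> D g \<Longrightarrow> tr a \<in> LD g"
proof -
  assume g: "g \<in> carrier G" "a \<in> D g"
  have "sca (rho (tr a)) id \<in> D g"
    using g trace_identity[of a] D_lin D_\<alpha>\<^sub>1[of g "a + adj a"] D_adj[of g a] E.D_add[of g a "adj a"]
    by simp
  then have "rho (tr a) \<in> LD g" by (simp add: LD_def)
  from LD_rho[OF g(1) LD_rho[OF g(1) this]] show ?thesis by simp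
qed

lemma lin_part: "lin a \<Longrightarrow> lin (E.part a g)"
proof (cases "g \<in> carrier G")
  case True
  assume "lin a"
  then show ?thesis using E.part_in[of a g] D_lin True by simp
next
  case False
  assume "lin a"
  then have "g \<notin> E.supp a" using E.supp_sub[of a] False by auto
  then show ?thesis by (simp add: E.supp_def)
qed

lemma part_sca_diag:
  assumes a: "lin a"
  shows "E.part (sca (diag s) a) g = sca (diag s) (E.part a g)"
proof -
  have A: "a \<in> Collect lin" using a by simp
  have "sca (diag s) a = (\<Sum>g\<in>E.supp a. sca (diag s) (E.part a g))"
    using E.sum_part_supp[OF A] by (simp flip: sca_sum)
  then have "E.part (sca (diag s) a) g = (if g \<in> E.supp a then sca (diag s) (E.part a g) else 0)"
    using a A E.supp_finite[OF A] E.supp_sub[OF A]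
    by (intro E.part_unique) (auto intro!: lin_sca D_diag E.part_in lin_sumI lin_part)
  then show ?thesis by (auto simp: E.supp_def)
qed

lemma part_plus: "lin a \<Longrightarrow> lin c \<Longrightarrow> E.part (a + c) g = E.part a g + E.part c g"
  by (rule E.part_add) (auto intro: lin_plus)

section \<open>The Casimir element\<close>

text \<open>The trace over \<open>\<bbbF>\<close> kills every component but the neutral one, hence pairs the component of
  degree \<open>g\<close> with that of degree \<open>g\<^sup>-\<^sup>1\<close>.\<close>

definition tr1 :: "('v \<Rightarrow> 'v) \<Rightarrow> 'k" where
  "tr1 a = trace3 (tr a)"

lemma tr1_add: "tr1 (a + c) = tr1 a + tr1 c"
  by (simp add: tr1_def tr_add trace3_add)

lemma tr1_sum: "tr1 (sum f F) = (\<Sum>i\<in>F. tr1 (f i))"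
  by (rule additive_sum[of tr1]) (rule tr1_add)

lemma tr1_commute: "lin a \<Longrightarrow> lin c \<Longrightarrow> tr1 (a \<circ> c) = tr1 (c \<circ> a)"
  by (simp add: tr1_def tr_comp)

lemma tr1_hom: "g \<in> carrier G \<Longrightarrow> k \<in> carrier G \<Longrightarrow> a \<in> D g \<Longrightarrow> c \<in> D k \<Longrightarrow> g \<otimes> k \<noteq> \<one> \<Longrightarrow> tr1 (a \<circ> c) = 0"
  using trace3_LD[of "g \<otimes> k"] tr_LD[of "g \<otimes> k"] D_mult by (simp add: tr1_def)

lemma tr1_part1:
  assumes a: "lin a" and c: "lin c" and g: "g \<in> carrier G"
  shows "tr1 (E.part a g \<circ> c) = tr1 (E.part a g \<circ> E.part c (inv g))"
proof -
  have C: "c \<in> Collect lin" and A: "a \<in> Collect lin" using a c by simp_all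
  let ?S = "insert (inv g) (E.supp c)"
  have S: "finite ?S" "?S \<subseteq> carrier G" using E.supp_finite[OF C] E.supp_sub[OF C] g by auto
  have "c = sum (E.part c) ?S" using E.sum_part[OF C S(1), symmetric] by blast
  then have "E.part a g \<circ> c = (\<Sum>k\<in>?S. E.part a g \<circ> E.part c k)"
    by (subst \<open>c = _\<close>) (auto simp: fun_simps lin_sum lin_part a)
  then have "tr1 (E.part a g \<circ> c) = (\<Sum>k\<in>?S. tr1 (E.part a g \<circ> E.part c k))"
    by (simp only: tr1_sum)
  also have "\<dots> = (\<Sum>k\<in>{inv g}. tr1 (E.part a g \<circ> E.part c k))"
  proof (rule sum.mono_neutral_right)
    show "\<forall>k\<in>?S - {inv g}. tr1 (E.part a g \<circ> E.part c k) = 0"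
    proof
      fix k assume k: "k \<in> ?S - {inv g}"
      then have "g \<otimes> k \<noteq> \<one>" using S g by (metis DiffE G.comm_inv_char singletonI subsetD)
      then show "tr1 (E.part a g \<circ> E.part c k) = 0"
        using k S g by (intro tr1_hom[of g k] E.part_in[OF A] E.part_in[OF C]) auto
    qed
  qed (use S in auto)
  finally show ?thesis by simp
qed

text \<open>Both sides reduce to the component of \<open>a\<close> in degree g and that of
  \<open>c\<close> in degree g^-1: the two projections are adjoint to each other for the form tr1(a
  c).\<close>

lemma tr1_part:
  assumes a: "lin a" and c: "lin c" and g: "g \<in> carrier G"
  shows "tr1 (E.part a g \<circ> c) = tr1 (E.part c (inv g) \<circ> a)"
  using tr1_part1[OF a c g] tr1_part1[OF c a, of "inv g"] g
  by (simp add: tr1_commute lin_part a c)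

text \<open>Balance is over F and not over L: since L is itself graded nontrivially, the projections
  to homogeneous components commute with scalars from F but not with all of L.\<close>

definition fbal :: "(('v \<Rightarrow> 'v) \<Rightarrow> ('v \<Rightarrow> 'v) \<Rightarrow> 'w::ab_group_add) \<Rightarrow> bool" where
  "fbal B \<longleftrightarrow> biadd B \<and> (\<forall>s P R. lin P \<longrightarrow> lin R \<longrightarrow> B (sca (diag s) P) R = B P (sca (diag s) R))"

text \<open>For dual bases of a form, an operator applied to the first factor of the sum of the P_j
  \<otimes> R_j agrees with its adjoint applied to the second. By \<open>tr1_part\<close> the
  adjoint of a projection is the projection to the inverse degree.\<close>

lemma casimir_adjoint:
  fixes P R :: "'i \<Rightarrow> 'v \<Rightarrow> 'v"
  assumes P: "\<And>a. lin a \<Longrightarrow> a = (\<Sum>j\<in>J. sca (diag (tr1 (a \<circ> R j))) (P j))"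
    and R: "\<And>a. lin a \<Longrightarrow> a = (\<Sum>j\<in>J. sca (diag (tr1 (a \<circ> P j))) (R j))"
    and lin: "\<And>j. lin (P j)" "\<And>j. lin (R j)"
    and B: "fbal B" and g: "g \<in> carrier G"
  shows "(\<Sum>j\<in>J. B (E.part (P j) g) (R j)) = (\<Sum>j\<in>J. B (P j) (E.part (R j) (inv g)))"
proof -
  have bi: "biadd B" and bal: "lin P \<Longrightarrow> lin R \<Longrightarrow> B (sca (diag s) P) R = B P (sca (diag s) R)" for P R s
    using B by (auto simp: fbal_def)
  let ?c = "\<lambda>j i. diag (tr1 (E.part (P j) g \<circ> R i))"
  have c: "?c j i = diag (tr1 (E.part (R i) (inv g) \<circ> P j))" for i j
    using tr1_part[of "P j" "R i" g] lin g by simp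
  have expand: "B (E.part (P j) g) (R j) = (\<Sum>i\<in>J. B (P i) (sca (?c j i) (R j)))" for j
    by (subst P[of "E.part (P j) g"]) (simp_all add: lin_part lin lin_sca biadd_sum[OF bi] bal)
  have "(\<Sum>j\<in>J. B (E.part (P j) g) (R j)) = (\<Sum>i\<in>J. \<Sum>j\<in>J. B (P i) (sca (?c j i) (R j)))"
    unfolding expand by (rule sum.swap)
  also have "\<dots> = (\<Sum>i\<in>J. B (P i) (\<Sum>j\<in>J. sca (?c j i) (R j)))"
    by (simp add: biadd_sum[OF bi] lin lin_sca)
  also have "\<dots> = (\<Sum>i\<in>J. B (P i) (E.part (R i) (inv g)))"
    unfolding c by (simp add: R[symmetric] lin_part lin)
  finally show ?thesis .
qed

text \<open>Decomposing the first factor is enough: \<open>casimir_adjoint\<close> then forces the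
  second factor into the inverse degree, where \<open>deg\<close> applies.\<close>

lemma casimir_degree:
  fixes P R :: "'i \<Rightarrow> 'v \<Rightarrow> 'v"
  assumes P: "\<And>a. lin a \<Longrightarrow> a = (\<Sum>j\<in>J. sca (diag (tr1 (a \<circ> R j))) (P j))"
    and R: "\<And>a. lin a \<Longrightarrow> a = (\<Sum>j\<in>J. sca (diag (tr1 (a \<circ> P j))) (R j))"
    and lin: "\<And>j. lin (P j)" "\<And>j. lin (R j)" and J: "finite J"
    and B: "fbal B" and m: "m \<in> carrier G"
    and deg: "\<And>p P R. p \<in> carrier G \<Longrightarrow> P \<in> D p \<Longrightarrow> R \<in> D (inv p) \<Longrightarrow> B P R \<in> D m"
  shows "(\<Sum>j\<in>J. B (P j) (R j)) \<in> D m"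
proof -
  have bi: "biadd B" using B by (simp add: fbal_def)
  define S where "S = (\<Union>j\<in>J. E.supp (P j))"
  have S: "finite S" "S \<subseteq> carrier G" "\<And>j. j \<in> J \<Longrightarrow> E.supp (P j) \<subseteq> S"
    using J E.supp_finite E.supp_sub lin by (auto simp: S_def)
  have "B (P j) (R j) = (\<Sum>g\<in>S. B (E.part (P j) g) (R j))" if "j \<in> J" for j
    using E.sum_part[of "P j" S] S that lin
    by (simp add: lin_part flip: biadd_sum[OF bi])
  then have "(\<Sum>j\<in>J. B (P j) (R j)) = (\<Sum>g\<in>S. \<Sum>j\<in>J. B (E.part (P j) g) (R j))"
    by (simp add: sum.swap[of _ J S])
  also have "\<dots> \<in> D m"
  proof (rule E.D_sum[OF m])
    fix g assume "g \<in> S"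
    then have g: "g \<in> carrier G" using S by blast
    \<comment> \<open>Projection is idempotent, so one copy stays on the first factor while another
      is moved to the second.\<close>
    have pp: "E.part (E.part (P j) g) g = E.part (P j) g" for j
      using E.part_hom[OF g E.part_in[of "P j" g]] g lin by simp
    have "fbal (\<lambda>P R. B (E.part P g) R)"
      using B by (auto simp: fbal_def biadd_def lin_part part_plus part_sca_diag)
    from casimir_adjoint[OF P R lin this g]
    have "(\<Sum>j\<in>J. B (E.part (P j) g) (R j)) = (\<Sum>j\<in>J. B (E.part (P j) g) (E.part (R j) (inv g)))"
      by (simp add: pp)
    also have "\<dots> \<in> D m"
      using g lin by (intro E.D_sum[OF m] deg[OF g] E.part_in) auto
    finally show "(\<Sum>j\<in>J. B (E.part (P j) g) (R j)) \<in> D m" .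
  qed
  finally show ?thesis .
qed

text \<open>Matrix units for the dual pair, cut by the idempotents of L, expand every operator over
  F; exchanging i and j gives the dual family for \<open>tr1\<close>.\<close>

definition unitX :: "nat \<times> nat \<times> nat \<Rightarrow> 'v \<Rightarrow> 'v" where
  "unitX = (\<lambda>(i, j, l). sca (idem3 l) (ten (e i) (e' j)))"

lemma unitX_expand:
  assumes a: "lin a"
  shows "a = (\<Sum>(i, j, l)\<in>{..<n} \<times> {..<n} \<times> {..<3}. sca (diag (tr1 (a \<circ> unitX (j, i, l)))) (unitX (i, j, l)))"
proof -
  have "(\<Sum>(i, j, l)\<in>{..<n} \<times> {..<n} \<times> {..<3}. sca (diag (tr1 (a \<circ> unitX (j, i, l)))) (unitX (i, j, l)))
    = (\<Sum>i<n. \<Sum>j<n. \<Sum>l<3. sca (diag (trace3 (idem3 l * b (a (e j)) (e' i))) * idem3 l) (ten (e i) (e' j)))"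
    by (simp add: sum.cartesian_product' split_def unitX_def tr1_def sca_sca comp_sca[OF a] comp_ten[OF a] tr_sca)
  also have "\<dots> = (\<Sum>i<n. \<Sum>j<n. sca (b (a (e j)) (e' i)) (ten (e i) (e' j)))"
    by (simp only: sum_trace3_idem3 flip: sca_sum_left)
  also have "\<dots> = (\<Sum>j<n. \<Sum>i<n. ten (b (e' i) (a (e j)) \<bullet> e i) (e' j))"
    by (subst sum.swap) (simp add: sca_ten b_sym)
  also have "\<dots> = (\<Sum>j<n. ten (\<Sum>i<n. b (e' i) (a (e j)) \<bullet> e i) (e' j))"
    by (simp add: additive_sum[of "\<lambda>x. ten x _"] ten_add_left)
  also have "\<dots> = a" by (simp add: dual ten_expand[OF a])
  finally show ?thesis by simp
qed

lemma unitX_expand':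
  assumes a: "lin a"
  shows "a = (\<Sum>(i, j, l)\<in>{..<n} \<times> {..<n} \<times> {..<3}. sca (diag (tr1 (a \<circ> unitX (i, j, l)))) (unitX (j, i, l)))"
  by (subst unitX_expand[OF a])
    (rule sum.reindex_bij_witness[of _ "\<lambda>(i, j, l). (j, i, l)" "\<lambda>(i, j, l). (j, i, l)"], auto)

text \<open>\<open>\<Sum> X\<^sub>i\<^sub>j \<otimes> X\<^sub>j\<^sub>i\<close>, with \<open>X\<^sub>i\<^sub>j\<close> the matrix units, is homogeneous of trivial degree.\<close>

lemma casimir:
  assumes bi: "biadd B" and bal: "\<And>l P R. lin P \<Longrightarrow> lin R \<Longrightarrow> B (sca l P) R = B P (sca l R)"
    and m: "m \<in> carrier G"
    and deg: "\<And>p P R. p \<in> carrier G \<Longrightarrow> P \<in> D p \<Longrightarrow> R \<in> D (inv p) \<Longrightarrow> B P R \<in> D m"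
  shows "(\<Sum>i<n. \<Sum>j<n. B (ten (e i) (e' j)) (ten (e j) (e' i))) \<in> D m"
proof -
  let ?R = "\<lambda>(i, j, l). unitX (j, i, l)"
  have lin: "lin (unitX x)" "lin (?R x)" for x
    by (auto simp: unitX_def split_def lin_sca)
  have "(\<Sum>x\<in>{..<n} \<times> {..<n} \<times> {..<3}. B (unitX x) (?R x)) \<in> D m"
    by (rule casimir_degree[OF _ _ lin _ _ m deg])
      (use unitX_expand unitX_expand' bi bal in \<open>auto simp: split_def fbal_def\<close>)
  \<comment> \<open>Balance over L collects both idempotents on the first factor, where they merge
    into one; afterwards the idempotents sum to 1.\<close>
  also have "(\<Sum>x\<in>{..<n} \<times> {..<n} \<times> {..<3}. B (unitX x) (?R x))
     = (\<Sum>i<n. \<Sum>j<n. \<Sum>l<3. B (sca (idem3 l) (ten (e i) (e' j))) (ten (e j) (e' i)))"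
    by (simp add: sum.cartesian_product' split_def unitX_def bal[symmetric] lin_sca sca_sca)
  also have "\<dots> = (\<Sum>i<n. \<Sum>j<n. B (ten (e i) (e' j)) (ten (e j) (e' i)))"
    by (simp add: lin_sca sum_idem3 flip: biadd_sum[OF bi] sca_sum_left)
  finally show ?thesis .
qed

section \<open>The tensor square of the product preserves degrees\<close>

text \<open>The operators for which the degree claim holds against every homogeneous first argument.
  The goal is that their sums exhaust the linear operators.\<close>

definition tame :: "('v \<Rightarrow> 'v) set" where
  "tame = {c. \<exists>k\<in>carrier G. c \<in> D k \<and> (\<forall>g\<in>carrier G. \<forall>a\<in>D g. \<Phi> a c \<in> D (g \<otimes> k))}"

text \<open>For a = x \<otimes> w and c = y \<otimes> z the left side is l_x r_y l_z d r_w. Grouped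
  as (l_x r_y)(l_z d r_w) it is a value of \<open>\<alpha>\<^sub>1\<close> times a value of \<Phi>,
  in which the factors of \<open>a\<close> and \<open>c\<close> have exchanged partners; in dual
  bases the exchange becomes a Casimir sum.\<close>

lemma \<Phi>_\<alpha>\<^sub>2:
  assumes a: "lin a" and c: "lin c" and d: "lin d"
  shows "\<Phi> a (\<alpha>\<^sub>2 c \<circ> d) =
    (\<Sum>i<n. \<Sum>j<n. \<alpha>\<^sub>1 (a \<circ> ten (e i) (e' j)) \<circ> \<Phi> (adj c \<circ> ten (e j) (e' i)) d)"
proof -
  have "\<alpha>\<^sub>2 c = (\<Sum>j<n. (\<lambda>v. (adj c (e j) \<star> v) \<star> e' j))"
    by (subst ten_expand_adj[OF c, symmetric]) (simp add: \<alpha>\<^sub>2_sum \<alpha>\<^sub>2_ten)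
  then show ?thesis
    by (simp add: comp_ten a d \<Phi>_ten)
      (simp add: fun_simps \<Phi>_def lift_def LR_def mul_sum_right)
qed

lemma \<Phi>_\<alpha>\<^sub>2_degree:
  assumes g: "g \<in> carrier G" "a \<in> D g" and k: "k \<in> carrier G" "c \<in> D k"
    and m: "m \<in> carrier G" "d \<in> D m" and tame: "\<And>g a. g \<in> carrier G \<Longrightarrow> a \<in> D g \<Longrightarrow> \<Phi> a d \<in> D (g \<otimes> m)"
  shows "\<Phi> a (\<alpha>\<^sub>2 c \<circ> d) \<in> D (g \<otimes> (k \<otimes> m))"
proof -
  have lin: "lin a" "lin c" "lin d" using D_lin g k m by auto
  \<comment> \<open>Both factors are \<rho>-semilinear, in P and in R respectively, so a scalar from
    L passes from one argument to the other.\<close>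
  let ?B = "\<lambda>P R. \<alpha>\<^sub>1 (a \<circ> P) \<circ> \<Phi> (adj c \<circ> R) d"
  have "biadd ?B"
    by (simp add: biadd_def comp_add_distrib_right lin \<Phi>_add_left comp_add_distrib lin_\<Phi>)
  moreover have "?B (sca l P) R = ?B P (sca l R)" for l P R
    by (simp add: comp_sca lin \<Phi>_sca_left sca_comp lin_\<Phi>)
  moreover have "?B P R \<in> D (g \<otimes> (k \<otimes> m))" if p: "p \<in> carrier G" "P \<in> D p" "R \<in> D (inv p)" for p P R
  proof -
    \<comment> \<open>Commutativity of G cancels p against its inverse, so the degree does not
      depend on p.\<close>
    have "?B P R \<in> D ((g \<otimes> p) \<otimes> ((k \<otimes> inv p) \<otimes> m))"
      using p g k m by (intro D_mult D_\<alpha>\<^sub>1 tame D_adj) auto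
    moreover have "(g \<otimes> p) \<otimes> ((k \<otimes> inv p) \<otimes> m) = (p \<otimes> inv p) \<otimes> (g \<otimes> (k \<otimes> m))"
      using p g k m by (simp add: G.m_ac del: G.r_inv G.l_inv)
    ultimately show ?thesis using p g k m by simp
  qed
  ultimately show ?thesis
    unfolding \<Phi>_\<alpha>\<^sub>2[OF lin] using g k m by (intro casimir[of ?B]) auto
qed

lemma tame_span:
  assumes "lin a"
  shows "a \<in> add_span tame"
proof (rule gen[OF _ _ _ _ assms])
  have "id \<in> D \<one>" using LD_diag[of 1] by (simp add: LD_def)
  then have "id \<in> tame"
    unfolding tame_def using D_\<alpha>\<^sub>1 by (auto intro!: bexI[of _ "\<one>"])
  then show "id \<in> add_span tame" by (rule add_span.incl)
next
  fix l a assume "a \<in> add_span tame"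
  then show "sca l a \<in> add_span tame"
  proof induction
    case (incl x)
    then obtain k where k: "k \<in> carrier G" "x \<in> D k" "\<And>g a. g \<in> carrier G \<Longrightarrow> a \<in> D g \<Longrightarrow> \<Phi> a x \<in> D (g \<otimes> k)"
      by (auto simp: tame_def)
    have *: "sca m x \<in> tame" if m: "p \<in> carrier G" "m \<in> LD p" for p m
    proof -
      have "\<Phi> a (sca m x) \<in> D (g \<otimes> (p \<otimes> k))" if g: "g \<in> carrier G" "a \<in> D g" for g a
        using LD_sca[OF m(1) _ LD_rho[OF m(1) LD_rho[OF m]] k(3)[OF g]] g m k
        by (simp add: \<Phi>_sca_right G.m_lcomm)
      then show ?thesis using LD_sca[OF m(1) k(1) m(2) k(2)] m k
        unfolding tame_def by (auto intro!: bexI[of _ "p \<otimes> k"])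
    qed
    \<comment> \<open>An arbitrary scalar need not keep an operator homogeneous, so it is split into
      its three homogeneous components.\<close>
    obtain c0 c1 c2 where l: "l = diag c0 + diag c1 * xi + diag c2 * (xi * xi)" using L_decomp by blast
    have "sca (diag c0) x \<in> tame" by (rule *[of "\<one>"]) (auto simp: LD_one)
    moreover have "sca (diag c1 * xi) x \<in> tame" by (rule *[of h]) (auto simp: LD_h h)
    moreover have "sca (diag c2 * (xi * xi)) x \<in> tame" by (rule *[of "h \<otimes> h"]) (auto simp: LD_hh h)
    ultimately
    show ?case unfolding l sca_add_left by (intro add_span.add add_span.incl)
  next
    case zero
    then show ?case by (simp add: add_span.zero)
  next
    case (add x y)
    then show ?case unfolding sca_add by (intro add_span.add)
  qed
next
  fix a c assume a: "lin a" and "c \<in> add_span tame"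
  from this(2) show "\<alpha>\<^sub>2 a \<circ> c \<in> add_span tame"
  proof induction
    case zero
    have "\<alpha>\<^sub>2 a \<circ> 0 = (0 :: 'v \<Rightarrow> 'v)" using lin_zero[OF lin_\<alpha>\<^sub>2] by (simp add: fun_simps)
    then show ?case by (simp add: add_span.zero)
  next
    case (incl x)
    then obtain k where k: "k \<in> carrier G" "x \<in> D k" "\<And>g a. g \<in> carrier G \<Longrightarrow> a \<in> D g \<Longrightarrow> \<Phi> a x \<in> D (g \<otimes> k)"
      by (auto simp: tame_def)
    have "a \<in> Collect lin" using a by simp
    note A = E.sum_part_supp[OF this] E.supp_finite[OF this] E.supp_sub[OF this] E.part_in[OF this]
    \<comment> \<open>The induction principle supplies an arbitrary \<open>a\<close>; passing to its
      components keeps the composites homogeneous.\<close>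
    have "\<alpha>\<^sub>2 (E.part a p) \<circ> x \<in> tame" if p: "p \<in> E.supp a" for p
    proof -
      have p: "p \<in> carrier G" using p A by blast
      show ?thesis
        unfolding tame_def using p k A(4)[OF p]
        by (auto intro!: bexI[of _ "p \<otimes> k"] D_mult D_\<alpha>\<^sub>2 \<Phi>_\<alpha>\<^sub>2_degree)
    qed
    moreover have "\<alpha>\<^sub>2 a \<circ> x = (\<Sum>p\<in>E.supp a. \<alpha>\<^sub>2 (E.part a p) \<circ> x)"
      by (subst A(1)[symmetric]) (simp only: \<alpha>\<^sub>2_sum, simp add: fun_simps)
    ultimately show ?case by (simp only:) (intro add_span_sum add_span.incl)
  next
    case (add x y)
    then show ?case unfolding comp_add_distrib_right[OF lin_\<alpha>\<^sub>2] by (intro add_span.add)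
  qed
qed (rule add_span.add)

theorem \<Phi>_degree:
  assumes g: "g \<in> carrier G" "a \<in> D g" and k: "k \<in> carrier G" "c \<in> D k"
  shows "\<Phi> a c \<in> D (g \<otimes> k)"
proof -
  have c: "lin c" using D_lin k by blast
  have tl: "lin x" if "x \<in> tame" for x using that D_lin by (auto simp: tame_def)
  \<comment> \<open>The claim is made for the component of degree k, which is additive in c: tame
    summands of other degrees contribute 0.\<close>
  have "lin c \<and> \<Phi> a (E.part c k) \<in> D (g \<otimes> k)"
    using tame_span[OF c]
  proof induction
    case zero
    have "\<Phi> a 0 = 0" using \<Phi>_add_right[of a 0 0] by simp
    moreover have "E.part 0 k = 0" by (rule E.part_zero) (use k in blast)
    ultimately show ?case using g k by (auto intro!: E.D_zero)
  next
    case (incl x)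
    then obtain m where m: "m \<in> carrier G" "x \<in> D m" "\<And>g a. g \<in> carrier G \<Longrightarrow> a \<in> D g \<Longrightarrow> \<Phi> a x \<in> D (g \<otimes> m)"
      by (auto simp: tame_def)
    have "\<Phi> a 0 = 0" using \<Phi>_add_right[of a 0 0] by simp
    then show ?case using E.part_hom[OF m(1,2), of k] m(3)[OF g] tl[OF incl] g k by (auto intro!: E.D_zero)
  next
    case (add x y)
    then show ?case using g k by (auto simp: part_plus \<Phi>_add_right lin_plus intro!: E.D_add)
  qed
  then show ?thesis using E.part_hom[OF k, of k] by simp
qed

end

section \<open>Extending characters\<close>

text \<open>A character of a subgroup, kept as its graph so that extension is inclusion and a chain
  is bounded by its union. The last clause makes the graph single-valued and puts the unit in its
  domain.\<close>

definition partial_character :: "('g, 'm) monoid_scheme \<Rightarrow> ('g \<times> 'k::field) set \<Rightarrow> bool" where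
  "partial_character G f \<longleftrightarrow> f \<subseteq> carrier G \<times> (UNIV - {0}) \<and>
     (\<forall>x a y c. (x, a) \<in> f \<longrightarrow> (y, c) \<in> f \<longrightarrow> (x \<otimes>\<^bsub>G\<^esub> y, a * c) \<in> f) \<and>
     (\<forall>x a. (x, a) \<in> f \<longrightarrow> (inv\<^bsub>G\<^esub> x, inverse a) \<in> f) \<and>
     (\<forall>a. (\<one>\<^bsub>G\<^esub>, a) \<in> f \<longleftrightarrow> a = 1)"

context comm_group
begin

lemma int_pow_nonneg: "0 \<le> k \<Longrightarrow> x [^] (k :: int) = x [^] nat k"
  by (subst int_pow_def2) simp

lemma int_pow_negative: "k < 0 \<Longrightarrow> x [^] (k :: int) = inv (x [^] nat (- k))"
  by (subst int_pow_def2) simp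

lemma partial_characterD:
  assumes "partial_character G f"
  shows "(x, a) \<in> f \<Longrightarrow> (y, c) \<in> f \<Longrightarrow> (x \<otimes> y, a * c) \<in> f"
    and "(x, a) \<in> f \<Longrightarrow> (inv x, inverse a) \<in> f"
    and "(\<one>, a) \<in> f \<longleftrightarrow> a = 1"
    and "(x, a) \<in> f \<Longrightarrow> x \<in> carrier G"
    and "(x, a) \<in> f \<Longrightarrow> a \<noteq> 0"
proof -
  note f = assms[unfolded partial_character_def]
  have sub: "f \<subseteq> carrier G \<times> (UNIV - {0})" using f by (rule conjunct1)
  show "(x, a) \<in> f \<Longrightarrow> (y, c) \<in> f \<Longrightarrow> (x \<otimes> y, a * c) \<in> f"
    using f[THEN conjunct2, THEN conjunct1, rule_format] .
  show "(x, a) \<in> f \<Longrightarrow> (inv x, inverse a) \<in> f"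
    using f[THEN conjunct2, THEN conjunct2, THEN conjunct1, rule_format] .
  show "(\<one>, a) \<in> f \<longleftrightarrow> a = 1"
    using f[THEN conjunct2, THEN conjunct2, THEN conjunct2, rule_format] .
  show "(x, a) \<in> f \<Longrightarrow> x \<in> carrier G" "(x, a) \<in> f \<Longrightarrow> a \<noteq> 0"
    using subsetD[OF sub, of "(x, a)"] by simp_all
qed

lemma partial_character_unique:
  assumes f: "partial_character G f" and xa: "(x, a) \<in> f" and xc: "(x, c) \<in> f"
  shows "a = c"
proof -
  have x: "x \<in> carrier G" "c \<noteq> 0" using partial_characterD(4,5)[OF f xc] by simp_all
  have "(x \<otimes> inv x, a * inverse c) \<in> f"
    by (rule partial_characterD(1)[OF f xa partial_characterD(2)[OF f xc]])
  then have "(\<one>, a * inverse c) \<in> f" using x by simp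
  then have "a * inverse c = 1" by (rule iffD1[OF partial_characterD(3)[OF f]])
  then have "a * inverse c * c = c" by (simp only: mult_1_left)
  then show ?thesis using x(2) by (simp add: mult.assoc)
qed

lemma partial_character_pow:
  assumes f: "partial_character G f" and xa: "(x, a) \<in> f"
  shows "(x [^] (k :: int), a powi k) \<in> f"
proof -
  have x: "x \<in> carrier G" "a \<noteq> 0" using partial_characterD(4,5)[OF f xa] by simp_all
  have nat: "(x [^] n, a ^ n) \<in> f" for n :: nat
  proof (induction n)
    case 0
    then show ?case using partial_characterD(3)[OF f] by simp
  next
    case (Suc n)
    from partial_characterD(1)[OF f this xa] show ?case by (simp add: mult.commute)
  qed
  show ?thesis
  proof (cases "k < 0")
    case False
    then have "x [^] k = x [^] nat k" "a powi k = a ^ nat k"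
      by (simp_all only: int_pow_nonneg power_int_def not_less if_True)
    then show ?thesis by (simp only: nat)
  next
    case True
    then have "x [^] k = inv (x [^] nat (- k))" by (rule int_pow_negative)
    moreover have "a powi k = inverse a ^ nat (- k)" using True by (simp only: power_int_def) simp
    ultimately show ?thesis using partial_characterD(2)[OF f nat[of "nat (- k)"]] by (simp only: power_inverse)
  qed
qed

text \<open>Adjoining g requires a value d with d^k = f(g^k) whenever g^k lies in the domain.
  Algebraic closedness provides the root that this asks for.\<close>

lemma partial_character_extend:
  fixes f :: "('a \<times> 'k::alg_closed_field) set"
  assumes f: "partial_character G f" and g: "g \<in> carrier G"
  shows "\<exists>f' d. partial_character G f' \<and> f \<subseteq> f' \<and> (g, d) \<in> f'"
proof -
  have mult: "(x, a) \<in> f \<Longrightarrow> (y, c) \<in> f \<Longrightarrow> (x \<otimes> y, a * c) \<in> f"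
    and inv: "(x, a) \<in> f \<Longrightarrow> (inv x, inverse a) \<in> f"
    and one: "(\<one>, a) \<in> f \<longleftrightarrow> a = 1"
    and carr: "(x, a) \<in> f \<Longrightarrow> x \<in> carrier G \<and> a \<noteq> 0" for x y a c
    using partial_characterD[OF f] by simp_all
  have "\<exists>d. d \<noteq> 0 \<and> (\<forall>(k :: int) c. (g [^] k, c) \<in> f \<longrightarrow> d powi k = c)"
  proof (cases "\<exists>k :: nat. k > 0 \<and> (\<exists>c. (g [^] k, c) \<in> f)")
    case False
    have "k = 0" if "(g [^] k, c) \<in> f" for k :: int and c
    proof (rule ccontr)
      assume "k \<noteq> 0"
      then consider "k > 0" | "k < 0" by linarith
      then show False
      proof cases
        case 1
        then have "g [^] k = g [^] nat k" by (intro int_pow_nonneg) simp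
        then have "(g [^] nat k, c) \<in> f" "nat k > 0" using that 1 by simp_all
        then show False using False by blast
      next
        case 2
        have "g [^] k = inv (g [^] nat (- k))" using 2 by (rule int_pow_negative)
        then have "(g [^] nat (- k), inverse c) \<in> f" using inv[OF that] g by simp
        moreover have "nat (- k) > 0" using 2 by simp
        ultimately show False using False by blast
      qed
    qed
    \<comment> \<open>Only the exponent 0 puts a power of g in the domain here, so the sole
      condition on d is d^0 = 1, and d = 1 is taken.\<close>
    then have "c = 1" if "(g [^] k, c) \<in> f" for k :: int and c
      using that one[of c] by fastforce
    then show ?thesis by (intro exI[of _ 1]) auto
  next
    case True
    define T where "T = (\<lambda>k :: nat. k > 0 \<and> (\<exists>c. (g [^] k, c) \<in> f))"
    define N where "N = (LEAST k. T k)"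
    have "\<exists>k. T k" using True unfolding T_def .
    then have N': "T N" unfolding N_def by (rule LeastI_ex)
    then have N: "N > 0" unfolding T_def by (rule conjunct1)
    obtain c0 where c0: "(g [^] N, c0) \<in> f" using N' unfolding T_def by (elim conjE exE)
    have least: "k \<ge> N" if "k > 0" "(g [^] k, c) \<in> f" for k c
      unfolding N_def by (rule Least_le) (use that in \<open>auto simp: T_def\<close>)
    \<comment> \<open>The least positive exponent N with g^N in the domain divides all such
      exponents, so an N-th root settles every power.\<close>
    obtain d where d: "d ^ N = c0" using nth_root_exists[of N c0] N by blast
    have "d \<noteq> 0" using d carr[OF c0] N by auto
    moreover have "d powi k = c" if k: "(g [^] k, c) \<in> f" for k c
    proof -
      \<comment> \<open>Division with remainder: the remainder is again an exponent for which the
        power lies in the domain, it is below N, hence 0.\<close>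
      let ?q = "k div int N" and ?r = "k mod int N"
      have q: "(g [^] (int N * ?q), c0 powi ?q) \<in> f"
        using partial_character_pow[OF f c0, of ?q] g int_pow_pow[OF g, of "int N" ?q]
        by (simp add: int_pow_int)
      have "(g [^] k \<otimes> inv (g [^] (int N * ?q)), c * inverse (c0 powi ?q)) \<in> f"
        using mult[OF k inv[OF q]] .
      moreover have "g [^] k \<otimes> inv (g [^] (int N * ?q)) = g [^] ?r"
        using int_pow_diff[OF g, of k "int N * ?q"] by (simp add: minus_mult_div_eq_mod)
      moreover have "g [^] ?r = g [^] nat ?r" using N by (intro int_pow_nonneg) simp
      ultimately have "(g [^] nat ?r, c * inverse (c0 powi ?q)) \<in> f" by simp
      moreover have "nat ?r < N" using N by (simp add: nat_less_iff)
      ultimately have "nat ?r = 0" using least by (metis gr0I linorder_not_less)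
      then have "?r \<le> 0" by simp
      moreover have "?r \<ge> 0" using N by simp
      ultimately have "?r = 0" by simp
      then have k_eq: "k = int N * ?q" by (metis add.right_neutral mult_div_mod_eq)
      then have "c = c0 powi ?q" using partial_character_unique[OF f k] q by metis
      also have "\<dots> = d powi k" using d by (subst k_eq) (simp add: power_int_mult)
      finally show ?thesis by simp
    qed
    ultimately show ?thesis by blast
  qed
  then obtain d where d: "d \<noteq> 0" "\<And>(k :: int) c. (g [^] k, c) \<in> f \<Longrightarrow> d powi k = c" by blast
  define f' where "f' = {(x \<otimes> g [^] k, a * d powi k) | x a (k :: int). (x, a) \<in> f}"
  have f'I: "(x, a) \<in> f \<Longrightarrow> y = x \<otimes> g [^] k \<Longrightarrow> c = a * d powi k \<Longrightarrow> (y, c) \<in> f'" for x a y c and k :: int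
    unfolding f'_def by blast
  have "partial_character G f'"
    unfolding partial_character_def
  proof (intro conjI allI impI)
    show "f' \<subseteq> carrier G \<times> (UNIV - {0})" using carr g d(1) unfolding f'_def by fastforce
  next
    fix x a y c assume "(x, a) \<in> f'" "(y, c) \<in> f'"
    then obtain x' a' k y' c' l where *: "(x', a') \<in> f" "(y', c') \<in> f"
      "x = x' \<otimes> g [^] (k :: int)" "a = a' * d powi k" "y = y' \<otimes> g [^] (l :: int)" "c = c' * d powi l"
      unfolding f'_def by auto
    then show "(x \<otimes> y, a * c) \<in> f'"
      using carr[OF *(1)] carr[OF *(2)] g d(1)
      by (intro f'I[OF mult[OF *(1,2)], of _ "k + l"])
        (simp_all add: int_pow_mult m_ac power_int_add ac_simps)
  next
    fix x a assume "(x, a) \<in> f'"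
    then obtain x' a' k where *: "(x', a') \<in> f" "x = x' \<otimes> g [^] (k :: int)" "a = a' * d powi k"
      unfolding f'_def by auto
    then show "(inv x, inverse a) \<in> f'"
      using carr[OF *(1)] g d(1)
      by (intro f'I[OF inv[OF *(1)], of _ "- k"])
        (simp_all add: int_pow_neg inv_mult power_int_minus)
  next
    fix a show "(\<one>, a) \<in> f' \<longleftrightarrow> a = 1"
    proof
      assume "(\<one>, a) \<in> f'"
      then obtain x' a' k where *: "(x', a') \<in> f" "\<one> = x' \<otimes> g [^] (k :: int)" "a = a' * d powi k"
        unfolding f'_def by auto
      \<comment> \<open>This power of g is the inverse of an element of the domain, hence lies in
        the domain, where d was chosen to agree with f.\<close>
      then have "inv x' = g [^] k" using carr[OF *(1)] g by (metis inv_equality int_pow_closed m_comm)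
      then have "d powi k = inverse a'" using d(2) inv[OF *(1)] by metis
      then show "a = 1" using * carr[OF *(1)] by simp
    next
      assume "a = 1"
      then show "(\<one>, a) \<in> f'" using one by (intro f'I[of "\<one>" 1 _ 0]) simp_all
    qed
  qed
  moreover have "f \<subseteq> f'"
  proof
    fix p assume "p \<in> f"
    then show "p \<in> f'" using carr by (cases p) (auto intro!: f'I[of _ _ _ 0])
  qed
  moreover have "(g, d) \<in> f'" using one g by (intro f'I[of "\<one>" 1 _ 1]) simp_all
  ultimately show ?thesis by blast
qed

text \<open>The powers of h with values w^i form a first partial character, because w^n = 1 for the
  order n of h. Zorn's lemma gives a maximal extension, and \<open>partial_character_extend\<close>
  makes it total.\<close>

lemma character_exists:
  fixes w :: "'k::alg_closed_field"
  assumes h: "h \<in> carrier G" "ord h = n" and w: "w ^ n = 1" and n: "n > 0"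
  shows "\<exists>\<chi>. (\<forall>x\<in>carrier G. \<chi> x \<noteq> 0) \<and> (\<forall>x\<in>carrier G. \<forall>y\<in>carrier G. \<chi> (x \<otimes> y) = \<chi> x * \<chi> y) \<and> \<chi> h = w"
proof -
  define A where "A = {f :: ('a \<times> 'k) set. partial_character G f \<and> (h, w) \<in> f}"
  have w0: "w \<noteq> 0" using w n by (metis power_eq_0_iff zero_neq_one)
  have hn: "h [^] n = \<one>" using h by (metis pow_ord_eq_1)
  let ?f = "{(h [^] i, w ^ i) | i :: nat. True}"
  have "partial_character G ?f"
    unfolding partial_character_def
  proof (intro conjI allI impI)
    show "?f \<subseteq> carrier G \<times> (UNIV - {0})" using h w0 by auto
  next
    fix x a y c assume "(x, a) \<in> ?f" "(y, c) \<in> ?f"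
    then obtain i j where "x = h [^] (i :: nat)" "a = w ^ i" "y = h [^] (j :: nat)" "c = w ^ j" by auto
    then have "x \<otimes> y = h [^] (i + j)" "a * c = w ^ (i + j)" using h by (simp_all add: nat_pow_mult power_add)
    then show "(x \<otimes> y, a * c) \<in> ?f" by blast
  next
    fix x a assume "(x, a) \<in> ?f"
    then obtain i where i: "x = h [^] (i :: nat)" "a = w ^ i" by auto
    let ?j = "(n - 1) * i"
    have eq: "?j + i = n * i" using n by (simp add: algebra_simps)
    have "h [^] (n * i) = (h [^] n) [^] i" using h by (simp only: nat_pow_pow)
    then have "h [^] ?j \<otimes> h [^] i = \<one>" using h(1) hn by (simp only: nat_pow_mult eq nat_pow_one)
    then have "inv x = h [^] ?j" using h i by (intro inv_equality) auto
    moreover have "w ^ (?j + i) = 1" using w unfolding eq by (simp only: power_mult power_one)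
    then have "w ^ ?j * w ^ i = 1" by (simp only: power_add)
    then have "inverse a = w ^ ?j" using i by (metis inverse_unique mult.commute)
    ultimately show "(inv x, inverse a) \<in> ?f" by blast
  next
    fix a show "(\<one>, a) \<in> ?f \<longleftrightarrow> a = 1"
    proof
      assume "(\<one>, a) \<in> ?f"
      then obtain i where i: "\<one> = h [^] (i :: nat)" "a = w ^ i" by auto
      then have "n dvd i" using pow_eq_id[OF h(1), of i] h(2) by simp
      then show "a = 1" using i w by (auto simp: power_mult)
    next
      assume "a = 1"
      then show "(\<one>, a) \<in> ?f" by (auto intro!: exI[of _ 0])
    qed
  qed
  moreover have "(h, w) \<in> ?f" using h by (auto intro!: exI[of _ 1])
  ultimately have "?f \<in> A" by (simp add: A_def)
  then have "A \<noteq> {}" by blast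
  moreover have "\<Union>C \<in> A" if C: "C \<noteq> {}" "subset.chain A C" for C
  proof -
    have pc: "f \<in> C \<Longrightarrow> partial_character G f \<and> (h, w) \<in> f" for f
      using C(2) by (auto simp: subset_chain_def A_def)
    have two: "\<exists>f\<in>C. p \<in> f \<and> q \<in> f" if "p \<in> \<Union>C" "q \<in> \<Union>C" for p q
    proof -
      obtain f where "f \<in> C" "p \<in> f" using \<open>p \<in> \<Union>C\<close> by (rule UnionE)
      moreover obtain f' where "f' \<in> C" "q \<in> f'" using \<open>q \<in> \<Union>C\<close> by (rule UnionE)
      moreover have "f \<subseteq> f' \<or> f' \<subseteq> f" using C(2) \<open>f \<in> C\<close> \<open>f' \<in> C\<close> by (simp add: subset_chain_def)
      ultimately show ?thesis by blast
    qed
    have "partial_character G (\<Union>C)"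
      unfolding partial_character_def
    proof (intro conjI allI impI)
      show "\<Union>C \<subseteq> carrier G \<times> (UNIV - {0})"
        using pc partial_characterD(4,5) by fastforce
    next
      fix x a y c assume "(x, a) \<in> \<Union>C" "(y, c) \<in> \<Union>C"
      from two[OF this] obtain f where f: "f \<in> C" "(x, a) \<in> f" "(y, c) \<in> f" by blast
      then show "(x \<otimes> y, a * c) \<in> \<Union>C"
        using partial_characterD(1)[of f x a y c] pc by blast
    next
      fix x a assume "(x, a) \<in> \<Union>C"
      then obtain f where f: "f \<in> C" "(x, a) \<in> f" by blast
      then show "(inv x, inverse a) \<in> \<Union>C"
        using partial_characterD(2)[of f x a] pc by blast
    next
      fix a show "(\<one>, a) \<in> \<Union>C \<longleftrightarrow> a = 1"
        using pc C(1) partial_characterD(3) by blast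
    qed
    then show ?thesis using pc C(1) by (auto simp: A_def)
  qed
  ultimately obtain f where f: "f \<in> A" and max: "\<And>f'. f' \<in> A \<Longrightarrow> f \<subseteq> f' \<Longrightarrow> f' = f"
    using subset_Zorn_nonempty[of A] by blast
  have pc: "partial_character G f" "(h, w) \<in> f" using f by (auto simp: A_def)
  have total: "\<exists>a. (x, a) \<in> f" if "x \<in> carrier G" for x
  proof -
    obtain f' d where f': "partial_character G f'" "f \<subseteq> f'" "(x, d) \<in> f'"
      using partial_character_extend[OF pc(1) \<open>x \<in> carrier G\<close>] by blast
    then have "f' = f" using max pc by (auto simp: A_def)
    then show ?thesis using f' by blast
  qed
  define \<chi> where "\<chi> = (\<lambda>x. SOME a. (x, a) \<in> f)"
  have \<chi>: "(x, \<chi> x) \<in> f" if "x \<in> carrier G" for x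
    unfolding \<chi>_def using total[OF that] by (rule someI_ex)
  have uniq: "\<chi> x = a" if "(x, a) \<in> f" for x a
  proof -
    have "x \<in> carrier G" using that pc(1) by (auto simp: partial_character_def)
    from partial_character_unique[OF pc(1) \<chi>[OF this] that] show ?thesis .
  qed
  show ?thesis
  proof (intro exI[of _ \<chi>] conjI ballI)
    fix x assume "x \<in> carrier G"
    then show "\<chi> x \<noteq> 0" using \<chi>[of x] pc(1) by (auto simp: partial_character_def)
  next
    fix x y assume "x \<in> carrier G" "y \<in> carrier G"
    then show "\<chi> (x \<otimes> y) = \<chi> x * \<chi> y"
      by (intro uniq partial_characterD(1)[OF pc(1)] \<chi>)
  next
    show "\<chi> h = w" using uniq pc(2) .
  qed
qed

end

section \<open>Idempotents, square roots and unimodular vectors over F x F x F\<close>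

lemma rho_idem3: "rho (rho (idem3 0)) = idem3 1" "rho (rho (idem3 1)) = idem3 2" "rho (rho (idem3 2)) = idem3 0"
  by (simp_all add: idem3_def)

lemma idem3_exists_rho: "\<exists>j. rho (rho (idem3 j)) = idem3 i"
proof -
  consider "i = 0" | "i = 1" | "i \<ge> 2" by linarith
  then show ?thesis
  proof cases
    case 3
    then have "idem3 i = idem3 2" by (simp add: idem3_def)
    then show ?thesis using rho_idem3 by metis
  qed (use rho_idem3 in blast)+
qed

lemma idem3_orth: "i \<noteq> j \<Longrightarrow> i < 3 \<Longrightarrow> j < 3 \<Longrightarrow> idem3 i * idem3 j = 0"
  by (auto simp: idem3_def triple_zero)

lemma idem3_mult_ne_0:
  assumes "idem3 i * l \<noteq> 0"
  shows "\<exists>m. m * (idem3 i * l) = idem3 i"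
proof -
  obtain x y z where l: "l = (x, y, z)" by (cases l)
  consider "i = 0" | "i = 1" | "i \<noteq> 0" "i \<noteq> 1" by blast
  then show ?thesis
  proof cases
    case 1 then show ?thesis using assms l
      by (intro exI[of _ "(1 / x, 0, 0)"]) (auto simp: idem3_def triple_zero)
  next
    case 2 then show ?thesis using assms l
      by (intro exI[of _ "(0, 1 / y, 0)"]) (auto simp: idem3_def triple_zero)
  next
    case 3 then show ?thesis using assms l
      by (intro exI[of _ "(0, 0, 1 / z)"]) (auto simp: idem3_def triple_zero)
  qed
qed

lemma idem3_ne_0: "idem3 i \<noteq> 0"
  by (simp add: idem3_def triple_zero)

lemma triple_sqrt:
  fixes l m :: "'k::alg_closed_field triple"
  assumes "l * m = 1"
  shows "\<exists>s. s * s * l = 1"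
proof -
  obtain x y z where m: "m = (x, y, z)" by (cases m)
  obtain x' y' z' where l: "l = (x', y', z')" by (cases l)
  obtain p q r where "p ^ 2 = x" "q ^ 2 = y" "r ^ 2 = z"
    using nth_root_exists[of 2] by (metis pos2)
  then have "(p, q, r) * (p, q, r) = m" using m by (simp add: power2_eq_square)
  then show ?thesis using assms by (metis mult.commute)
qed

context cyclic_comp
begin

text \<open>In each factor of L nondegeneracy gives a value that is invertible there; the
  idempotents glue the three choices.\<close>

lemma unimodular:
  assumes "\<And>i. i < 3 \<Longrightarrow> idem3 i \<bullet> z \<noteq> 0"
  shows "\<exists>p. b p z = 1"
proof -
  have "\<exists>p. b p z * idem3 i = idem3 i" if i: "i < 3" for i
  proof -
    obtain p where "b p (idem3 i \<bullet> z) \<noteq> 0" using nondeg[of "idem3 i \<bullet> z"] assms[OF i] by blast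
    then obtain m where m: "m * (idem3 i * b p z) = idem3 i"
      using idem3_mult_ne_0[of i "b p z"] by (auto simp: b_sc_right)
    have "b (m \<bullet> p) z * idem3 i = idem3 i"
      using m by (simp add: b_sc_left ac_simps)
    then show ?thesis by blast
  qed
  then obtain p where p: "\<And>i. i < 3 \<Longrightarrow> b (p i) z * idem3 i = idem3 i" by metis
  have "b (\<Sum>i<3. idem3 i \<bullet> p i) z = (\<Sum>i<3. idem3 i)"
    using p by (simp add: b_sum_left b_sc_left mult.commute)
  then show ?thesis by (metis sum_idem3)
qed

end

context graded_cyclic_comp
begin

lemma part_0 [simp]: "E.part 0 g = 0"
  by (rule E.part_zero) (use G.one_closed in blast)

lemma part_sum: "(\<And>i. i \<in> F \<Longrightarrow> lin (f i)) \<Longrightarrow> E.part (sum f F) g = (\<Sum>i\<in>F. E.part (f i) g)"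
proof (induction F rule: infinite_finite_induct)
  case (insert x F)
  have "lin (f x)" "lin (sum f F)" using insert.prems by (auto intro: lin_sumI)
  then show ?case using insert by (simp add: part_plus)
qed simp_all

section \<open>A rank one decomposition of the grading\<close>

text \<open>Compatibility with \<open>adj\<close> will make the inducing bijection of V preserve the
  form up to a scalar; the degree clause lets \<psi> be inserted into degree computations.\<close>

definition semilinear_auto :: "(('v \<Rightarrow> 'v) \<Rightarrow> 'v \<Rightarrow> 'v) \<Rightarrow> bool" where
  "semilinear_auto \<psi> \<longleftrightarrow> (\<forall>a. lin a \<longrightarrow> lin (\<psi> a)) \<and> (\<forall>a c. lin a \<longrightarrow> lin c \<longrightarrow> \<psi> (a + c) = \<psi> a + \<psi> c) \<and>
     (\<forall>a c. lin a \<longrightarrow> lin c \<longrightarrow> \<psi> (a \<circ> c) = \<psi> a \<circ> \<psi> c) \<and> (\<forall>a. lin a \<longrightarrow> \<psi> (adj a) = adj (\<psi> a)) \<and>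
     (\<forall>l a. lin a \<longrightarrow> \<psi> (sca l a) = sca (rho (rho l)) (\<psi> a)) \<and>
     (\<forall>a. lin a \<longrightarrow> \<psi> a = 0 \<longrightarrow> a = 0) \<and> (\<forall>c. lin c \<longrightarrow> (\<exists>a. lin a \<and> \<psi> a = c)) \<and>
     (\<forall>g\<in>carrier G. \<forall>a\<in>D g. \<psi> a \<in> D g)"

text \<open>Multiplying the component of degree g by the value of a character at g is an algebra
  automorphism, and its action on L is determined by the value at h.\<close>

lemma semilinear_auto_exists: "\<exists>\<psi>. semilinear_auto \<psi>"
proof -
  \<comment> \<open>The value \<omega>^2 at h is the eigenvalue of \<rho>^2 on
    \<open>xi\<close>.\<close>
  have "(\<omega>\<^sup>2) ^ 3 = 1" using \<omega>(1) by (metis power_mult mult.commute power_one)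
  then obtain \<chi> where \<chi>: "\<And>g. g \<in> carrier G \<Longrightarrow> \<chi> g \<noteq> 0" "\<chi> h = \<omega>\<^sup>2"
    "\<And>g k. g \<in> carrier G \<Longrightarrow> k \<in> carrier G \<Longrightarrow> \<chi> (g \<otimes> k) = \<chi> g * \<chi> k"
    using G.character_exists[OF h, where w = "\<omega>\<^sup>2"] by auto
  have \<chi>1: "\<chi> \<one> = 1" using \<chi>(3)[of "\<one>" "\<one>"] \<chi>(1)[of "\<one>"] by simp
  define \<psi> where "\<psi> a = (\<Sum>g\<in>E.supp a. sca (diag (\<chi> g)) (E.part a g))" for a
  have \<psi>_eq: "\<psi> a = (\<Sum>g\<in>S. sca (diag (\<chi> g)) (E.part a g))" if "lin a" "finite S" "E.supp a \<subseteq> S" for a S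
    unfolding \<psi>_def using that by (intro sum.mono_neutral_left) (auto simp: E.supp_def)
  have \<psi>_lin: "lin (\<psi> a)" if "lin a" for a
    unfolding \<psi>_def using that by (auto intro!: lin_sumI lin_sca lin_part)
  have \<psi>_add: "\<psi> (a + c) = \<psi> a + \<psi> c" if "lin a" "lin c" for a c
  proof -
    define S where "S = E.supp a \<union> E.supp c \<union> E.supp (a + c)"
    have S: "finite S" unfolding S_def using that by (auto intro!: E.supp_finite lin_plus)
    have "\<psi> a = (\<Sum>g\<in>S. sca (diag (\<chi> g)) (E.part a g))" "\<psi> c = (\<Sum>g\<in>S. sca (diag (\<chi> g)) (E.part c g))"
      "\<psi> (a + c) = (\<Sum>g\<in>S. sca (diag (\<chi> g)) (E.part (a + c) g))"
      by (rule \<psi>_eq; use that S in \<open>auto simp: S_def lin_plus\<close>)+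
    then show ?thesis using that by (simp add: part_plus sca_add sum.distrib)
  qed
  have \<psi>_hom: "\<psi> a = sca (diag (\<chi> g)) a" if "g \<in> carrier G" "a \<in> D g" for a g
  proof -
    have "E.supp a \<subseteq> {g}" using that by (auto simp: E.supp_def E.part_hom split: if_splits)
    then show ?thesis using \<psi>_eq[of a "{g}"] that D_lin by (simp add: E.part_hom)
  qed
  have \<psi>_zero: "\<psi> 0 = 0" using \<psi>_add[of 0 0] by simp
  have \<psi>_sum: "\<psi> (sum f F) = (\<Sum>i\<in>F. \<psi> (f i))" if "\<And>i. i \<in> F \<Longrightarrow> lin (f i)" for f and F :: "'j set"
    using that
  proof (induction F rule: infinite_finite_induct)
    case (insert x F)
    have "lin (f x)" "lin (sum f F)" using insert.prems by (auto intro: lin_sumI)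
    then show ?case using insert by (simp add: \<psi>_add)
  qed (simp_all add: \<psi>_zero)
  \<comment> \<open>Additive statements may be checked on homogeneous operators.\<close>
  have hom_ind: "P a" if a: "lin a" and hom: "\<And>g a. g \<in> carrier G \<Longrightarrow> a \<in> D g \<Longrightarrow> P a"
    and zero: "P 0" and plus: "\<And>a c. lin a \<Longrightarrow> lin c \<Longrightarrow> P a \<Longrightarrow> P c \<Longrightarrow> P (a + c)" for P a
  proof -
    have A: "a \<in> Collect lin" using a by simp
    have "lin (sum (E.part a) F) \<and> P (sum (E.part a) F)" if F: "F \<subseteq> carrier G" for F
      using F
    proof (induction F rule: infinite_finite_induct)
      case (insert x F)
      have "lin (E.part a x)" "P (E.part a x)"
        using insert.prems E.part_in[OF A, of x] hom[of x] D_lin by auto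
      then show ?case using insert plus by (simp add: lin_plus)
    qed (use zero in simp_all)
    from this[OF E.supp_sub[OF A]] show ?thesis by (simp add: E.sum_part_supp[OF A])
  qed
  have \<psi>_comp: "\<psi> (a \<circ> c) = \<psi> a \<circ> \<psi> c" if a: "lin a" and c: "lin c" for a c
    using a
  proof (rule hom_ind)
    fix g a assume g: "g \<in> carrier G" "a \<in> D g"
    then have a: "lin a" by (rule D_lin)
    show "\<psi> (a \<circ> c) = \<psi> a \<circ> \<psi> c"
      using c
    proof (rule hom_ind)
      fix k c assume k: "k \<in> carrier G" "c \<in> D k"
      then have "lin c" using D_lin by blast
      then show "\<psi> (a \<circ> c) = \<psi> a \<circ> \<psi> c"
        using g k a D_mult[OF g(1) k(1) g(2) k(2)]
        by (simp add: \<psi>_hom[of "g \<otimes> k"] \<psi>_hom[OF g] \<psi>_hom[OF k] \<chi>(3) diag_mult sca_comp comp_sca sca_sca)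
    next
      have "a \<circ> 0 = (0 :: 'v \<Rightarrow> 'v)" "\<psi> a \<circ> 0 = (0 :: 'v \<Rightarrow> 'v)" using lin_zero[OF a] lin_zero[OF \<psi>_lin[OF a]] by (simp_all add: fun_simps)
      then show "\<psi> (a \<circ> 0) = \<psi> a \<circ> \<psi> 0" by (simp add: \<psi>_zero)
    next
      fix c c' assume "lin c" "lin c'" "\<psi> (a \<circ> c) = \<psi> a \<circ> \<psi> c" "\<psi> (a \<circ> c') = \<psi> a \<circ> \<psi> c'"
      then show "\<psi> (a \<circ> (c + c')) = \<psi> a \<circ> \<psi> (c + c')"
        by (simp add: comp_add_distrib_right a \<psi>_lin \<psi>_add lin_comp)
    qed
  next
    have "0 \<circ> c = (0 :: 'v \<Rightarrow> 'v)" "0 \<circ> \<psi> c = (0 :: 'v \<Rightarrow> 'v)" by (simp_all add: fun_simps)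
    then show "\<psi> (0 \<circ> c) = \<psi> 0 \<circ> \<psi> c" by (simp add: \<psi>_zero)
  next
    fix a a' assume "lin a" "lin a'" "\<psi> (a \<circ> c) = \<psi> a \<circ> \<psi> c" "\<psi> (a' \<circ> c) = \<psi> a' \<circ> \<psi> c"
    then show "\<psi> (a + a' \<circ> c) = \<psi> (a + a') \<circ> \<psi> c"
      by (simp add: comp_add_distrib \<psi>_add lin_comp c)
  qed
  have \<psi>_adj: "\<psi> (adj a) = adj (\<psi> a)" if a: "lin a" for a
    using a
  proof (rule hom_ind)
    fix g a assume g: "g \<in> carrier G" "a \<in> D g"
    then show "\<psi> (adj a) = adj (\<psi> a)"
      using \<psi>_hom[OF g] \<psi>_hom[OF g(1) D_adj[OF g]] D_lin[OF g] by (simp add: adj_sca)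
  next
    have "adj 0 = 0" using adj_add[of 0 0] by simp
    then show "\<psi> (adj 0) = adj (\<psi> 0)" by (simp add: \<psi>_zero)
  next
    fix a c assume "lin a" "lin c" "\<psi> (adj a) = adj (\<psi> a)" "\<psi> (adj c) = adj (\<psi> c)"
    then show "\<psi> (adj (a + c)) = adj (\<psi> (a + c))" by (simp add: adj_add \<psi>_add)
  qed
  have \<psi>_id: "\<psi> (sca l id) = sca (rho (rho l)) id" for l
  proof -
    obtain c0 c1 c2 where l: "l = diag c0 + diag c1 * xi + diag c2 * (xi * xi)" using L_decomp by blast
    have w: "diag (\<omega>\<^sup>2) * xi = rho (rho xi)"
      by (simp add: rho_xi power2_eq_square diag_mult ac_simps)
    have "\<psi> (sca l id) = \<psi> (sca (diag c0) id) + \<psi> (sca (diag c1 * xi) id) + \<psi> (sca (diag c2 * (xi * xi)) id)"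
      unfolding l sca_add_left by (simp add: \<psi>_add lin_plus lin_sca)
    also have "\<psi> (sca (diag c0) id) = sca (diag c0) id"
      using \<psi>_hom[of "\<one>" "sca (diag c0) id"] LD_one \<chi>1 by (auto simp: LD_def)
    also have "\<psi> (sca (diag c1 * xi) id) = sca (diag c1 * (diag (\<omega>\<^sup>2) * xi)) id"
      using \<psi>_hom[of h "sca (diag c1 * xi) id"] LD_h \<chi>(2) h by (auto simp: LD_def sca_sca ac_simps)
    also have "\<psi> (sca (diag c2 * (xi * xi)) id) = sca (diag c2 * ((diag (\<omega>\<^sup>2) * xi) * (diag (\<omega>\<^sup>2) * xi))) id"
    proof -
      have "diag c2 * (xi * xi) \<in> LD (h \<otimes> h)" unfolding LD_hh by blast
      then have D: "sca (diag c2 * (xi * xi)) id \<in> D (h \<otimes> h)" by (simp only: LD_def mem_Collect_eq)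
      have "diag (\<chi> (h \<otimes> h)) = diag (\<omega>\<^sup>2) * diag (\<omega>\<^sup>2)"
        unfolding \<chi>(3)[OF h(1) h(1)] \<chi>(2) by (rule diag_mult)
      then show ?thesis
        unfolding \<psi>_hom[OF h_facts(5) D] sca_sca by (simp only: ac_simps)
    qed
    finally show ?thesis unfolding w by (simp add: l sca_add_left)
  qed
  have \<psi>_sca: "\<psi> (sca l a) = sca (rho (rho l)) (\<psi> a)" if a: "lin a" for l a
  proof -
    have "sca l a = sca l id \<circ> a" by (simp add: sca_comp)
    then show ?thesis using a by (simp add: \<psi>_comp lin_sca \<psi>_id) (simp add: sca_comp)
  qed
  have \<psi>_part: "E.part (\<psi> a) g = sca (diag (\<chi> g)) (E.part a g)" if a: "lin a" and g: "g \<in> carrier G" for a g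
    using a
  proof (rule hom_ind)
    fix k a assume k: "k \<in> carrier G" "a \<in> D k"
    then show "E.part (\<psi> a) g = sca (diag (\<chi> g)) (E.part a g)"
      by (auto simp: \<psi>_hom[OF k] part_sca_diag D_lin E.part_hom[OF k])
  next
    show "E.part (\<psi> 0) g = sca (diag (\<chi> g)) (E.part 0 g)"
      by (simp add: \<psi>_zero)
  next
    fix a c assume "lin a" "lin c" "E.part (\<psi> a) g = sca (diag (\<chi> g)) (E.part a g)"
      "E.part (\<psi> c) g = sca (diag (\<chi> g)) (E.part c g)"
    then show "E.part (\<psi> (a + c)) g = sca (diag (\<chi> g)) (E.part (a + c) g)"
      by (simp add: \<psi>_add part_plus \<psi>_lin sca_add)
  qed
  have d: "diag (1 / \<chi> g) * diag (\<chi> g) = 1" "diag (\<chi> g) * diag (1 / \<chi> g) = 1" if "g \<in> carrier G" for g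
  proof -
    have "1 / \<chi> g * \<chi> g = 1" using \<chi>(1)[OF that] by simp
    then show "diag (1 / \<chi> g) * diag (\<chi> g) = 1" by (metis diag_mult diag_one)
    then show "diag (\<chi> g) * diag (1 / \<chi> g) = 1" by (simp add: mult.commute)
  qed
  have \<psi>_inj: "a = 0" if a: "lin a" "\<psi> a = 0" for a
  proof -
    have "E.part a g = 0" if g: "g \<in> E.supp a" for g
    proof -
      have g: "g \<in> carrier G" using g E.supp_sub a by auto
      then have "sca (diag (\<chi> g)) (E.part a g) = 0"
        using \<psi>_part[OF a(1) g] a(2) by simp
      then have "sca (diag (1 / \<chi> g)) (sca (diag (\<chi> g)) (E.part a g)) = 0" by simp
      then show ?thesis using d[OF g] by (simp add: sca_sca)
    qed
    then have "E.supp a = {}" by (auto simp: E.supp_def)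
    then show ?thesis using E.sum_part_supp[of a] a by simp
  qed
  have \<psi>_surj: "\<exists>a. lin a \<and> \<psi> a = c" if c: "lin c" for c
    using c
  proof (rule hom_ind)
    fix k c assume k: "k \<in> carrier G" "c \<in> D k"
    then have "sca (diag (1 / \<chi> k)) c \<in> D k" by (rule D_diag)
    from \<psi>_hom[OF k(1) this] show "\<exists>a. lin a \<and> \<psi> a = c"
      using d[OF k(1)] D_lin[OF k] by (intro exI[of _ "sca (diag (1 / \<chi> k)) c"]) (simp add: sca_sca lin_sca)
  next
    show "\<exists>a. lin a \<and> \<psi> a = 0" using \<psi>_zero by (intro exI[of _ 0]) simp
  next
    fix c c' assume "\<exists>a. lin a \<and> \<psi> a = c" "\<exists>a. lin a \<and> \<psi> a = c'"
    then show "\<exists>a. lin a \<and> \<psi> a = c + c'" using \<psi>_add lin_plus by metis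
  qed
  have "\<psi> a \<in> D g" if "g \<in> carrier G" "a \<in> D g" for g a
    using \<psi>_hom[OF that] D_diag[OF that] by simp
  then show ?thesis
    using \<psi>_lin \<psi>_add \<psi>_comp \<psi>_adj \<psi>_sca \<psi>_inj \<psi>_surj
    by (intro exI[of _ \<psi>]) (simp add: semilinear_auto_def)
qed

text \<open>The map sends \<open>x \<otimes> y\<close> to a multiple of \<open>x \<star> u(y)\<close>, where \<open>u\<close> is a semilinear bijection of \<open>V\<close>
  inducing the automorphism \<open>\<psi>\<close>.\<close>

lemma rank_one_map:
  "\<exists>f :: ('v \<Rightarrow> 'v) \<Rightarrow> 'v. (\<forall>a c. f (a + c) = f a + f c) \<and> (\<forall>l a. f (sca l a) = rho l \<bullet> f a) \<and>
     (\<forall>v. \<exists>a. lin a \<and> f a = v) \<and>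
     (\<forall>g\<in>carrier G. \<forall>k\<in>carrier G. \<forall>a\<in>D g. \<forall>c\<in>D k. ten (f a) (f c) \<in> D (g \<otimes> k))"
proof -
  obtain \<psi> where \<psi>: "semilinear_auto \<psi>" using semilinear_auto_exists by blast
  have \<psi>_lin: "lin a \<Longrightarrow> lin (\<psi> a)"
    and \<psi>_add: "lin a \<Longrightarrow> lin c \<Longrightarrow> \<psi> (a + c) = \<psi> a + \<psi> c"
    and \<psi>_comp: "lin a \<Longrightarrow> lin c \<Longrightarrow> \<psi> (a \<circ> c) = \<psi> a \<circ> \<psi> c"
    and \<psi>_adj: "lin a \<Longrightarrow> \<psi> (adj a) = adj (\<psi> a)"
    and \<psi>_sca: "lin a \<Longrightarrow> \<psi> (sca l a) = sca (rho (rho l)) (\<psi> a)"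
    and \<psi>_inj: "lin a \<Longrightarrow> \<psi> a = 0 \<Longrightarrow> a = 0" and \<psi>_surj: "lin c \<Longrightarrow> \<exists>a. lin a \<and> \<psi> a = c"
    and \<psi>_D: "g \<in> carrier G \<Longrightarrow> a \<in> D g \<Longrightarrow> \<psi> a \<in> D g" for a c l g
    using \<psi> by (simp_all add: semilinear_auto_def)
  obtain x0 y0 where xy: "b x0 y0 = 1" using unit_ex by blast
  have yx: "b y0 x0 = 1" using xy b_sym by simp
  \<comment> \<open>The image of a rank one projection. As in the Skolem-Noether theorem, a vector
    that it does not kill is the seed from which u is built; here it must survive in all three
    factors of L.\<close>
  define \<epsilon> where "\<epsilon> = \<psi> (ten x0 y0)"
  have \<epsilon>_lin: "lin \<epsilon>" by (simp add: \<epsilon>_def \<psi>_lin)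
  \<comment> \<open>If \<epsilon> vanished in one factor, injectivity of \<psi> would kill the
    projection in the factor that \<rho>^2 carries there.\<close>
  have "\<exists>z. idem3 i \<bullet> \<epsilon> z \<noteq> 0" for i
  proof (rule ccontr)
    assume "\<not> ?thesis"
    then have "sca (idem3 i) \<epsilon> = 0" by (simp add: sca_def fun_simps)
    moreover obtain j where "rho (rho (idem3 j)) = (idem3 i :: 'k triple)" using idem3_exists_rho by metis
    ultimately have "\<psi> (sca (idem3 j) (ten x0 y0)) = 0" by (simp add: \<psi>_sca \<epsilon>_def)
    then have "sca (idem3 j) (ten x0 y0) = 0" by (simp add: \<psi>_inj lin_sca)
    then have "b (sca (idem3 j) (ten x0 y0) x0) y0 = 0" by (simp add: fun_simps)
    then have "idem3 j = (0 :: 'k triple)" by (simp add: sca_def ten_def yx sc_one b_sc_left xy)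
    then show False by (simp add: idem3_ne_0)
  qed
  then obtain zz where zz: "\<And>i. idem3 i \<bullet> \<epsilon> (zz i) \<noteq> 0" by metis
  \<comment> \<open>Glued factor by factor, since no single \<open>zz i\<close> need survive in all
    three.\<close>
  define z0 where "z0 = (\<Sum>i<3. idem3 i \<bullet> zz i)"
  have "idem3 i \<bullet> \<epsilon> z0 = idem3 i \<bullet> \<epsilon> (zz i)" if i: "i < 3" for i
  proof -
    have "idem3 i \<bullet> \<epsilon> z0 = (\<Sum>j<3. (idem3 i * idem3 j) \<bullet> \<epsilon> (zz j))"
      by (simp add: z0_def lin_sum[OF \<epsilon>_lin] lin_sc[OF \<epsilon>_lin] sc_sum_right sc_mult)
    also have "\<dots> = (\<Sum>j\<in>{i}. (idem3 i * idem3 j) \<bullet> \<epsilon> (zz j))"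
      using i by (intro sum.mono_neutral_right) (auto simp: idem3_orth)
    finally show ?thesis by simp
  qed
  then obtain p0 where p0: "b p0 (\<epsilon> z0) = 1" using unimodular[of "\<epsilon> z0"] zz by metis
  \<comment> \<open>V is identified with the left ideal of the operators v \<otimes> y0; \<psi>
    moves this ideal, and evaluation at z0 returns to V, so that u(a v) = \<psi>(a) u(v).\<close>
  define u where "u v = \<psi> (ten v y0) z0" for v
  have u_lin: "u (a v) = \<psi> a (u v)" if "lin a" for a v
    using that by (simp add: u_def \<psi>_comp flip: comp_ten) (simp add: o_apply)
  have u_add: "u (v + w) = u v + u w" for v w
    by (simp add: u_def ten_add_left \<psi>_add plus_fun_apply)
  have u_sc: "u (l \<bullet> v) = rho (rho l) \<bullet> u v" for l v
    by (simp add: u_def \<psi>_sca flip: sca_ten) (simp add: sca_def)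
  have u_surj: "\<exists>v. u v = w" for w
  proof -
    \<comment> \<open>Since u(x0) = \<epsilon>(z0) pairs to 1 with p0, the operator w \<otimes> p0
      sends it to w.\<close>
    obtain a where a: "lin a" "\<psi> a = ten w p0" using \<psi>_surj[of "ten w p0"] by auto
    have "u (a x0) = \<psi> a (\<epsilon> z0)" using u_lin[OF a(1), of x0] by (simp add: u_def \<epsilon>_def)
    also have "\<dots> = w" by (simp add: a(2)) (simp add: ten_def p0 sc_one)
    finally show ?thesis by blast
  qed
  \<comment> \<open>The form pulled back along u. The outer \<rho> undoes the twist by \<rho>^2, and
    compatibility of \<psi> with adjoints leaves only multiples of b.\<close>
  define c where "c v w = rho (b (u v) (u w))" for v w
  have c_adj: "c (a v) w = c v (adj a w)" if "lin a" for a v w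
    using that by (simp add: c_def u_lin \<psi>_adj adj_iff[OF \<psi>_lin[OF that]])
  define \<mu> where "\<mu> = c x0 y0"
  have c_eq: "c v w = b v w * \<mu>" for v w
  proof -
    have "c v w = c (ten v y0 x0) w" by (simp add: ten_def yx sc_one)
    also have "\<dots> = c x0 (ten y0 v w)" by (subst c_adj) simp_all
    also have "\<dots> = b v w * \<mu>" by (simp add: ten_def c_def u_sc b_sc_right \<mu>_def)
    finally show ?thesis .
  qed
  have b_u: "b (u v) (u w) = rho (rho (b v w * \<mu>))" for v w
    using c_eq[of v w, symmetric] by (simp add: c_def)
  \<comment> \<open>Surjectivity of u makes the multiplier \<mu> invertible. A square root s of the
    inverse of \<rho>(\<mu>) will absorb it, entering once through each factor of f(a) \<otimes>
    f(d).\<close>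
  obtain v1 w1 where "u v1 = x0" "u w1 = y0" using u_surj by metis
  then have "rho (rho (b v1 w1 * \<mu>)) = 1" using b_u[of v1 w1] xy by simp
  then have "b v1 w1 * \<mu> = 1" by (metis rho_rho_rho rho_one)
  then have "rho \<mu> * rho (b v1 w1) = 1" by (metis rho_mult rho_one mult.commute)
  then obtain s where s: "s * s * rho \<mu> = 1" using triple_sqrt by metis
  have ten_u: "ten (u y) (u w) = sca (rho (rho \<mu>)) (\<psi> (ten y w))" for y w
  proof
    fix v' obtain v where v: "v' = u v" using u_surj by metis
    have "\<psi> (ten y w) (u v) = u (ten y w v)" by (simp add: u_lin)
    also have "\<dots> = rho (rho (b w v)) \<bullet> u y" by (simp add: ten_def u_sc)
    finally show "ten (u y) (u w) v' = sca (rho (rho \<mu>)) (\<psi> (ten y w)) v'"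
      unfolding v sca_def by (simp add: ten_def b_u sc_mult sc_commute)
  qed
  define B where "B x y = x \<star> u y" for x y
  have B: "balanced B"
    by (simp add: balanced_def B_def mul_add_left mul_add_right u_add mul_sc_left mul_sc_right u_sc)
  define f where "f a = s \<bullet> lift B a" for a
  have f_add: "f (a + a') = f a + f a'" for a a'
    by (simp add: f_def lift_add[OF B] sc_add_right)
  have f_sca: "f (sca l a) = rho l \<bullet> f a" for l a
    by (simp add: f_def lift_def sca_def B_def mul_sc_left sc_sum_right sc_commute)
  have f_surj: "\<exists>a. lin a \<and> f a = v" for v
  proof -
    have "\<exists>t. s * t = 1" using s by (metis mult.assoc)
    then obtain t where t: "s * t = 1" by blast
    \<comment> \<open>The polarized composition law with b(x0, y0) = 1 writes any vector as a sum of
      two products; t compensates the scalar s.\<close>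
    obtain p q where pq: "u p = (t \<bullet> v) \<star> y0" "u q = (t \<bullet> v) \<star> x0"
      using u_surj by metis
    have "lift B (ten x0 p + ten y0 q) = t \<bullet> v"
      using comp_id[of x0 "t \<bullet> v" y0] by (simp add: lift_add[OF B] lift_ten[OF B] B_def pq xy sc_one)
    then have "f (ten x0 p + ten y0 q) = v"
      by (simp add: f_def t sc_one flip: sc_mult)
    then show ?thesis by (metis lin_plus lin_ten)
  qed
  have "ten (f a) (f d) \<in> D (g \<otimes> k)" if g: "g \<in> carrier G" "a \<in> D g" and k: "k \<in> carrier G" "d \<in> D k" for g k a d
  proof -
    have a: "lin a" and d: "lin d" using D_lin g k by auto
    \<comment> \<open>For a = x \<otimes> y and d = z \<otimes> w the factors of f(a) \<otimes> f(d)
      regroup as \<Phi>(x \<otimes> z, u(y) \<otimes> u(w)) up to a scalar. The partners are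
      exchanged across a and d, which in dual bases is again a Casimir sum; the two adjoints put the
      factors in the required order.\<close>
    let ?B = "\<lambda>P R. \<Phi> (a \<circ> P) (\<psi> (adj (adj d \<circ> R)))"
    have lift_d: "lift B d = (\<Sum>j<n. B (e' j) (adj d (e j)))"
      by (subst ten_expand_adj[OF d, symmetric]) (simp add: lift_sum[OF B] lift_ten[OF B])
    have summand: "ten (B (a (e i)) (e' i)) (B (e' j) (adj d (e j)))
        = sca (rho \<mu>) (?B (ten (e i) (e' j)) (ten (e j) (e' i)))" for i j
    proof -
      have "ten (B (a (e i)) (e' i)) (B (e' j) (adj d (e j)))
         = \<Phi> (ten (a (e i)) (e' j)) (ten (u (e' i)) (u (adj d (e j))))"
        by (simp add: B_def \<Phi>_ten_ten)
      also have "\<dots> = sca (rho \<mu>) (\<Phi> (ten (a (e i)) (e' j)) (\<psi> (ten (e' i) (adj d (e j)))))"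
        by (simp add: ten_u \<Phi>_sca_right)
      finally show ?thesis by (simp add: comp_ten a)
    qed
    have "ten (lift B a) (lift B d) = (\<Sum>i<n. \<Sum>j<n. ten (B (a (e i)) (e' i)) (B (e' j) (adj d (e j))))"
      unfolding lift_d lift_def[of B a]
      by (subst sum.swap) (simp add: additive_sum[of "\<lambda>x. ten x _"] additive_sum[of "ten _"] ten_add_left ten_add_right)
    also have "\<dots> = sca (rho \<mu>) (\<Sum>i<n. \<Sum>j<n. ?B (ten (e i) (e' j)) (ten (e j) (e' i)))"
      unfolding summand by (simp only: sca_sum)
    finally have eq: "ten (f a) (f d) = (\<Sum>i<n. \<Sum>j<n. ?B (ten (e i) (e' j)) (ten (e j) (e' i)))"
      using s by (simp add: f_def sca_sca mult.assoc flip: sca_ten sca_ten')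
    have "biadd ?B"
      by (simp add: biadd_def comp_add_distrib_right a adj_add \<psi>_add \<Phi>_add_left \<Phi>_add_right \<psi>_lin)
    \<comment> \<open>The second slot twists by \<rho>^2 through \<psi> and again through \<Phi>,
      hence by \<rho> in total, as the first slot does.\<close>
    moreover have "?B (sca l P) R = ?B P (sca l R)" if "lin R" for l P R
      using that by (simp add: comp_sca a \<Phi>_sca_left adj_sca lin_comp \<psi>_sca \<Phi>_sca_right)
    moreover have "?B P R \<in> D (g \<otimes> k)" if p: "p \<in> carrier G" "P \<in> D p" "R \<in> D (inv p)" for p P R
    proof -
      have "?B P R \<in> D ((g \<otimes> p) \<otimes> (k \<otimes> inv p))"
        using p g k by (intro \<Phi>_degree \<psi>_D D_mult D_adj) auto
      moreover have "(g \<otimes> p) \<otimes> (k \<otimes> inv p) = (p \<otimes> inv p) \<otimes> (g \<otimes> k)"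
        using p g k by (simp add: G.m_ac del: G.r_inv G.l_inv)
      ultimately show ?thesis using p g k by simp
    qed
    ultimately show ?thesis
      unfolding eq using g k by (intro casimir[of ?B]) auto
  qed
  then show ?thesis using f_add f_sca f_surj by (intro exI[of _ f]) blast
qed

section \<open>The grading of the composition algebra\<close>

lemma sum_translate:
  assumes "F \<subseteq> carrier G" "s \<in> carrier G"
  shows "(\<Sum>g\<in>(\<lambda>g. g \<otimes> s) ` F. f g) = (\<Sum>g\<in>F. f (g \<otimes> s))"
proof -
  have "inj_on (\<lambda>g. g \<otimes> s) F" using assms by (intro inj_onI) (meson G.right_cancel subsetD)
  then show ?thesis by (simp add: sum.reindex o_apply)
qed

text \<open>Independence of the \<open>W g\<close>, and the agreement of the grading they induce on
  operators with \<open>D\<close>, are to be extracted from \<open>W_ten\<close>: the degree of a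
  vector is read off from its tensor products with homogeneous vectors.\<close>

context
  fixes W :: "'g \<Rightarrow> 'v set"
  assumes W_zero: "g \<in> carrier G \<Longrightarrow> 0 \<in> W g"
    and W_add: "g \<in> carrier G \<Longrightarrow> x \<in> W g \<Longrightarrow> y \<in> W g \<Longrightarrow> x + y \<in> W g"
    and W_LD: "g \<in> carrier G \<Longrightarrow> k \<in> carrier G \<Longrightarrow> l \<in> LD g \<Longrightarrow> x \<in> W k \<Longrightarrow> l \<bullet> x \<in> W (g \<otimes> k)"
    and W_decomp: "\<exists>F w. finite F \<and> F \<subseteq> carrier G \<and> (\<forall>g\<in>F. w g \<in> W g) \<and> v = sum w F"
    and W_ten: "g \<in> carrier G \<Longrightarrow> k \<in> carrier G \<Longrightarrow> x \<in> W g \<Longrightarrow> y \<in> W k \<Longrightarrow> ten x y \<in> D (g \<otimes> k)"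
begin

lemma W_additive_zero:
  assumes "\<And>x y. f (x + y) = f x + f y" "\<And>g x. g \<in> carrier G \<Longrightarrow> x \<in> W g \<Longrightarrow> f x = 0"
  shows "f v = (0 :: 'b::ab_group_add)"
proof -
  obtain F w where F: "F \<subseteq> carrier G" "\<forall>g\<in>F. w g \<in> W g" "v = sum w F" using W_decomp[of v] by blast
  have "f v = (\<Sum>g\<in>F. f (w g))" unfolding F(3) by (rule additive_sum) (rule assms(1))
  also have "\<dots> = 0" using F assms(2) by (intro sum.neutral) blast
  finally show ?thesis .
qed

lemma W_ten_eq_0: "(\<And>g y. g \<in> carrier G \<Longrightarrow> y \<in> W g \<Longrightarrow> ten x y = 0) \<Longrightarrow> x = 0"
  by (rule ten_eq_0) (rule W_additive_zero[of "ten x"], auto simp: ten_add_right)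

text \<open>Tensoring with a vector of degree m shifts all degrees by m, so the terms w g land in
  distinct components of E.\<close>

lemma part_ten_sum:
  assumes F: "finite F" "F \<subseteq> carrier G" "\<And>g. g \<in> F \<Longrightarrow> w g \<in> W g" and m: "m \<in> carrier G" "y \<in> W m"
    and k: "k \<in> carrier G"
  shows "E.part (ten (sum w F) y) (k \<otimes> m) = (if k \<in> F then ten (w k) y else 0)"
proof -
  have "ten (sum w F) y = (\<Sum>g\<in>F. ten (w g) y)"
    by (rule additive_sum[of "\<lambda>x. ten x y"]) (rule ten_add_left)
  then have "E.part (ten (sum w F) y) (k \<otimes> m) = (\<Sum>g\<in>F. E.part (ten (w g) y) (k \<otimes> m))"
    by (simp add: part_sum)
  also have "\<dots> = (\<Sum>g\<in>F. if g = k then ten (w k) y else 0)"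
  proof (rule sum.cong)
    fix g assume g: "g \<in> F"
    then have gc: "g \<in> carrier G" "ten (w g) y \<in> D (g \<otimes> m)" using F m by (auto intro: W_ten)
    then show "E.part (ten (w g) y) (k \<otimes> m) = (if g = k then ten (w k) y else 0)"
      using E.part_hom[of "g \<otimes> m" "ten (w g) y" "k \<otimes> m"] m k by auto
  qed simp
  finally show ?thesis using F(1) by simp
qed

lemma W_indep:
  assumes F: "finite F" "F \<subseteq> carrier G" "\<And>g. g \<in> F \<Longrightarrow> w g \<in> W g" "sum w F = 0" and k: "k \<in> F"
  shows "w k = 0"
proof (rule W_ten_eq_0)
  fix m y assume m: "m \<in> carrier G" "y \<in> W m"
  have "ten 0 y = 0" by (simp add: ten_def fun_simps)
  then show "ten (w k) y = 0"
    using part_ten_sum[OF F(1-3) m, of k] F k by auto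
qed

lemma W_memI:
  assumes k: "k \<in> carrier G" and v: "\<And>m y. m \<in> carrier G \<Longrightarrow> y \<in> W m \<Longrightarrow> ten v y \<in> D (k \<otimes> m)"
  shows "v \<in> W k"
proof -
  obtain F w where F: "finite F" "F \<subseteq> carrier G" "\<And>g. g \<in> F \<Longrightarrow> w g \<in> W g" "v = sum w F"
    using W_decomp[of v] by blast
  have "w c = 0" if c: "c \<in> F" "c \<noteq> k" for c
  proof (rule W_ten_eq_0)
    fix m y assume m: "m \<in> carrier G" "y \<in> W m"
    have cc: "c \<in> carrier G" using c F by blast
    have "ten (w c) y = E.part (ten v y) (c \<otimes> m)"
      using part_ten_sum[OF F(1-3) m cc] c F by simp
    also have "\<dots> = 0"
      using E.part_hom[OF _ v[OF m], of "c \<otimes> m"] k m cc c by simp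
    finally show "ten (w c) y = 0" .
  qed
  then have "sum w F = sum w (F \<inter> {k})" using F(1) by (intro sum.mono_neutral_right) auto
  also have "\<dots> \<in> W k" using F(3) k W_zero by (cases "k \<in> F") auto
  finally show ?thesis using F(4) by simp
qed

text \<open>The identity a (x \<otimes> y) = (a x) \<otimes> y reduces this to the multiplicativity
  of \<open>D\<close>.\<close>

lemma D_W:
  assumes g: "g \<in> carrier G" "a \<in> D g" and k: "k \<in> carrier G" "x \<in> W k"
  shows "a x \<in> W (g \<otimes> k)"
proof (rule W_memI)
  fix m y assume m: "m \<in> carrier G" "y \<in> W m"
  have "a \<circ> ten x y \<in> D (g \<otimes> (k \<otimes> m))" using g k m by (intro D_mult W_ten) auto
  then show "ten (a x) y \<in> D (g \<otimes> k \<otimes> m)" using g k m D_lin[OF g] by (simp add: comp_ten G.m_assoc)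
qed (use g k in auto)

text \<open>On a vector of degree k the component of \<open>a\<close> of degree d has values of
  degree d k. If a(x) has degree g k, independence of the \<open>W g\<close> kills all components
  other than that of degree g.\<close>

lemma W_D:
  assumes a: "lin a" and g: "g \<in> carrier G"
    and W: "\<And>k x. k \<in> carrier G \<Longrightarrow> x \<in> W k \<Longrightarrow> a x \<in> W (g \<otimes> k)"
  shows "a \<in> D g"
proof (rule E.in_D_if)
  show A: "a \<in> Collect lin" using a by simp
  fix c assume c: "c \<in> carrier G" "c \<noteq> g"
  have l: "lin (E.part a c)" using a by (rule lin_part)
  show "E.part a c = 0"
  proof
    fix v
    show "E.part a c v = 0 v"
      unfolding zero_fun_apply
    proof (rule W_additive_zero[of "E.part a c"])
      show "E.part a c (x + y) = E.part a c x + E.part a c y" for x y by (rule lin_add[OF l])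
    next
      fix k x assume k: "k \<in> carrier G" "x \<in> W k"
      \<comment> \<open>Both c and g are put in, so that these two degrees occur even when the
        component there is 0.\<close>
      define F where "F = insert c (insert g (E.supp a))"
      define K where "K = (\<lambda>d. d \<otimes> k) ` F"
      have fin: "finite F" "F \<subseteq> carrier G" "c \<in> F" "g \<in> F"
        using E.supp_finite[OF A] E.supp_sub[OF A] c g by (auto simp: F_def)
      have finK: "finite K" "K \<subseteq> carrier G" "c \<otimes> k \<in> K" "g \<otimes> k \<in> K"
        using fin k by (auto simp: K_def)
      have aF: "sum (E.part a) F = a" by (rule E.sum_part[OF A fin(1)]) (auto simp: F_def)
      have "a x = (\<Sum>d\<in>F. E.part a d x)"
        using sum_fun_apply[of "E.part a" F x] unfolding aF .
      also have "\<dots> = (\<Sum>d\<in>F. E.part a (d \<otimes> k \<otimes> inv k) x)"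
        using fin k by (intro sum.cong) (auto simp: G.m_assoc)
      also have "\<dots> = (\<Sum>d\<in>K. E.part a (d \<otimes> inv k) x)"
        unfolding K_def using fin(2) k by (simp only: sum_translate)
      finally have sum: "a x = (\<Sum>d\<in>K. E.part a (d \<otimes> inv k) x)" .
      define w where "w d = E.part a (d \<otimes> inv k) x - (if d = g \<otimes> k then a x else 0)" for d
      have "sum w (K) = 0"
        unfolding w_def sum_subtractf using finK by (simp add: sum[symmetric])
      moreover have "w d \<in> W d" if d: "d \<in> K" for d
      proof -
        have d': "d \<in> carrier G" using d finK by auto
        have "E.part a (d \<otimes> inv k) x \<in> W (d \<otimes> inv k \<otimes> k)"
          using d' k by (intro D_W E.part_in[OF A]) auto
        then have 1: "E.part a (d \<otimes> inv k) x \<in> W d" using d' k by (simp add: G.m_assoc)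
        have "(- 1) \<bullet> a x \<in> W (\<one> \<otimes> (g \<otimes> k))"
          using W[OF k] LD_diag[of "- 1"] g k by (intro W_LD) (auto simp: diag_def triple_one uminus_prod_def)
        then have 2: "- a x \<in> W (g \<otimes> k)" using g k by (simp add: sc_minus_one)
        show ?thesis using W_add[OF _ 1, of "- a x"] 1 2 d' by (auto simp: w_def)
      qed
      ultimately have "w (c \<otimes> k) = 0"
        using finK by (intro W_indep[of "K" w]) auto
      then show "E.part a c x = 0" using c g k by (simp add: w_def G.m_assoc)
    qed
  qed
qed (rule g)

lemma b_W: "g \<in> carrier G \<Longrightarrow> k \<in> carrier G \<Longrightarrow> x \<in> W g \<Longrightarrow> y \<in> W k \<Longrightarrow> b x y \<in> LD (g \<otimes> k)"
  using tr_LD[of "g \<otimes> k" "ten x y"] W_ten by simp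

text \<open>Otherwise every product would be orthogonal to everything, against
  \<open>comp_id\<close> for a pair with b(x, y) = 1.\<close>

lemma product_nonzero:
  "\<exists>p q r x y z. p \<in> carrier G \<and> q \<in> carrier G \<and> r \<in> carrier G \<and> x \<in> W p \<and> y \<in> W q \<and> z \<in> W r \<and> b (x \<star> y) z \<noteq> 0"
proof (rule ccontr)
  assume *: "\<not> ?thesis"
  have 1: "b (x \<star> y) z = 0" if "p \<in> carrier G" "x \<in> W p" "q \<in> carrier G" "y \<in> W q" for p x q y z
    by (rule W_additive_zero[of "b (x \<star> y)"]) (use that * in \<open>auto simp: b_add_right\<close>)
  have 2: "b (x \<star> y) z = 0" if "p \<in> carrier G" "x \<in> W p" for p x y z
    by (rule W_additive_zero[of "\<lambda>y. b (x \<star> y) z"]) (use that 1 in \<open>auto simp: b_add_left mul_add_right\<close>)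
  have 3: "b (x \<star> y) z = 0" for x y z
    by (rule W_additive_zero[of "\<lambda>x. b (x \<star> y) z"]) (use 2 in \<open>auto simp: b_add_left mul_add_left\<close>)
  obtain x y where xy: "b x y = 1" using unit_ex by blast
  have "b (x \<star> (x \<star> y) + y \<star> (x \<star> x)) y = 0" by (simp add: b_add_left 3)
  then have "(1 :: 'k triple) = 0" by (simp add: comp_id xy sc_one)
  then show False by simp
qed

text \<open>An eigenvalue of \<rho>^2 is a cube root of unity, and each of the three eigenlines is
  one homogeneous component.\<close>

lemma eigen_LD:
  assumes l: "rho (rho l) = diag s * l" "l \<noteq> 0"
  shows "\<exists>q\<in>carrier G. l \<in> LD q"
proof -
  obtain x y z where xyz: "l = (x, y, z)" by (cases l)
  have "(z, x, y) = (s * x, s * y, s * z)"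
    using l(1) unfolding xyz diag_def rho.simps triple_times .
  then have eqs: "z = s * x" "x = s * y" "y = s * z" unfolding prod.inject by blast+
  have x0: "x \<noteq> 0"
  proof
    assume x: "x = 0"
    have z: "z = 0" using eqs(1) unfolding x by simp
    have "y = 0" using eqs(3) unfolding z by simp
    then show False using l(2) x z by (simp add: xyz triple_zero)
  qed
  have "s ^ 3 * x = s * (s * (s * x))" by (simp only: power3_eq_cube mult.assoc)
  also have "\<dots> = x" by (simp only: eqs[symmetric])
  finally have "s ^ 3 * x = 1 * x" by (simp only: mult_1)
  then have s3: "s ^ 3 = 1" by (rule iffD1[OF mult_right_cancel[OF x0]])
  have "(s - 1) * ((s - \<omega>) * (s - \<omega>\<^sup>2)) = s ^ 3 - \<omega> ^ 3 - (1 + \<omega> + \<omega>\<^sup>2) * (s\<^sup>2 - \<omega> * s)"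
    by (simp add: algebra_simps power2_eq_square power3_eq_cube)
  then have "(s - 1) * ((s - \<omega>) * (s - \<omega>\<^sup>2)) = 0" unfolding s3 \<omega>(1) \<omega>_sum by simp
  then consider "s = 1" | "s = \<omega>" | "s = \<omega>\<^sup>2" by auto
  then show ?thesis
  proof cases
    case 1
    then have "l = diag x" using eqs by (simp add: xyz diag_def)
    then show ?thesis using LD_diag by blast
  next
    case 2
    have "y = x * \<omega>\<^sup>2"
      by (subst eqs(3), subst eqs(1)) (simp only: 2 power2_eq_square ac_simps)
    moreover have "z = x * (\<omega>\<^sup>2 * \<omega>\<^sup>2)"
    proof -
      have "\<omega>\<^sup>2 * \<omega>\<^sup>2 = \<omega> ^ 3 * \<omega>" by (simp only: power2_eq_square power3_eq_cube ac_simps)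
      then show ?thesis by (subst eqs(1)) (simp only: 2 \<omega>(1) mult_1 mult.commute)
    qed
    ultimately have "l = diag x * (xi * xi)"
      by (simp only: xyz diag_def xi_def triple_times mult_1_right power2_eq_square[of \<omega>, symmetric])
    then show ?thesis using LD_hh h_facts(5) by blast
  next
    case 3
    have "\<omega>\<^sup>2 * \<omega>\<^sup>2 = \<omega> ^ 3 * \<omega>" by (simp only: power2_eq_square power3_eq_cube ac_simps)
    then have w: "\<omega>\<^sup>2 * \<omega>\<^sup>2 = \<omega>" by (simp only: \<omega>(1) mult_1)
    have "z = x * \<omega>\<^sup>2" by (subst eqs(1)) (simp only: 3 mult.commute)
    moreover have "y = x * \<omega>"
    proof -
      have "y = (\<omega>\<^sup>2 * \<omega>\<^sup>2) * x" by (subst eqs(3), subst eqs(1)) (simp only: 3 mult.assoc)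
      then show ?thesis unfolding w by (simp only: mult.commute)
    qed
    ultimately have "l = diag x * xi" by (simp only: xyz diag_def xi_def triple_times mult_1_right)
    then show ?thesis using LD_h h(1) by blast
  qed
qed

text \<open>The factor \<open>s\<close> is removed by passing to the components \<open>W (g \<otimes> s)\<close>.\<close>

lemma product_degree:
  "\<exists>s\<in>carrier G. s \<otimes> s = \<one> \<and>
    (\<forall>p\<in>carrier G. \<forall>q\<in>carrier G. \<forall>x\<in>W p. \<forall>y\<in>W q. x \<star> y \<in> W (p \<otimes> q \<otimes> s))"
proof -
  obtain p1 q1 r1 x1 y1 z1 where 1: "p1 \<in> carrier G" "q1 \<in> carrier G" "r1 \<in> carrier G"
    "x1 \<in> W p1" "y1 \<in> W q1" "z1 \<in> W r1" "b (x1 \<star> y1) z1 \<noteq> 0"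
    using product_nonzero by blast
  define l where "l = b (x1 \<star> y1) z1"
  define r where "r = p1 \<otimes> q1 \<otimes> r1"
  have r: "r \<in> carrier G" using 1 by (simp add: r_def)
  have l0: "l \<noteq> 0" using 1 by (simp add: l_def)
  \<comment> \<open>The operator (x \<star> y) \<otimes> (x1 \<star> y1) is homogeneous by
    \<open>\<Phi>_degree\<close>; evaluated at z1 it multiplies x \<star> y by l. It remains to
    divide by l, which is not yet known to be homogeneous.\<close>
  have step: "l \<bullet> (x \<star> y) \<in> W (p \<otimes> q \<otimes> r)" if pq: "p \<in> carrier G" "q \<in> carrier G" "x \<in> W p" "y \<in> W q" for p q x y
  proof -
    have "\<Phi> (ten x x1) (ten y y1) \<in> D ((p \<otimes> p1) \<otimes> (q \<otimes> q1))"
      using pq 1 by (intro \<Phi>_degree W_ten) auto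
    then have "ten (x \<star> y) (x1 \<star> y1) z1 \<in> W ((p \<otimes> p1) \<otimes> (q \<otimes> q1) \<otimes> r1)"
      using pq 1 by (intro D_W) (auto simp: \<Phi>_ten_ten)
    moreover have "(p \<otimes> p1) \<otimes> (q \<otimes> q1) \<otimes> r1 = p \<otimes> q \<otimes> r"
      using pq 1 by (simp add: r_def G.m_ac)
    ultimately show ?thesis by (simp add: ten_def l_def)
  qed
  \<comment> \<open>Applied to y1 \<star> z1 and paired with x1, the same step produces \<rho>^2(l)
    by cyclicity. So l^2 and l \<rho>^2(l) have the same degree, their quotient lies in F, and l is
    an eigenvector of \<rho>^2.\<close>
  have rho_l: "rho (rho l) = b (y1 \<star> z1) x1"
    unfolding l_def by (subst cyc) simp
  have "b (l \<bullet> (x1 \<star> y1)) z1 \<in> LD ((p1 \<otimes> q1 \<otimes> r) \<otimes> r1)"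
    using 1 r by (intro b_W step) auto
  moreover have "(p1 \<otimes> q1 \<otimes> r) \<otimes> r1 = r \<otimes> r" using 1 by (simp add: r_def G.m_ac)
  ultimately have ll: "l * l \<in> LD (r \<otimes> r)" by (simp add: b_sc_left l_def)
  have "b (l \<bullet> (y1 \<star> z1)) x1 \<in> LD ((q1 \<otimes> r1 \<otimes> r) \<otimes> p1)"
    using 1 r by (intro b_W step) auto
  moreover have "(q1 \<otimes> r1 \<otimes> r) \<otimes> p1 = r \<otimes> r" using 1 by (simp add: r_def G.m_ac)
  ultimately have lrl: "l * rho (rho l) \<in> LD (r \<otimes> r)" by (simp add: b_sc_left rho_l)
  have "l * l \<noteq> 0" using l0 by (cases l) (auto simp: triple_zero)
  then obtain m where m: "m \<in> LD (inv (r \<otimes> r))" "l * l * m = 1" using LD_unit[OF _ ll] r by blast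
  have "l * rho (rho l) * m \<in> LD (r \<otimes> r \<otimes> inv (r \<otimes> r))" using r by (intro LD_mult lrl m) auto
  then obtain s where s: "l * rho (rho l) * m = diag s" using r LD_one by auto
  have "rho (rho l) = diag s * l"
  proof -
    have "rho (rho l) = (l * l * m) * rho (rho l)" unfolding m by simp
    also have "\<dots> = l * (l * rho (rho l) * m)" by (simp only: ac_simps)
    finally show ?thesis unfolding s by (simp only: mult.commute)
  qed
  then obtain q where q: "q \<in> carrier G" "l \<in> LD q" using eigen_LD l0 by blast
  obtain l' where l': "l' \<in> LD (inv q)" "l * l' = 1" using LD_unit[OF q l0] by blast
  \<comment> \<open>Dividing by l, of degree q, leaves a fixed shift of degrees.\<close>
  define t where "t = r \<otimes> inv q"
  have t: "t \<in> carrier G" using r q by (simp add: t_def)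
  have prod: "x \<star> y \<in> W (p \<otimes> q' \<otimes> t)" if pq: "p \<in> carrier G" "q' \<in> carrier G" "x \<in> W p" "y \<in> W q'" for p q' x y
  proof -
    have "l' \<bullet> l \<bullet> (x \<star> y) \<in> W (inv q \<otimes> (p \<otimes> q' \<otimes> r))"
      using pq q r by (intro W_LD step l') auto
    moreover have "inv q \<otimes> (p \<otimes> q' \<otimes> r) = p \<otimes> q' \<otimes> t" using pq q r by (simp add: t_def G.m_ac)
    moreover have "l' \<bullet> l \<bullet> (x \<star> y) = x \<star> y" using l'(2) by (simp add: sc_one mult.commute flip: sc_mult)
    ultimately show ?thesis by simp
  qed
  \<comment> \<open>The degree of l is computed a second time, from the shifted products; q = r t
    together with t = r q^-1 gives t^2 = 1.\<close>
  have "l \<in> LD ((p1 \<otimes> q1 \<otimes> t) \<otimes> r1)" unfolding l_def using 1 t by (intro b_W prod) auto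
  moreover have "(p1 \<otimes> q1 \<otimes> t) \<otimes> r1 = r \<otimes> t" using 1 t by (simp add: r_def G.m_ac)
  ultimately have "q = r \<otimes> t" using LD_disjoint[of q "r \<otimes> t" l] q r t l0 by simp
  then have "t \<otimes> t = (r \<otimes> inv (r \<otimes> t)) \<otimes> t" by (simp add: t_def)
  also have "\<dots> = \<one>" using r t by (simp add: G.inv_mult G.m_assoc[symmetric])
  finally have "t \<otimes> t = \<one>" .
  then show ?thesis using t prod by blast
qed

text \<open>Products from W(g s) and W(k s) lie in W(g s k s s), which is W(g k s) since s^2 = 1.
  For \<open>b\<close> the two shifts cancel, and for operators source and target shift
  alike.\<close>

lemma shifted_grading:
  "\<exists>V. direct_sum (carrier G) UNIV V \<and>
     (\<forall>g\<in>carrier G. \<forall>k\<in>carrier G. \<forall>l\<in>LD g. \<forall>x\<in>V k. l \<bullet> x \<in> V (g \<otimes> k)) \<and>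
     (\<forall>g\<in>carrier G. \<forall>k\<in>carrier G. \<forall>x\<in>V g. \<forall>y\<in>V k. x \<star> y \<in> V (g \<otimes> k) \<and> b x y \<in> LD (g \<otimes> k)) \<and>
     (\<forall>g\<in>carrier G. D g = {a. lin a \<and> (\<forall>k\<in>carrier G. a ` V k \<subseteq> V (g \<otimes> k))})"
proof -
  obtain s where s: "s \<in> carrier G" "s \<otimes> s = \<one>"
    and prod: "\<And>p q x y. p \<in> carrier G \<Longrightarrow> q \<in> carrier G \<Longrightarrow> x \<in> W p \<Longrightarrow> y \<in> W q \<Longrightarrow> x \<star> y \<in> W (p \<otimes> q \<otimes> s)"
    using product_degree by blast
  define V where "V g = W (g \<otimes> s)" for g
  have ss: "g \<otimes> s \<otimes> s = g" if "g \<in> carrier G" for g using s that by (simp add: G.m_assoc)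
  have LDV: "l \<bullet> x \<in> V (g \<otimes> k)" if "g \<in> carrier G" "k \<in> carrier G" "l \<in> LD g" "x \<in> V k" for g k l x
    using W_LD[of g "k \<otimes> s" l x] that s by (simp add: V_def G.m_assoc)
  have "direct_sum (carrier G) UNIV V"
  proof
    fix g x assume g: "g \<in> carrier G" and x: "x \<in> V g"
    have "(- 1) \<bullet> x \<in> V (\<one> \<otimes> g)"
      using LD_diag[of "- 1"] g x by (intro LDV) (auto simp: diag_def triple_one uminus_prod_def)
    then show "- x \<in> V g" using g by (simp add: sc_minus_one)
  next
    fix v
    obtain F w where F: "finite F" "F \<subseteq> carrier G" "\<forall>g\<in>F. w g \<in> W g" "v = sum w F"
      using W_decomp[of v] by blast
    have "v = (\<Sum>g\<in>F. w (g \<otimes> s \<otimes> s))" using F ss by (auto intro!: sum.cong)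
    also have "\<dots> = (\<Sum>g\<in>(\<lambda>g. g \<otimes> s) ` F. w (g \<otimes> s))"
      using F s by (simp only: sum_translate)
    finally show "\<exists>F u. finite F \<and> F \<subseteq> carrier G \<and> (\<forall>g\<in>F. u g \<in> V g) \<and> v = sum u F"
      using F s ss by (intro exI[of _ "(\<lambda>g. g \<otimes> s) ` F"] exI[of _ "\<lambda>g. w (g \<otimes> s)"]) (auto simp: V_def)
  next
    fix F u g assume F: "finite F" "F \<subseteq> carrier G" "\<And>g. g \<in> F \<Longrightarrow> u g \<in> V g" "sum u F = 0" "g \<in> F"
    have "sum u F = (\<Sum>g\<in>F. u (g \<otimes> s \<otimes> s))"
      by (intro sum.cong refl) (use F(2) ss in \<open>auto simp: subset_iff\<close>)
    also have "\<dots> = (\<Sum>g\<in>(\<lambda>g. g \<otimes> s) ` F. u (g \<otimes> s))"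
      using F s by (simp only: sum_translate)
    finally have sum0: "(\<Sum>g\<in>(\<lambda>g. g \<otimes> s) ` F. u (g \<otimes> s)) = 0" using F by simp
    have "u (g \<otimes> s \<otimes> s) = 0"
      by (rule W_indep[OF _ _ _ sum0]) (use F s ss in \<open>auto simp: V_def\<close>)
    then show "u g = 0" using F ss by auto
  qed (use s in \<open>auto simp: V_def W_zero W_add\<close>)
  moreover have "x \<star> y \<in> V (g \<otimes> k) \<and> b x y \<in> LD (g \<otimes> k)"
    if gk: "g \<in> carrier G" "k \<in> carrier G" "x \<in> V g" "y \<in> V k" for g k x y
  proof -
    have eq: "(g \<otimes> s) \<otimes> (k \<otimes> s) = g \<otimes> k"
    proof -
      have "(g \<otimes> s) \<otimes> (k \<otimes> s) = (g \<otimes> k) \<otimes> (s \<otimes> s)" using gk s(1) by (simp add: G.m_ac)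
      then show ?thesis using gk s(2) by simp
    qed
    show ?thesis
      using prod[of "g \<otimes> s" "k \<otimes> s" x y] b_W[of "g \<otimes> s" "k \<otimes> s" x y] gk s(1) by (simp add: V_def eq)
  qed
  moreover have "D g = {a. lin a \<and> (\<forall>k\<in>carrier G. a ` V k \<subseteq> V (g \<otimes> k))}" if g: "g \<in> carrier G" for g
  proof (intro equalityI subsetI CollectI conjI ballI)
    fix a assume a: "a \<in> D g"
    then show "lin a" using D_lin g by blast
    fix k x assume k: "k \<in> carrier G" and x: "x \<in> a ` V k"
    then show "x \<in> V (g \<otimes> k)"
      using D_W[OF g a, of "k \<otimes> s"] s g by (auto simp: V_def G.m_assoc)
  next
    fix a assume "a \<in> {a. lin a \<and> (\<forall>k\<in>carrier G. a ` V k \<subseteq> V (g \<otimes> k))}"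
    then have a: "lin a" "\<And>k. k \<in> carrier G \<Longrightarrow> a ` V k \<subseteq> V (g \<otimes> k)" by blast+
    show "a \<in> D g"
    proof (rule W_D[OF a(1) g])
      fix k x assume k: "k \<in> carrier G" "x \<in> W k"
      then have "a x \<in> V (g \<otimes> (k \<otimes> s))" using a(2)[of "k \<otimes> s"] s ss by (auto simp: V_def)
      then show "a x \<in> W (g \<otimes> k)" using g k s ss by (simp add: V_def flip: G.m_assoc)
    qed
  qed
  ultimately show ?thesis using LDV by (intro exI[of _ V]) blast
qed

end

theorem composition_grading:
  "\<exists>V. direct_sum (carrier G) UNIV V \<and>
     (\<forall>g\<in>carrier G. \<forall>k\<in>carrier G. \<forall>l\<in>LD g. \<forall>x\<in>V k. l \<bullet> x \<in> V (g \<otimes> k)) \<and>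
     (\<forall>g\<in>carrier G. \<forall>k\<in>carrier G. \<forall>x\<in>V g. \<forall>y\<in>V k. x \<star> y \<in> V (g \<otimes> k) \<and> b x y \<in> LD (g \<otimes> k)) \<and>
     (\<forall>g\<in>carrier G. D g = {a. lin a \<and> (\<forall>k\<in>carrier G. a ` V k \<subseteq> V (g \<otimes> k))})"
proof -
  obtain f :: "('v \<Rightarrow> 'v) \<Rightarrow> 'v" where f_add: "\<And>a c. f (a + c) = f a + f c"
    and f_sca: "\<And>l a. f (sca l a) = rho l \<bullet> f a" and f_surj: "\<And>v. \<exists>a. lin a \<and> f a = v"
    and f_ten: "\<And>g k a c. g \<in> carrier G \<Longrightarrow> k \<in> carrier G \<Longrightarrow> a \<in> D g \<Longrightarrow> c \<in> D k \<Longrightarrow> ten (f a) (f c) \<in> D (g \<otimes> k)"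
    using rank_one_map by (elim exE conjE) metis
  have f0: "f 0 = 0" using f_add[of 0 0] by simp
  show ?thesis
  proof (rule shifted_grading[of "\<lambda>g. f ` D g"])
    show "0 \<in> f ` D g" if "g \<in> carrier G" for g using E.D_zero[OF that] f0 by force
    show "x + y \<in> f ` D g" if "g \<in> carrier G" "x \<in> f ` D g" "y \<in> f ` D g" for g x y
    proof -
      obtain a c where ac: "a \<in> D g" "c \<in> D g" "x = f a" "y = f c" using \<open>x \<in> f ` D g\<close> \<open>y \<in> f ` D g\<close> by blast
      then have "f (a + c) \<in> f ` D g" using that(1) by (intro imageI E.D_add)
      then show ?thesis unfolding f_add ac .
    qed
    show "l \<bullet> x \<in> f ` D (g \<otimes> k)" if gk: "g \<in> carrier G" "k \<in> carrier G" "l \<in> LD g" "x \<in> f ` D k" for g k l x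
    proof -
      obtain a where a: "a \<in> D k" "x = f a" using gk by blast
      \<comment> \<open>\<open>f\<close> is \<rho>-semilinear, so multiplication by l in V comes
        from \<rho>^2(l) in E, a scalar of the same degree.\<close>
      have "sca (rho (rho l)) a \<in> D (g \<otimes> k)" using gk a by (intro LD_sca LD_rho) auto
      moreover have "f (sca (rho (rho l)) a) = l \<bullet> x" by (simp add: f_sca a)
      ultimately show ?thesis by force
    qed
    show "\<exists>F w. finite F \<and> F \<subseteq> carrier G \<and> (\<forall>g\<in>F. w g \<in> f ` D g) \<and> v = sum w F" for v
    proof -
      obtain a where a: "lin a" "f a = v" using f_surj by blast
      then have A: "a \<in> Collect lin" by simp
      have "v = f (sum (E.part a) (E.supp a))" by (simp add: E.sum_part_supp[OF A] a)
      also have "\<dots> = (\<Sum>g\<in>E.supp a. f (E.part a g))" by (rule additive_sum[of f]) (rule f_add)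
      finally show ?thesis
        using E.supp_finite[OF A] E.supp_sub[OF A] E.part_in[OF A]
        by (intro exI[of _ "E.supp a"] exI[of _ "\<lambda>g. f (E.part a g)"]) auto
    qed
    show "ten x y \<in> D (g \<otimes> k)" if "g \<in> carrier G" "k \<in> carrier G" "x \<in> f ` D g" "y \<in> f ` D k" for g k x y
      using that f_ten by auto
  qed
qed

end

section \<open>The even Clifford algebra is generated by the image of kappa\<close>

lemma ring_extend:
  assumes "ring R"
  shows "ring (ring.extend R x)"
proof -
  interpret ring R by fact
  show ?thesis
  proof (rule ringI)
    show "abelian_group (ring.extend R x)"
      by (rule abelian_groupI)
        (auto simp: ring.defs a_ac intro: bexI[of _ "\<ominus>\<^bsub>R\<^esub> _"] l_neg)
    show "monoid (ring.extend R x)"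
      by (rule monoidI) (auto simp: ring.defs m_assoc)
  qed (auto simp: ring.defs l_distr r_distr)
qed

lemma alg_quot_simps [simp]:
  "carrier (alg_quot A I) = carrier (A Quot I)" "monoid.mult (alg_quot A I) = monoid.mult (A Quot I)"
  "one (alg_quot A I) = one (A Quot I)" "add (alg_quot A I) = add (A Quot I)"
  "\<zero>\<^bsub>alg_quot A I\<^esub> = \<zero>\<^bsub>A Quot I\<^esub>"
  "l \<odot>\<^bsub>alg_quot A I\<^esub> c = (I +>\<^bsub>A\<^esub> (l \<odot>\<^bsub>A\<^esub> \<one>\<^bsub>A\<^esub>)) \<otimes>\<^bsub>A Quot I\<^esub> c"
  by (simp_all add: alg_quot_def ring.defs)

lemma alg_quot_ring: "ideal I A \<Longrightarrow> ring (alg_quot A I)"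
  unfolding alg_quot_def by (intro ring_extend ideal.quotient_is_ring)

lemma alg_quot_hom: "ideal I A \<Longrightarrow> (+>\<^bsub>A\<^esub>) I \<in> ring_hom A (alg_quot A I)"
  using ideal.rcos_ring_hom[of I A] by (simp add: ring_hom_def)

lemma alg_quot_surj: "carrier (alg_quot A I) = (+>\<^bsub>A\<^esub>) I ` carrier A"
  by (auto simp: FactRing_def A_RCOSETS_def')

lemma alg_quot_smult_one:
  assumes I: "ideal I A" and l: "l \<odot>\<^bsub>A\<^esub> \<one>\<^bsub>A\<^esub> \<in> carrier A"
  shows "l \<odot>\<^bsub>alg_quot A I\<^esub> \<one>\<^bsub>alg_quot A I\<^esub> = I +>\<^bsub>A\<^esub> (l \<odot>\<^bsub>A\<^esub> \<one>\<^bsub>A\<^esub>)"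
proof -
  interpret Q: ring "alg_quot A I" using I by (rule alg_quot_ring)
  have "I +>\<^bsub>A\<^esub> (l \<odot>\<^bsub>A\<^esub> \<one>\<^bsub>A\<^esub>) \<in> carrier (alg_quot A I)" unfolding alg_quot_surj using l by (rule imageI)
  from Q.r_one[OF this] show ?thesis by simp
qed

lemma alg_quot_smult:
  assumes I: "ideal I A" and l: "l \<odot>\<^bsub>A\<^esub> \<one>\<^bsub>A\<^esub> \<in> carrier A"
  shows "l \<odot>\<^bsub>alg_quot A I\<^esub> c = (l \<odot>\<^bsub>alg_quot A I\<^esub> \<one>\<^bsub>alg_quot A I\<^esub>) \<otimes>\<^bsub>alg_quot A I\<^esub> c"
  using alg_quot_smult_one[OF assms] by simp

lemma free_alg_simps [simp]:
  "carrier (free_alg E) = {p. \<forall>w\<in>Poly_Mapping.keys p. set (letters w) \<subseteq> carrier E}"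
  "p \<otimes>\<^bsub>free_alg E\<^esub> q = p * q" "\<one>\<^bsub>free_alg E\<^esub> = 1" "p \<oplus>\<^bsub>free_alg E\<^esub> q = p + q" "\<zero>\<^bsub>free_alg E\<^esub> = 0"
  "l \<odot>\<^bsub>free_alg E\<^esub> p = Poly_Mapping.single 0 l * p"
  by (simp_all add: free_alg_def ring.defs ring_of_type_algebra_def)

lemma free_alg_closed:
  assumes "p \<in> carrier (free_alg E)" "q \<in> carrier (free_alg E)"
  shows "p + q \<in> carrier (free_alg E)" "p * q \<in> carrier (free_alg E)" "- p \<in> carrier (free_alg E)"
proof -
  show "p + q \<in> carrier (free_alg E)" using assms Poly_Mapping.keys_add[of p q] by (auto dest!: subsetD)
  show "p * q \<in> carrier (free_alg E)"
    using assms keys_mult[of p q] by (force simp: plus_word_def)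
  have "Poly_Mapping.keys (- p) = Poly_Mapping.keys p" by (auto simp: in_keys_iff)
  then show "- p \<in> carrier (free_alg E)" using assms by simp
qed

lemma free_alg_ring: "ring (free_alg E)"
proof (rule ringI)
  show "abelian_group (free_alg E)"
  proof (rule abelian_groupI)
    fix p assume p: "p \<in> carrier (free_alg E)"
    show "\<exists>q\<in>carrier (free_alg E). q \<oplus>\<^bsub>free_alg E\<^esub> p = \<zero>\<^bsub>free_alg E\<^esub>"
      using free_alg_closed(3)[OF p p] by (intro bexI[of _ "- p"]) (simp_all del: free_alg_simps(1))
  qed (use free_alg_closed(1) in \<open>auto simp add: algebra_simps simp del: free_alg_simps(1)\<close>,
      simp_all)
  have "1 \<in> carrier (free_alg E)" by (simp add: zero_word_def)
  then show "monoid (free_alg E)"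
    by (intro monoidI) (simp_all add: free_alg_closed mult.assoc del: free_alg_simps(1))
qed (simp_all add: algebra_simps)

lemma letter_closed: "a \<in> carrier E \<Longrightarrow> letter a \<in> carrier (free_alg E)"
  by (simp add: letter_def)

lemma free_alg_smult_one_closed: "l \<odot>\<^bsub>free_alg E\<^esub> \<one>\<^bsub>free_alg E\<^esub> \<in> carrier (free_alg E)"
  by (simp add: zero_word_def)

lemma free_alg_induct:
  fixes E :: "('k::field triple, 'e) module"
  assumes p: "p \<in> carrier (free_alg E)"
    and smult: "\<And>l. P (l \<odot>\<^bsub>free_alg E\<^esub> \<one>\<^bsub>free_alg E\<^esub>)"
    and letter: "\<And>a. a \<in> carrier E \<Longrightarrow> P (letter a)"
    and add: "\<And>p q. p \<in> carrier (free_alg E) \<Longrightarrow> q \<in> carrier (free_alg E) \<Longrightarrow> P p \<Longrightarrow> P q \<Longrightarrow> P (p + q)"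
    and mult: "\<And>p q. p \<in> carrier (free_alg E) \<Longrightarrow> q \<in> carrier (free_alg E) \<Longrightarrow> P p \<Longrightarrow> P q \<Longrightarrow> P (p * q)"
  shows "P p"
proof -
  have words: "Poly_Mapping.single (Word as) 1 \<in> carrier (free_alg E) \<and> P (Poly_Mapping.single (Word as) 1)"
    if "set as \<subseteq> carrier E" for as
    using that
  proof (induction as)
    case Nil
    then show ?case using smult[of 1] by (simp add: zero_word_def)
  next
    case (Cons a as)
    have "Poly_Mapping.single (Word (a # as)) 1 = letter a * (Poly_Mapping.single (Word as) 1 :: _ \<Rightarrow>\<^sub>0 'k triple)"
      by (simp add: letter_def mult_single plus_word_def)
    then show ?case
      using Cons mult[OF letter_closed[of a E]] letter[of a] free_alg_closed(2)[OF letter_closed[of a E]]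
      by (simp del: free_alg_simps(1))
  qed
  have mono: "Poly_Mapping.single w l \<in> carrier (free_alg E) \<and> P (Poly_Mapping.single w l)"
    if "set (letters w) \<subseteq> carrier E" for w and l :: "'k triple"
  proof -
    have "Poly_Mapping.single w l = (l \<odot>\<^bsub>free_alg E\<^esub> \<one>\<^bsub>free_alg E\<^esub>) * Poly_Mapping.single (Word (letters w)) 1"
      by (simp add: mult_single)
    then show ?thesis
      using words[OF that] mult[OF free_alg_smult_one_closed] smult free_alg_closed(2)[OF free_alg_smult_one_closed]
      by (metis (no_types, lifting))
  qed
  have "(\<Sum>w\<in>K. Poly_Mapping.single w (Poly_Mapping.lookup p w)) \<in> carrier (free_alg E)
      \<and> P (\<Sum>w\<in>K. Poly_Mapping.single w (Poly_Mapping.lookup p w))"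
    if "finite K" "K \<subseteq> Poly_Mapping.keys p" for K
    using that
  proof (induction K)
    case empty
    then show ?case using smult[of 0] by simp
  next
    case (insert w K)
    have "set (letters w) \<subseteq> carrier E" using insert.prems p by auto
    note m = mono[OF this, of "Poly_Mapping.lookup p w"]
    note IH = insert.IH[OF order.trans[OF subset_insertI insert.prems]]
    show ?case
      unfolding sum.insert[OF insert.hyps]
      using m IH by (intro conjI free_alg_closed(1) add) simp_all
  qed
  from this[of "Poly_Mapping.keys p"]
  have "P (\<Sum>w\<in>Poly_Mapping.keys p. Poly_Mapping.single w (Poly_Mapping.lookup p w))" by simp
  also have "(\<Sum>w\<in>Poly_Mapping.keys p. Poly_Mapping.single w (Poly_Mapping.lookup p w)) = p"
    by (rule poly_mapping_eqI) (auto simp: lookup_sum lookup_single when_def in_keys_iff)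
  finally show ?thesis .
qed

lemma triple_ring_simps:
  "carrier triple_ring = (UNIV :: 'k triple set)" "x \<oplus>\<^bsub>triple_ring\<^esub> y = x + y"
  "x \<otimes>\<^bsub>triple_ring\<^esub> y = x * y" "\<one>\<^bsub>triple_ring\<^esub> = 1" for x y :: "'k::field triple"
  by (simp_all add: ring_of_type_algebra_def)

lemma module_smult:
  fixes W :: "('k::field triple, 'w) module"
  assumes "Module.module triple_ring W" "x \<in> carrier W"
  shows "l \<odot>\<^bsub>W\<^esub> x \<in> carrier W" "y \<in> carrier W \<Longrightarrow> l \<odot>\<^bsub>W\<^esub> (x \<oplus>\<^bsub>W\<^esub> y) = l \<odot>\<^bsub>W\<^esub> x \<oplus>\<^bsub>W\<^esub> l \<odot>\<^bsub>W\<^esub> y"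
    "(l + m) \<odot>\<^bsub>W\<^esub> x = l \<odot>\<^bsub>W\<^esub> x \<oplus>\<^bsub>W\<^esub> m \<odot>\<^bsub>W\<^esub> x" "(l * m) \<odot>\<^bsub>W\<^esub> x = l \<odot>\<^bsub>W\<^esub> (m \<odot>\<^bsub>W\<^esub> x)" "1 \<odot>\<^bsub>W\<^esub> x = x"
  using module.smult_closed[OF assms(1) _ assms(2), of l] module.smult_r_distr[OF assms(1) _ assms(2), of l]
    module.smult_l_distr[OF assms(1) _ _ assms(2), of l m] module.smult_assoc1[OF assms(1) _ _ assms(2), of l m]
    module.smult_one[OF assms]
  by (simp_all add: triple_ring_simps)

lemma rank_one_closed:
  fixes W :: "('k::field triple, 'w) module"
  assumes "Module.module triple_ring W" "quadratic_form W q" "x \<in> carrier W" "y \<in> carrier W"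
  shows "rank_one W q x y \<in> carrier (End_alg W)"
proof -
  note sm = module_smult[OF assms(1)]
  interpret W: abelian_group W using assms(1) by (rule module.axioms)
  have sym: "polar W q u v = polar W q v u" if "u \<in> carrier W" "v \<in> carrier W" for u v
    using that by (simp add: polar_def W.a_comm)
  note q = assms(2)[unfolded quadratic_form_def]
  have add: "polar W q y (u \<oplus>\<^bsub>W\<^esub> v) = polar W q y u + polar W q y v" if uv: "u \<in> carrier W" "v \<in> carrier W" for u v
    using q[THEN conjunct2, THEN conjunct1, rule_format, OF uv assms(4)]
    by (simp only: sym[OF _ assms(4)] uv W.a_closed)
  have mul: "polar W q y (l \<odot>\<^bsub>W\<^esub> u) = l * polar W q y u" if u: "u \<in> carrier W" for l u
    using q[THEN conjunct2, THEN conjunct2, rule_format, OF u assms(4), of l]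
    by (simp only: sym[OF _ assms(4)] u sm(1))
  show ?thesis
    unfolding End_alg_def rank_one_def using assms(3)
    by (simp add: add mul sm)
qed

text \<open>Closure of E keeps the linearity relations inside the free algebra on E. The locale
  serves the given algebra as well as \<open>End_alg V\<close>.\<close>

locale closed_module =
  fixes E :: "('k::field triple, 'e) module" and s :: "'e \<Rightarrow> 'e"
  assumes add_closed: "a \<in> carrier E \<Longrightarrow> c \<in> carrier E \<Longrightarrow> a \<oplus>\<^bsub>E\<^esub> c \<in> carrier E"
    and smult_closed: "a \<in> carrier E \<Longrightarrow> l \<odot>\<^bsub>E\<^esub> a \<in> carrier E"
begin

lemma linear_ideal: "ideal (linear_ideal E) (free_alg E)"
  and linear_ideal_add: "a \<in> carrier E \<Longrightarrow> c \<in> carrier E \<Longrightarrow> letter (a \<oplus>\<^bsub>E\<^esub> c) - letter a - letter c \<in> linear_ideal E"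
proof -
  interpret ring "free_alg E" by (rule free_alg_ring)
  let ?S = "{letter (a \<oplus>\<^bsub>E\<^esub> b) - letter a - letter b | a b. a \<in> carrier E \<and> b \<in> carrier E} \<union>
      {letter (l \<odot>\<^bsub>E\<^esub> a) - l \<odot>\<^bsub>free_alg E\<^esub> letter a | l a. a \<in> carrier E}"
  have diff: "p - q \<in> carrier (free_alg E)" if "p \<in> carrier (free_alg E)" "q \<in> carrier (free_alg E)" for p q
    using free_alg_closed(1)[OF that(1) free_alg_closed(3)[OF that(2,2)]] by simp
  have smult: "l \<odot>\<^bsub>free_alg E\<^esub> p \<in> carrier (free_alg E)" if "p \<in> carrier (free_alg E)" for l p
    using free_alg_closed(2)[OF free_alg_smult_one_closed that, of l] by simp
  have S: "?S \<subseteq> carrier (free_alg E)"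
    by (rule subsetI, elim UnE CollectE exE conjE; simp only:; intro diff smult letter_closed add_closed smult_closed; assumption)
  show "ideal (linear_ideal E) (free_alg E)" unfolding linear_ideal_def by (rule genideal_ideal[OF S])
  show "letter (a \<oplus>\<^bsub>E\<^esub> c) - letter a - letter c \<in> linear_ideal E" if "a \<in> carrier E" "c \<in> carrier E"
    unfolding linear_ideal_def using genideal_self[OF S] that by blast
qed

lemma tensor_ring: "ring (tensor_alg E)"
  unfolding tensor_alg_def by (rule alg_quot_ring[OF linear_ideal])

abbreviation \<pi>\<^sub>1 where "\<pi>\<^sub>1 \<equiv> (+>\<^bsub>free_alg E\<^esub>) (linear_ideal E)"

lemma \<pi>1_hom: "\<pi>\<^sub>1 \<in> ring_hom (free_alg E) (tensor_alg E)"
  unfolding tensor_alg_def by (rule alg_quot_hom[OF linear_ideal])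

lemma \<pi>1_surj: "carrier (tensor_alg E) = \<pi>\<^sub>1 ` carrier (free_alg E)"
  unfolding tensor_alg_def by (rule alg_quot_surj)

lemma \<pi>1_smult_one: "l \<odot>\<^bsub>tensor_alg E\<^esub> \<one>\<^bsub>tensor_alg E\<^esub> = \<pi>\<^sub>1 (l \<odot>\<^bsub>free_alg E\<^esub> \<one>\<^bsub>free_alg E\<^esub>)"
  unfolding tensor_alg_def by (rule alg_quot_smult_one[OF linear_ideal free_alg_smult_one_closed])

lemma tensor_incl_closed: "a \<in> carrier E \<Longrightarrow> tensor_incl E a \<in> carrier (tensor_alg E)"
  unfolding tensor_incl_def \<pi>1_surj by (rule imageI) (rule letter_closed)

lemma tensor_smult_one_closed: "l \<odot>\<^bsub>tensor_alg E\<^esub> \<one>\<^bsub>tensor_alg E\<^esub> \<in> carrier (tensor_alg E)"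
  unfolding \<pi>1_smult_one \<pi>1_surj by (rule imageI) (rule free_alg_smult_one_closed)

lemma tensor_incl_add:
  assumes a: "a \<in> carrier E" and c: "c \<in> carrier E"
  shows "tensor_incl E (a \<oplus>\<^bsub>E\<^esub> c) = tensor_incl E a \<oplus>\<^bsub>tensor_alg E\<^esub> tensor_incl E c"
proof -
  interpret T: ring "tensor_alg E" by (rule tensor_ring)
  let ?d = "letter (a \<oplus>\<^bsub>E\<^esub> c) - letter a - letter c :: 'e word \<Rightarrow>\<^sub>0 'k triple"
  have d: "?d \<in> linear_ideal E" using a c by (rule linear_ideal_add)
  have sub: "abelian_subgroup (linear_ideal E) (free_alg E)"
    using linear_ideal by (intro abelian_subgroupI3 ring.is_abelian_group free_alg_ring ideal.axioms)
  have d': "?d \<in> carrier (free_alg E)" using d ideal.Icarr[OF linear_ideal] by blast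
  have la: "letter a \<in> carrier (free_alg E)" "letter c \<in> carrier (free_alg E)" using a c by (auto intro: letter_closed simp del: free_alg_simps)
  have "\<pi>\<^sub>1 ?d = linear_ideal E" using abelian_subgroup.a_rcos_const[OF sub d] .
  then have d0: "\<pi>\<^sub>1 ?d = \<zero>\<^bsub>tensor_alg E\<^esub>" by (simp add: tensor_alg_def FactRing_def)
  have sum: "letter a \<oplus>\<^bsub>free_alg E\<^esub> letter c \<in> carrier (free_alg E)"
    using free_alg_closed(1)[OF la] by (simp only: free_alg_simps(4))
  have "letter (a \<oplus>\<^bsub>E\<^esub> c) = ?d \<oplus>\<^bsub>free_alg E\<^esub> (letter a \<oplus>\<^bsub>free_alg E\<^esub> letter c)"
    by simp
  then have "\<pi>\<^sub>1 (letter (a \<oplus>\<^bsub>E\<^esub> c)) = \<pi>\<^sub>1 (?d \<oplus>\<^bsub>free_alg E\<^esub> (letter a \<oplus>\<^bsub>free_alg E\<^esub> letter c))"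
    by (rule arg_cong)
  also have "\<dots> = \<pi>\<^sub>1 ?d \<oplus>\<^bsub>tensor_alg E\<^esub> (\<pi>\<^sub>1 (letter a) \<oplus>\<^bsub>tensor_alg E\<^esub> \<pi>\<^sub>1 (letter c))"
    unfolding ring_hom_add[OF \<pi>1_hom d' sum] ring_hom_add[OF \<pi>1_hom la] ..
  also have "\<dots> = tensor_incl E a \<oplus>\<^bsub>tensor_alg E\<^esub> tensor_incl E c"
    using tensor_incl_closed[OF a] tensor_incl_closed[OF c] unfolding d0 tensor_incl_def by simp
  finally show ?thesis unfolding tensor_incl_def .
qed

lemma clifford_ideal: "ideal (clifford_ideal E s) (tensor_alg E)"
  unfolding clifford_ideal_def
proof (rule ring.genideal_ideal[OF tensor_ring], safe)
  fix W :: "('k triple, nat \<Rightarrow> 'k triple) module" and q t c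
  assume pres: "is_presentation E s W q t" and c: "c \<in> clifford_relations E W q t"
  interpret T: ring "tensor_alg E" by (rule tensor_ring)
  have W: "Module.module triple_ring W" "quadratic_form W q" "bij_betw t (carrier E) (carrier (End_alg W))"
    using pres by (auto simp: is_presentation_def alg_iso_def ring_iso_def)
  define ee where "ee x y = tensor_incl E (inv_into (carrier E) t (rank_one W q x y))" for x y
  have e: "ee x y \<in> carrier (tensor_alg E)" if "x \<in> carrier W" "y \<in> carrier W" for x y
    unfolding ee_def using that rank_one_closed[OF W(1,2)] W(3)
    by (intro tensor_incl_closed inv_into_into) (auto simp: bij_betw_def)
  have sm: "l \<odot>\<^bsub>tensor_alg E\<^esub> x \<in> carrier (tensor_alg E)" if "x \<in> carrier (tensor_alg E)" for l x
    using T.m_closed[OF tensor_smult_one_closed that, of l]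
      alg_quot_smult[OF linear_ideal free_alg_smult_one_closed, of l x] by (simp add: tensor_alg_def)
  show "c \<in> carrier (tensor_alg E)"
    using c unfolding clifford_relations_def Let_def ee_def[symmetric]
    by (elim UnE CollectE exE conjE)
      (simp_all only:, (intro T.minus_closed T.m_closed e sm T.one_closed; assumption)+)
qed

lemma clifford_ring: "ring (clifford E s)"
  unfolding clifford_def by (rule alg_quot_ring[OF clifford_ideal])

abbreviation \<pi>\<^sub>2 where "\<pi>\<^sub>2 \<equiv> (+>\<^bsub>tensor_alg E\<^esub>) (clifford_ideal E s)"

lemma \<pi>2_hom: "\<pi>\<^sub>2 \<in> ring_hom (tensor_alg E) (clifford E s)"
  unfolding clifford_def by (rule alg_quot_hom[OF clifford_ideal])

lemma clifford_smult_one: "l \<odot>\<^bsub>clifford E s\<^esub> \<one>\<^bsub>clifford E s\<^esub> = \<pi>\<^sub>2 (\<pi>\<^sub>1 (l \<odot>\<^bsub>free_alg E\<^esub> \<one>\<^bsub>free_alg E\<^esub>))"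
  unfolding \<pi>1_smult_one[symmetric] clifford_def
  by (rule alg_quot_smult_one[OF clifford_ideal tensor_smult_one_closed])

lemma clifford_smult_one_closed: "l \<odot>\<^bsub>clifford E s\<^esub> \<one>\<^bsub>clifford E s\<^esub> \<in> carrier (clifford E s)"
  unfolding clifford_smult_one using ring_hom_closed[OF \<pi>2_hom] ring_hom_closed[OF \<pi>1_hom] free_alg_smult_one_closed
  by blast

lemma clifford_smult: "l \<odot>\<^bsub>clifford E s\<^esub> c = (l \<odot>\<^bsub>clifford E s\<^esub> \<one>\<^bsub>clifford E s\<^esub>) \<otimes>\<^bsub>clifford E s\<^esub> c"
  unfolding clifford_def by (rule alg_quot_smult[OF clifford_ideal tensor_smult_one_closed])

lemma kappa_closed: "a \<in> carrier E \<Longrightarrow> kappa E s a \<in> carrier (clifford E s)"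
  unfolding kappa_def using ring_hom_closed[OF \<pi>2_hom] tensor_incl_closed by blast

lemma kappa_add:
  "a \<in> carrier E \<Longrightarrow> c \<in> carrier E \<Longrightarrow> kappa E s (a \<oplus>\<^bsub>E\<^esub> c) = kappa E s a \<oplus>\<^bsub>clifford E s\<^esub> kappa E s c"
  unfolding kappa_def tensor_incl_add using ring_hom_add[OF \<pi>2_hom] tensor_incl_closed by blast

text \<open>Every element is the image of a polynomial in letters under the two quotient maps, and
  letters go to values of \<open>kappa\<close>: generation by the image of \<open>kappa\<close>, as
  an induction rule.\<close>

lemma clifford_induct:
  assumes z: "z \<in> carrier (clifford E s)"
    and smult: "\<And>l. P (l \<odot>\<^bsub>clifford E s\<^esub> \<one>\<^bsub>clifford E s\<^esub>)"
    and kappa: "\<And>a. a \<in> carrier E \<Longrightarrow> P (kappa E s a)"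
    and add: "\<And>x y. x \<in> carrier (clifford E s) \<Longrightarrow> y \<in> carrier (clifford E s) \<Longrightarrow> P x \<Longrightarrow> P y
      \<Longrightarrow> P (x \<oplus>\<^bsub>clifford E s\<^esub> y)"
    and mult: "\<And>x y. x \<in> carrier (clifford E s) \<Longrightarrow> y \<in> carrier (clifford E s) \<Longrightarrow> P x \<Longrightarrow> P y
      \<Longrightarrow> P (x \<otimes>\<^bsub>clifford E s\<^esub> y)"
  shows "P z"
proof -
  have "carrier (clifford E s) = \<pi>\<^sub>2 ` carrier (tensor_alg E)" unfolding clifford_def by (rule alg_quot_surj)
  then obtain p where p: "p \<in> carrier (free_alg E)" "z = \<pi>\<^sub>2 (\<pi>\<^sub>1 p)" using z \<pi>1_surj by auto
  have cl: "\<pi>\<^sub>2 (\<pi>\<^sub>1 p) \<in> carrier (clifford E s)" if "p \<in> carrier (free_alg E)" for p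
    using ring_hom_closed[OF \<pi>2_hom ring_hom_closed[OF \<pi>1_hom that]] .
  have "P (\<pi>\<^sub>2 (\<pi>\<^sub>1 p))"
    using p(1)
  proof (rule free_alg_induct)
    fix l show "P (\<pi>\<^sub>2 (\<pi>\<^sub>1 (l \<odot>\<^bsub>free_alg E\<^esub> \<one>\<^bsub>free_alg E\<^esub>)))"
      using smult[of l] unfolding clifford_smult_one .
  next
    fix a assume "a \<in> carrier E"
    then have "P (kappa E s a)" by (rule kappa)
    then show "P (\<pi>\<^sub>2 (\<pi>\<^sub>1 (letter a)))" unfolding kappa_def tensor_incl_def .
  next
    fix p q assume pq: "p \<in> carrier (free_alg E)" "q \<in> carrier (free_alg E)"
      and P: "P (\<pi>\<^sub>2 (\<pi>\<^sub>1 p))" "P (\<pi>\<^sub>2 (\<pi>\<^sub>1 q))"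
    have "\<pi>\<^sub>2 (\<pi>\<^sub>1 (p + q)) = \<pi>\<^sub>2 (\<pi>\<^sub>1 p) \<oplus>\<^bsub>clifford E s\<^esub> \<pi>\<^sub>2 (\<pi>\<^sub>1 q)"
      using ring_hom_add[OF \<pi>1_hom pq] ring_hom_add[OF \<pi>2_hom] ring_hom_closed[OF \<pi>1_hom] pq
      by (simp del: free_alg_simps(1))
    then show "P (\<pi>\<^sub>2 (\<pi>\<^sub>1 (p + q)))" using add[OF cl[OF pq(1)] cl[OF pq(2)] P] by simp
    have "\<pi>\<^sub>2 (\<pi>\<^sub>1 (p * q)) = \<pi>\<^sub>2 (\<pi>\<^sub>1 p) \<otimes>\<^bsub>clifford E s\<^esub> \<pi>\<^sub>2 (\<pi>\<^sub>1 q)"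
      using ring_hom_mult[OF \<pi>1_hom pq] ring_hom_mult[OF \<pi>2_hom] ring_hom_closed[OF \<pi>1_hom] pq
      by (simp del: free_alg_simps(1))
    then show "P (\<pi>\<^sub>2 (\<pi>\<^sub>1 (p * q)))" using mult[OF cl[OF pq(1)] cl[OF pq(2)] P] by simp
  qed
  then show ?thesis using p by simp
qed

end

section \<open>Gradings of record algebras\<close>

lemma finsum_hom:
  assumes A: "abelian_group A" and B: "abelian_group B"
    and f: "\<And>x. x \<in> carrier A \<Longrightarrow> f x \<in> carrier B"
    "\<And>x y. x \<in> carrier A \<Longrightarrow> y \<in> carrier A \<Longrightarrow> f (x \<oplus>\<^bsub>A\<^esub> y) = f x \<oplus>\<^bsub>B\<^esub> f y"
    and u: "\<And>i. i \<in> F \<Longrightarrow> u i \<in> carrier A" "finite F"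
  shows "f (finsum A u F) = finsum B (\<lambda>i. f (u i)) F"
proof -
  interpret A: abelian_group A by (rule A)
  interpret B: abelian_group B by (rule B)
  have f0: "f \<zero>\<^bsub>A\<^esub> = \<zero>\<^bsub>B\<^esub>"
  proof -
    have "f \<zero>\<^bsub>A\<^esub> \<oplus>\<^bsub>B\<^esub> f \<zero>\<^bsub>A\<^esub> = f \<zero>\<^bsub>A\<^esub>" using f(2)[of "\<zero>\<^bsub>A\<^esub>" "\<zero>\<^bsub>A\<^esub>"] by simp
    then show ?thesis using f(1)[of "\<zero>\<^bsub>A\<^esub>"] B.add.r_cancel_one by simp
  qed
  show ?thesis
    using u(2,1)
  proof (induction F)
    case (insert i F)
    then have "u \<in> F \<rightarrow> carrier A" "u i \<in> carrier A" "(\<lambda>i. f (u i)) \<in> F \<rightarrow> carrier B" "f (u i) \<in> carrier B"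
      using f(1) by auto
    then show ?case using insert by (simp add: f(2))
  qed (simp add: f0)
qed

lemma finsum_to_class:
  fixes f :: "'a \<Rightarrow> 'b::ab_group_add"
  assumes A: "abelian_group A"
    and f: "\<And>x y. x \<in> carrier A \<Longrightarrow> y \<in> carrier A \<Longrightarrow> f (x \<oplus>\<^bsub>A\<^esub> y) = f x + f y"
    and u: "\<And>i. i \<in> F \<Longrightarrow> u i \<in> carrier A" "finite F"
  shows "f (finsum A u F) = (\<Sum>i\<in>F. f (u i))"
proof -
  interpret A: abelian_group A by (rule A)
  have f0: "f \<zero>\<^bsub>A\<^esub> = 0" using f[of "\<zero>\<^bsub>A\<^esub>" "\<zero>\<^bsub>A\<^esub>"] by simp
  show ?thesis
    using u(2,1)
  proof (induction F)
    case (insert i F)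
    then have "u \<in> F \<rightarrow> carrier A" "u i \<in> carrier A" by auto
    then show ?case using insert by (simp add: f)
  qed (simp add: f0)
qed

text \<open>Extensionality fixes the family outside the group; without it a decomposition could not
  be unique in general.\<close>

definition decomposition :: "('g, 'm) monoid_scheme \<Rightarrow> ('k::field triple, 'a) module \<Rightarrow> ('g \<Rightarrow> 'a set) \<Rightarrow> 'a \<Rightarrow> ('g \<Rightarrow> 'a) \<Rightarrow> bool" where
  "decomposition G A D x u \<longleftrightarrow> u \<in> (\<Pi>\<^sub>E g\<in>carrier G. D g) \<and> finite {g \<in> carrier G. u g \<noteq> \<zero>\<^bsub>A\<^esub>} \<and>
     x = (\<Oplus>\<^bsub>A\<^esub>g\<in>{g \<in> carrier G. u g \<noteq> \<zero>\<^bsub>A\<^esub>}. u g)"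

lemma alg_grading_alt:
  "alg_grading G A D \<longleftrightarrow>
     (\<forall>g\<in>carrier G. D g \<subseteq> carrier A \<and> \<zero>\<^bsub>A\<^esub> \<in> D g \<and>
        (\<forall>x\<in>D g. \<forall>y\<in>D g. x \<oplus>\<^bsub>A\<^esub> y \<in> D g) \<and> (\<forall>c. \<forall>x\<in>D g. diag c \<odot>\<^bsub>A\<^esub> x \<in> D g)) \<and>
     (\<forall>x\<in>carrier A. \<exists>!u. decomposition G A D x u) \<and>
     (\<forall>g\<in>carrier G. \<forall>h\<in>carrier G. \<forall>x\<in>D g. \<forall>y\<in>D h. x \<otimes>\<^bsub>A\<^esub> y \<in> D (g \<otimes>\<^bsub>G\<^esub> h))"
  unfolding alg_grading_def decomposition_def ..

lemma decompositionI:
  assumes A: "abelian_group A" and D: "\<And>g. g \<in> carrier G \<Longrightarrow> D g \<subseteq> carrier A \<and> \<zero>\<^bsub>A\<^esub> \<in> D g"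
    and F: "finite F" "F \<subseteq> carrier G" "\<And>g. g \<in> F \<Longrightarrow> u g \<in> D g" "x = finsum A u F"
  shows "decomposition G A D x (\<lambda>g\<in>carrier G. if g \<in> F then u g else \<zero>\<^bsub>A\<^esub>)"
proof -
  interpret A: abelian_group A by (rule A)
  define v where "v = (\<lambda>g\<in>carrier G. if g \<in> F then u g else \<zero>\<^bsub>A\<^esub>)"
  have vF: "v g = u g" if "g \<in> F" for g using that F(2) by (auto simp: v_def)
  have v0: "v g = \<zero>\<^bsub>A\<^esub>" if "g \<in> carrier G" "g \<notin> F" for g using that by (simp add: v_def)
  define S where "S = {g \<in> carrier G. v g \<noteq> \<zero>\<^bsub>A\<^esub>}"
  have S: "S \<subseteq> F" using v0 by (auto simp: S_def)
  have uA: "u g \<in> carrier A" if "g \<in> F" for g using F D that by blast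
  have "finsum A u F = finsum A v S"
    by (rule A.add.finprod_mono_neutral_cong_right) (use F S uA vF in \<open>auto simp: S_def\<close>)
  moreover have "v \<in> (\<Pi>\<^sub>E g\<in>carrier G. D g)" using F D by (auto simp: v_def)
  ultimately show ?thesis
    unfolding v_def[symmetric] decomposition_def S_def[symmetric]
    using F(4) finite_subset[OF S F(1)] by simp
qed

lemma alg_grading_decomp:
  assumes gr: "alg_grading G A D" and x: "x \<in> carrier A"
  shows "\<exists>F u. finite F \<and> F \<subseteq> carrier G \<and> (\<forall>g\<in>F. u g \<in> D g) \<and> x = finsum A u F"
proof -
  obtain u where "decomposition G A D x u" using gr x unfolding alg_grading_alt by blast
  then show ?thesis unfolding decomposition_def
    by (intro exI[of _ "{g \<in> carrier G. u g \<noteq> \<zero>\<^bsub>A\<^esub>}"] exI[of _ u]) auto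
qed

text \<open>The given family, padded by zeros, and the empty family both decompose 0, so they
  agree.\<close>

lemma alg_grading_indep:
  assumes A: "abelian_group A" and gr: "alg_grading G A D"
    and F: "finite F" "F \<subseteq> carrier G" "\<And>g. g \<in> F \<Longrightarrow> u g \<in> D g" "finsum A u F = \<zero>\<^bsub>A\<^esub>" and g: "g \<in> F"
  shows "u g = \<zero>\<^bsub>A\<^esub>"
proof -
  interpret A: abelian_group A by (rule A)
  have D: "\<And>g. g \<in> carrier G \<Longrightarrow> D g \<subseteq> carrier A \<and> \<zero>\<^bsub>A\<^esub> \<in> D g"
    using gr unfolding alg_grading_alt by blast
  have 1: "decomposition G A D \<zero>\<^bsub>A\<^esub> (\<lambda>g\<in>carrier G. if g \<in> F then u g else \<zero>\<^bsub>A\<^esub>)"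
    by (rule decompositionI[OF A D F(1-3)]) (simp_all add: F(4))
  have 2: "decomposition G A D \<zero>\<^bsub>A\<^esub> (\<lambda>g\<in>carrier G. if g \<in> {} then u g else \<zero>\<^bsub>A\<^esub>)"
    by (rule decompositionI[OF A D]) auto
  have "\<exists>!v. decomposition G A D \<zero>\<^bsub>A\<^esub> v" using gr unfolding alg_grading_alt by blast
  then obtain w where w: "\<And>v. decomposition G A D \<zero>\<^bsub>A\<^esub> v \<Longrightarrow> v = w" by (elim ex1E) blast
  note trans[OF w[OF 1] w[OF 2, symmetric]]
  from fun_cong[OF this, of g] show ?thesis using g F(2) by auto
qed

lemma alg_gradingI:
  assumes A: "abelian_group A"
    and D: "\<And>g. g \<in> carrier G \<Longrightarrow> D g \<subseteq> carrier A" "\<And>g. g \<in> carrier G \<Longrightarrow> \<zero>\<^bsub>A\<^esub> \<in> D g"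
    "\<And>g x y. g \<in> carrier G \<Longrightarrow> x \<in> D g \<Longrightarrow> y \<in> D g \<Longrightarrow> x \<oplus>\<^bsub>A\<^esub> y \<in> D g"
    "\<And>g x. g \<in> carrier G \<Longrightarrow> x \<in> D g \<Longrightarrow> \<ominus>\<^bsub>A\<^esub> x \<in> D g"
    "\<And>g c x. g \<in> carrier G \<Longrightarrow> x \<in> D g \<Longrightarrow> diag c \<odot>\<^bsub>A\<^esub> x \<in> D g"
    and decomp: "\<And>x. x \<in> carrier A \<Longrightarrow> \<exists>F u. finite F \<and> F \<subseteq> carrier G \<and> (\<forall>g\<in>F. u g \<in> D g) \<and> x = finsum A u F"
    and indep: "\<And>F u g. finite F \<Longrightarrow> F \<subseteq> carrier G \<Longrightarrow> (\<And>g. g \<in> F \<Longrightarrow> u g \<in> D g) \<Longrightarrow> finsum A u F = \<zero>\<^bsub>A\<^esub>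
      \<Longrightarrow> g \<in> F \<Longrightarrow> u g = \<zero>\<^bsub>A\<^esub>"
    and mult: "\<And>g h x y. g \<in> carrier G \<Longrightarrow> h \<in> carrier G \<Longrightarrow> x \<in> D g \<Longrightarrow> y \<in> D h \<Longrightarrow> x \<otimes>\<^bsub>A\<^esub> y \<in> D (g \<otimes>\<^bsub>G\<^esub> h)"
  shows "alg_grading G A D"
proof -
  interpret A: abelian_group A by (rule A)
  have "\<exists>!u. decomposition G A D x u" if x: "x \<in> carrier A" for x
  proof (rule ex_ex1I)
    obtain F u where F: "finite F" "F \<subseteq> carrier G" "\<forall>g\<in>F. u g \<in> D g" "x = finsum A u F"
      using decomp[OF x] by blast
    show "\<exists>u. decomposition G A D x u"
      using decompositionI[OF A _ F(1,2) _ F(4)] D(1,2) F(3) by blast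
  next
    fix u v assume u: "decomposition G A D x u" and v: "decomposition G A D x v"
    define F where "F = {g \<in> carrier G. u g \<noteq> \<zero>\<^bsub>A\<^esub>} \<union> {g \<in> carrier G. v g \<noteq> \<zero>\<^bsub>A\<^esub>}"
    have F: "finite F" "F \<subseteq> carrier G" using u v by (auto simp: F_def decomposition_def)
    have uD: "u g \<in> D g" "v g \<in> D g" if "g \<in> carrier G" for g
      using u v that by (auto simp: decomposition_def)
    then have uA: "u g \<in> carrier A" "v g \<in> carrier A" if "g \<in> carrier G" for g
      using that D(1) by blast+
    have "x = finsum A u F" "x = finsum A v F"
    proof -
      have "finsum A u {g \<in> carrier G. u g \<noteq> \<zero>\<^bsub>A\<^esub>} = finsum A u F"
        using F uA by (intro A.add.finprod_mono_neutral_cong_left) (auto simp: F_def)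
      then show "x = finsum A u F" using u by (simp add: decomposition_def)
      have "finsum A v {g \<in> carrier G. v g \<noteq> \<zero>\<^bsub>A\<^esub>} = finsum A v F"
        using F uA by (intro A.add.finprod_mono_neutral_cong_left) (auto simp: F_def)
      then show "x = finsum A v F" using v by (simp add: decomposition_def)
    qed
    moreover have "finsum A (\<lambda>g. u g \<oplus>\<^bsub>A\<^esub> \<ominus>\<^bsub>A\<^esub> v g) F = finsum A u F \<oplus>\<^bsub>A\<^esub> finsum A (\<lambda>g. \<ominus>\<^bsub>A\<^esub> v g) F"
      using F uA by (intro A.finsum_addf) auto
    moreover have "finsum A (\<lambda>g. \<ominus>\<^bsub>A\<^esub> v g) F = \<ominus>\<^bsub>A\<^esub> finsum A v F"
      using F uA by (intro finsum_hom[OF A A, of "\<lambda>x. \<ominus>\<^bsub>A\<^esub> x", symmetric]) (auto simp: A.minus_add)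
    ultimately have sum: "finsum A (\<lambda>g. u g \<oplus>\<^bsub>A\<^esub> \<ominus>\<^bsub>A\<^esub> v g) F = \<zero>\<^bsub>A\<^esub>"
      using x by (simp add: A.r_neg)
    have "u g = v g" if g: "g \<in> carrier G" for g
    proof (cases "g \<in> F")
      case True
      have "u g \<oplus>\<^bsub>A\<^esub> \<ominus>\<^bsub>A\<^esub> v g = \<zero>\<^bsub>A\<^esub>"
        by (rule indep[OF F _ sum True]) (use uD F D(3,4) in blast)
      then have "\<ominus>\<^bsub>A\<^esub> (\<ominus>\<^bsub>A\<^esub> v g) = u g" using uA[OF g] by (intro A.minus_equality) auto
      then show ?thesis using uA[OF g] by simp
    next
      case False
      then show ?thesis using g by (auto simp: F_def)
    qed
    moreover have "u \<in> extensional (carrier G)" "v \<in> extensional (carrier G)"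
      using u v by (auto simp: decomposition_def PiE_def)
    ultimately show "u = v" by (intro extensionalityI) auto
  qed
  then show ?thesis unfolding alg_grading_alt
    by (intro conjI ballI allI) (simp_all add: D mult)
qed

text \<open>Linearity is asked over F and not over L, because an isomorphism of trialitarian
  algebras and the Clifford map it induces may act nontrivially on L.\<close>

lemma alg_grading_iso:
  assumes A: "abelian_group A" and B: "abelian_group B" and gr: "alg_grading G A D"
    and f: "bij_betw f (carrier A) (carrier B)"
    "\<And>x y. x \<in> carrier A \<Longrightarrow> y \<in> carrier A \<Longrightarrow> f (x \<oplus>\<^bsub>A\<^esub> y) = f x \<oplus>\<^bsub>B\<^esub> f y"
    "\<And>x y. x \<in> carrier A \<Longrightarrow> y \<in> carrier A \<Longrightarrow> f (x \<otimes>\<^bsub>A\<^esub> y) = f x \<otimes>\<^bsub>B\<^esub> f y"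
    "\<And>c x. x \<in> carrier A \<Longrightarrow> f (diag c \<odot>\<^bsub>A\<^esub> x) = diag c \<odot>\<^bsub>B\<^esub> f x"
  shows "alg_grading G B (\<lambda>g. f ` D g)"
proof -
  interpret A: abelian_group A by (rule A)
  interpret B: abelian_group B by (rule B)
  note fA = bij_betwE[OF f(1)]
  have inj: "f x = f y \<longleftrightarrow> x = y" if "x \<in> carrier A" "y \<in> carrier A" for x y
    using f(1) that by (auto simp: bij_betw_def inj_on_def)
  have D: "D g \<subseteq> carrier A" "\<zero>\<^bsub>A\<^esub> \<in> D g" "\<And>x y. x \<in> D g \<Longrightarrow> y \<in> D g \<Longrightarrow> x \<oplus>\<^bsub>A\<^esub> y \<in> D g"
    "\<And>c x. x \<in> D g \<Longrightarrow> diag c \<odot>\<^bsub>A\<^esub> x \<in> D g" if "g \<in> carrier G" for g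
    using gr that unfolding alg_grading_alt by blast+
  have DA: "x \<in> carrier A" if "g \<in> carrier G" "x \<in> D g" for g x using D(1) that by blast
  have f0: "f \<zero>\<^bsub>A\<^esub> = \<zero>\<^bsub>B\<^esub>"
    using finsum_hom[OF A B _ f(2), of "{}" "\<lambda>_. \<zero>\<^bsub>A\<^esub>"] fA by simp
  have ex1: "\<exists>!u. decomposition G B (\<lambda>g. f ` D g) y u" if y: "y \<in> carrier B" for y
  proof -
    obtain x where x: "x \<in> carrier A" "y = f x" using y f(1) by (auto simp: bij_betw_def)
    then obtain u where u: "decomposition G A D x u" and uniq: "\<And>v. decomposition G A D x v \<Longrightarrow> v = u"
      using gr unfolding alg_grading_alt by blast
    have uA: "u g \<in> carrier A" if "g \<in> carrier G" for g
      using u that DA by (auto simp: decomposition_def)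
    have transfer: "decomposition G A D x w \<longleftrightarrow> decomposition G B (\<lambda>g. f ` D g) y (\<lambda>g\<in>carrier G. f (w g))"
      if w: "\<And>g. g \<in> carrier G \<Longrightarrow> w g \<in> carrier A" "w \<in> extensional (carrier G)" for w
    proof -
      let ?S = "{g \<in> carrier G. w g \<noteq> \<zero>\<^bsub>A\<^esub>}"
      have S: "{g \<in> carrier G. (\<lambda>g\<in>carrier G. f (w g)) g \<noteq> \<zero>\<^bsub>B\<^esub>} = ?S"
        using inj[OF w(1) A.zero_closed] f0 by auto
      have mem: "w g \<in> D g \<longleftrightarrow> f (w g) \<in> f ` D g" if "g \<in> carrier G" for g
        using inj[OF w(1)] DA that by blast
      have pi: "w \<in> (\<Pi>\<^sub>E g\<in>carrier G. D g) \<longleftrightarrow> (\<lambda>g\<in>carrier G. f (w g)) \<in> (\<Pi>\<^sub>E g\<in>carrier G. f ` D g)"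
        using mem w(2) by (auto simp: PiE_iff)
      have sum: "x = finsum A w ?S \<longleftrightarrow> y = finsum B (\<lambda>g\<in>carrier G. f (w g)) ?S" if "finite ?S"
      proof -
        have "finsum B (\<lambda>g\<in>carrier G. f (w g)) ?S = finsum B (\<lambda>g. f (w g)) ?S"
          using fA w(1) by (intro B.finsum_cong') auto
        also have "\<dots> = f (finsum A w ?S)"
          using that fA w(1) f(2) by (intro finsum_hom[OF A B, symmetric]) auto
        finally have eq: "finsum B (\<lambda>g\<in>carrier G. f (w g)) ?S = f (finsum A w ?S)" .
        have "finsum A w ?S \<in> carrier A" using w(1) by (intro A.finsum_closed) auto
        from inj[OF x(1) this] show ?thesis unfolding eq x(2) by simp
      qed
      show ?thesis unfolding decomposition_def S using pi sum by blast
    qed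
    show ?thesis
    proof (rule ex1I)
      show "decomposition G B (\<lambda>g. f ` D g) y (\<lambda>g\<in>carrier G. f (u g))"
        using transfer[of u] u uA by (auto simp: decomposition_def PiE_def)
    next
      fix v assume v: "decomposition G B (\<lambda>g. f ` D g) y v"
      define w where "w = (\<lambda>g\<in>carrier G. inv_into (carrier A) f (v g))"
      have vB: "v g \<in> f ` carrier A" if "g \<in> carrier G" for g
      proof -
        have "v g \<in> f ` D g" using v that by (auto simp: decomposition_def)
        then show ?thesis using D(1)[OF that] by blast
      qed
      have wA: "w g \<in> carrier A" "f (w g) = v g" if "g \<in> carrier G" for g
        using vB[OF that] that by (simp_all add: w_def inv_into_into f_inv_into_f)
      have veq: "(\<lambda>g\<in>carrier G. f (w g)) = v"
        using v wA(2) by (auto simp: decomposition_def PiE_def extensional_def fun_eq_iff)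
      then have "decomposition G A D x w" using transfer[of w] wA(1) v by (simp add: w_def)
      then have "w = u" by (rule uniq)
      then show "v = (\<lambda>g\<in>carrier G. f (u g))" using veq by simp
    qed
  qed
  have closed: "f ` D g \<subseteq> carrier B \<and> \<zero>\<^bsub>B\<^esub> \<in> f ` D g \<and>
        (\<forall>x\<in>f ` D g. \<forall>y\<in>f ` D g. x \<oplus>\<^bsub>B\<^esub> y \<in> f ` D g) \<and> (\<forall>c. \<forall>x\<in>f ` D g. diag c \<odot>\<^bsub>B\<^esub> x \<in> f ` D g)"
    if g: "g \<in> carrier G" for g
  proof (intro conjI ballI allI)
    show "f ` D g \<subseteq> carrier B" using D(1)[OF g] fA by blast
    show "\<zero>\<^bsub>B\<^esub> \<in> f ` D g" using imageI[OF D(2)[OF g], of f] by (simp add: f0)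
  next
    fix x y assume "x \<in> f ` D g" "y \<in> f ` D g"
    then obtain a c where "a \<in> D g" "c \<in> D g" "x = f a" "y = f c" by blast
    then show "x \<oplus>\<^bsub>B\<^esub> y \<in> f ` D g"
      using imageI[OF D(3)[OF g], of a c f] f(2) DA[OF g] by simp
  next
    fix c x assume "x \<in> f ` D g"
    then obtain a where "a \<in> D g" "x = f a" by blast
    then show "diag c \<odot>\<^bsub>B\<^esub> x \<in> f ` D g"
      using imageI[OF D(4)[OF g], of a f c] f(4) DA[OF g] by simp
  qed
  have "x \<otimes>\<^bsub>B\<^esub> y \<in> f ` D (g \<otimes>\<^bsub>G\<^esub> h)"
    if gh: "g \<in> carrier G" "h \<in> carrier G" "x \<in> f ` D g" "y \<in> f ` D h" for g h x y
  proof -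
    obtain a c where ac: "a \<in> D g" "c \<in> D h" "x = f a" "y = f c" using gh by blast
    then have "a \<otimes>\<^bsub>A\<^esub> c \<in> D (g \<otimes>\<^bsub>G\<^esub> h)" using gr gh unfolding alg_grading_alt by blast
    then show ?thesis using ac f(3) DA gh by (metis imageI)
  qed
  then show ?thesis unfolding alg_grading_alt
    by (intro conjI ballI closed ex1) simp_all
qed

text \<open>L is identified with the scalar operators and inherits independence from
  \<open>D\<close>; the decomposition is the explicit one of \<open>L_decomp\<close>.\<close>

lemma (in graded_cyclic_comp) LD_direct_sum: "direct_sum (carrier G) UNIV LD"
proof
  have sum: "sca (sum u F) id = (\<Sum>g\<in>F. sca (u g) id)" for u and F :: "'g set" by (rule sca_sum_left)
  fix g l m assume g: "g \<in> carrier G" and l: "l \<in> LD g"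
  then have "- sca l id \<in> D g" unfolding LD_def by (simp add: E.D_minus)
  moreover have "- sca l id = sca (- l) id"
  proof -
    have "sca (- l) id + sca l id = 0" unfolding sca_add_left[symmetric] by simp
    then show ?thesis by (metis add_eq_0_iff2)
  qed
  ultimately show "- l \<in> LD g" by (simp add: LD_def)
  assume "m \<in> LD g"
  then show "l + m \<in> LD g" using l g unfolding LD_def by (simp add: sca_add_left E.D_add)
next
  fix l :: "'k triple"
  obtain c0 c1 c2 where l: "l = diag c0 + diag c1 * xi + diag c2 * (xi * xi)" using L_decomp by blast
  define u where "u k = (if k = \<one> then diag c0 else if k = h then diag c1 * xi else diag c2 * (xi * xi))" for k
  have "sum u {\<one>, h, h \<otimes> h} = l"
    using h_facts by (simp add: u_def l ac_simps)
  moreover have "u k \<in> LD k" if "k \<in> {\<one>, h, h \<otimes> h}" for k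
    using that LD_one LD_h LD_hh h_facts by (auto simp: u_def)
  ultimately show "\<exists>F u. finite F \<and> F \<subseteq> carrier G \<and> (\<forall>g\<in>F. u g \<in> LD g) \<and> l = sum u F"
    using h h_facts(5) by (intro exI[of _ "{\<one>, h, h \<otimes> h}"] exI[of _ u]) auto
next
  fix F and u :: "'g \<Rightarrow> 'k triple" and g
  assume F: "finite F" "F \<subseteq> carrier G" "\<And>g. g \<in> F \<Longrightarrow> u g \<in> LD g" "sum u F = 0" "g \<in> F"
  have "(\<Sum>g\<in>F. sca (u g) id) = 0" using F(4) by (simp flip: sca_sum_left)
  then have "sca (u g) id = 0"
    by (intro E.indep[OF F(1,2) _ _ F(5), of "\<lambda>g. sca (u g) id"]) (use F(3) in \<open>auto simp: LD_def\<close>)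
  then show "u g = 0" by (simp add: sca_id_zero)
qed (simp_all add: LD_zero)

text \<open>Carries a decomposition of a type that is a group over to the carrier of a record, where
  gradings are defined.\<close>

lemma alg_grading_class:
  fixes mk :: "'w::ab_group_add \<Rightarrow> 'a"
  assumes A: "abelian_group A" and mk: "bij_betw mk UNIV (carrier A)"
    and add: "\<And>x y. mk (x + y) = mk x \<oplus>\<^bsub>A\<^esub> mk y"
    and W: "direct_sum (carrier G) UNIV W"
    and diag: "\<And>g c x. g \<in> carrier G \<Longrightarrow> x \<in> W g \<Longrightarrow> diag c \<odot>\<^bsub>A\<^esub> mk x \<in> mk ` W g"
    and mult: "\<And>g h x y. g \<in> carrier G \<Longrightarrow> h \<in> carrier G \<Longrightarrow> x \<in> W g \<Longrightarrow> y \<in> W h \<Longrightarrow> mk x \<otimes>\<^bsub>A\<^esub> mk y \<in> mk ` W (g \<otimes>\<^bsub>G\<^esub> h)"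
  shows "alg_grading G A (\<lambda>g. mk ` W g)"
proof -
  interpret A: abelian_group A by (rule A)
  interpret W: direct_sum "carrier G" UNIV W by (rule W)
  have mkA: "mk x \<in> carrier A" for x using bij_betwE[OF mk] by blast
  have inj: "mk x = mk y \<longleftrightarrow> x = y" for x y using mk by (auto simp: bij_betw_def inj_on_def)
  have mk0: "mk 0 = \<zero>\<^bsub>A\<^esub>"
  proof -
    have "mk 0 \<oplus>\<^bsub>A\<^esub> mk 0 = mk 0" using add[of 0 0] by simp
    then show ?thesis using mkA[of 0] A.add.r_cancel_one by simp
  qed
  have mk_minus: "\<ominus>\<^bsub>A\<^esub> mk x = mk (- x)" for x
  proof -
    have "mk (- x) \<oplus>\<^bsub>A\<^esub> mk x = \<zero>\<^bsub>A\<^esub>" using add[of "- x" x] by (simp add: mk0)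
    then show ?thesis using mkA by (intro A.minus_equality) auto
  qed
  have mk_sum: "mk (sum u F) = finsum A (\<lambda>g. mk (u g)) F" if "finite F" for u and F :: "'g set"
    using that
  proof (induction F)
    case (insert i F)
    have "(\<lambda>g. mk (u g)) \<in> F \<rightarrow> carrier A" using mkA by simp
    then show ?case using insert mkA by (simp add: add)
  qed (simp add: mk0)
  show ?thesis
  proof (rule alg_gradingI[OF A])
    fix x assume "x \<in> carrier A"
    then obtain w where w: "x = mk w" using mk by (auto simp: bij_betw_def)
    obtain F u where F: "finite F" "F \<subseteq> carrier G" "\<forall>g\<in>F. u g \<in> W g" "w = sum u F" using W.decomp[of w] by auto
    show "\<exists>F u. finite F \<and> F \<subseteq> carrier G \<and> (\<forall>g\<in>F. u g \<in> mk ` W g) \<and> x = finsum A u F"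
      using F by (intro exI[of _ F] exI[of _ "\<lambda>g. mk (u g)"]) (simp add: w mk_sum)
  next
    fix F u g assume F: "finite F" "F \<subseteq> carrier G" "\<And>g. g \<in> F \<Longrightarrow> u g \<in> mk ` W g" "finsum A u F = \<zero>\<^bsub>A\<^esub>" "g \<in> F"
    define w where "w g = inv_into UNIV mk (u g)" for g
    have w: "mk (w g) = u g \<and> w g \<in> W g" if g: "g \<in> F" for g
    proof -
      obtain y where y: "u g = mk y" "y \<in> W g" using F(3)[OF g] by blast
      have "w g = y" unfolding w_def y(1) using mk by (simp add: bij_betw_def inv_f_f)
      then show ?thesis using y by simp
    qed
    have "finsum A u F = finsum A (\<lambda>g. mk (w g)) F" using w mkA by (intro A.finsum_cong') auto
    then have "mk (sum w F) = mk 0" using F(1,4) by (simp add: mk_sum mk0)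
    then have "sum w F = 0" by (simp add: inj)
    then have "w g = 0" using W.indep[OF F(1,2) _ _ F(5), of w] w by blast
    then show "u g = \<zero>\<^bsub>A\<^esub>" using w[OF F(5)] mk0 by simp
  next
    fix g x y assume "g \<in> carrier G" "x \<in> mk ` W g" "y \<in> mk ` W g"
    then obtain v w where "v \<in> W g" "w \<in> W g" "x = mk v" "y = mk w" by blast
    then show "x \<oplus>\<^bsub>A\<^esub> y \<in> mk ` W g" using W.D_add[OF \<open>g \<in> carrier G\<close>] by (simp add: inj image_iff flip: add)
  next
    fix g x assume g: "g \<in> carrier G" and "x \<in> mk ` W g"
    then obtain v where "v \<in> W g" "x = mk v" by blast
    then show "\<ominus>\<^bsub>A\<^esub> x \<in> mk ` W g" using W.D_minus[OF g] by (simp add: mk_minus)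
  next
    show "\<zero>\<^bsub>A\<^esub> \<in> mk ` W g" if "g \<in> carrier G" for g using W.D_zero[OF that] mk0 by force
  qed (use mkA diag mult in auto)
qed

section \<open>Coordinates\<close>

text \<open>\<open>mk\<close> is a coordinate isomorphism onto the carrier from a type that is an
  additive group as a whole; on that type the record V becomes an instance of
  \<open>cyclic_comp\<close>.\<close>

locale coords = cyclic_composition_algebra V Q
  for V :: "('k::alg_closed_field triple, 'v) module" (structure) and Q +
  fixes mk :: "'w::ab_group_add \<Rightarrow> 'v" and sc :: "'k triple \<Rightarrow> 'w \<Rightarrow> 'w" and n :: nat and e e' :: "nat \<Rightarrow> 'w"
  assumes mk_bij: "bij_betw mk UNIV (carrier V)"
    and mk_add: "mk (x + y) = mk x \<oplus> mk y"
    and mk_sc: "mk (sc l x) = l \<odot> mk x"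
    and dual: "(\<Sum>i<n. sc (polar V Q (mk (e' i)) (mk v)) (e i)) = v"
    and unit_ex: "\<exists>x y. polar V Q (mk x) (mk y) = 1"
begin

sublocale V: abelian_group V
  using module by (rule module.axioms)

lemmas sm = module_smult[OF module]

definition co :: "'v \<Rightarrow> 'w" where "co = inv_into UNIV mk"

definition vb :: "'w \<Rightarrow> 'w \<Rightarrow> 'k triple" where "vb x y = polar V Q (mk x) (mk y)"

definition vm :: "'w \<Rightarrow> 'w \<Rightarrow> 'w" where "vm x y = co (mk x \<otimes> mk y)"

lemma mk_closed [simp]: "mk x \<in> carrier V"
  using bij_betwE[OF mk_bij] by blast

lemma co_mk [simp]: "co (mk x) = x"
  using mk_bij by (simp add: co_def bij_betw_def inv_f_f)

lemma mk_co [simp]: "v \<in> carrier V \<Longrightarrow> mk (co v) = v"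
  using mk_bij by (simp add: co_def bij_betw_def f_inv_into_f)

lemma mk_injD: "mk x = mk y \<Longrightarrow> x = y"
  by (metis co_mk)

lemma mk_vm [simp]: "mk (vm x y) = mk x \<otimes> mk y"
  by (simp add: vm_def mult_closed)

lemma co_add: "v \<in> carrier V \<Longrightarrow> w \<in> carrier V \<Longrightarrow> co (v \<oplus> w) = co v + co w"
  by (rule mk_injD) (simp add: mk_add)

lemma co_smult: "v \<in> carrier V \<Longrightarrow> co (l \<odot> v) = sc l (co v)"
  by (rule mk_injD) (simp add: mk_sc sm)

lemma polar_sym: "v \<in> carrier V \<Longrightarrow> w \<in> carrier V \<Longrightarrow> polar V Q v w = polar V Q w v"
  by (simp add: polar_def V.a_comm)

lemma polar_add: "u \<in> carrier V \<Longrightarrow> v \<in> carrier V \<Longrightarrow> w \<in> carrier V \<Longrightarrow>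
    polar V Q (u \<oplus> v) w = polar V Q u w + polar V Q v w"
  and polar_smult: "v \<in> carrier V \<Longrightarrow> w \<in> carrier V \<Longrightarrow> polar V Q (l \<odot> v) w = l * polar V Q v w"
  using quadratic unfolding quadratic_form_def by blast+

lemma nondeg: "(\<And>x. vb x v = vb x w) \<Longrightarrow> v = w"
proof -
  assume *: "\<And>x. vb x v = vb x w"
  have "v = (\<Sum>i<n. sc (vb (e' i) v) (e i))" unfolding vb_def by (rule dual[symmetric])
  also have "\<dots> = w" unfolding * unfolding vb_def by (rule dual)
  finally show "v = w" .
qed

lemma norm_polar: "vb (vm x y) (vm z y) = rho (vb x z) * rho (rho (Q (mk y)))"
proof -
  have "vb (vm x y) (vm z y) = Q ((mk x \<oplus> mk z) \<otimes> mk y) - Q (mk x \<otimes> mk y) - Q (mk z \<otimes> mk y)"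
    by (simp add: vb_def polar_def mult_add_left)
  also have "\<dots> = rho (Q (mk x \<oplus> mk z)) * rho (rho (Q (mk y))) - rho (Q (mk x)) * rho (rho (Q (mk y)))
      - rho (Q (mk z)) * rho (rho (Q (mk y)))"
    by (simp add: norm_mult)
  also have "\<dots> = (rho (Q (mk x \<oplus> mk z)) - rho (Q (mk x)) - rho (Q (mk z))) * rho (rho (Q (mk y)))"
    by (simp add: algebra_simps)
  also have "rho (Q (mk x \<oplus> mk z)) - rho (Q (mk x)) - rho (Q (mk z)) = rho (vb x z)"
  proof -
    have "rho (Q (mk x \<oplus> mk z)) = rho (vb x z + Q (mk x) + Q (mk z))" by (simp add: vb_def polar_def)
    then show ?thesis by (simp only: rho_add) simp
  qed
  finally show ?thesis .
qed

lemma vb_sym: "vb x y = vb y x"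
  by (simp add: vb_def polar_sym)

lemma vb_cyc: "vb (vm x y) z = rho (vb (vm y z) x)"
  by (simp add: vb_def polar_cyclic1[of "mk x" "mk y" "mk z"])

lemma vb_sc: "vb (sc l x) y = l * vb x y"
  by (simp add: vb_def mk_sc polar_smult)

text \<open>Pairing with y and cyclic invariance turn the left side, up to \<rho>, into b(y \<star>
  x, z \<star> x), which the multiplicativity of Q, polarized in the first argument,
  evaluates.\<close>

lemma alternative: "vm x (vm z x) = sc (rho (Q (mk x))) z"
proof (rule nondeg)
  fix y
  have "rho (vb (vm x (vm z x)) y) = rho (vb y z) * rho (rho (Q (mk x)))"
    using vb_cyc[of y x "vm z x"] norm_polar[of y x z] by simp
  then have "rho (rho (rho (vb (vm x (vm z x)) y))) = rho (rho (rho (vb y z) * rho (rho (Q (mk x)))))"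
    by (simp only:)
  then have "vb (vm x (vm z x)) y = vb z y * rho (Q (mk x))" by (simp add: vb_sym)
  then show "vb y (vm x (vm z x)) = vb y (sc (rho (Q (mk x))) z)"
    by (simp add: vb_sym[of y] vb_sc mult.commute)
qed

lemma vm_add: "vm (x + y) z = vm x z + vm y z" "vm x (y + z) = vm x y + vm x z"
  by (rule mk_injD; simp add: mk_add mult_add_left mult_add_right)+

sublocale C: cyclic_comp sc vb vm n e e'
proof
  have q: "Q (mk (x + y)) = Q (mk x) + Q (mk y) + vb x y" for x y
    by (simp add: mk_add vb_def polar_def)
  show sc_add: "sc (l + m) x = sc l x + sc m x" for l m x
    by (rule mk_injD) (simp add: mk_add mk_sc sm)
  \<comment> \<open>Polarization of \<open>alternative\<close> at x + y.\<close>
  show "vm x (vm z y) + vm y (vm z x) = sc (rho (vb x y)) z" for x y z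
  proof -
    have "vm (x + y) (vm z (x + y)) = sc (rho (Q (mk (x + y)))) z" by (rule alternative)
    then have "vm x (vm z x) + vm x (vm z y) + (vm y (vm z x) + vm y (vm z y))
        = sc (rho (Q (mk x))) z + sc (rho (Q (mk y))) z + sc (rho (vb x y)) z"
      by (simp add: vm_add q sc_add algebra_simps)
    then show ?thesis by (simp add: alternative algebra_simps)
  qed
  show "\<exists>x y. vb x y = 1" using unit_ex by (simp add: vb_def)
  show "(\<Sum>i<n. sc (vb (e' i) v) (e i)) = v" for v using dual by (simp add: vb_def)
  show "vb (vm x y) z = rho (vb (vm y z) x)" for x y z by (rule vb_cyc)
  show "vb x y = vb y x" for x y by (rule vb_sym)
  show "sc l (x + y) = sc l x + sc l y" for l x y by (rule mk_injD) (simp add: mk_add mk_sc sm)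
  show "sc (l * m) x = sc l (sc m x)" for l m x by (rule mk_injD) (simp add: mk_sc sm)
  show "sc 1 x = x" for x by (rule mk_injD) (simp add: mk_sc sm)
  show "vb (x + y) z = vb x z + vb y z" for x y z by (simp add: vb_def mk_add polar_add)
  show "vb (sc l x) y = l * vb x y" for l x y by (rule vb_sc)
  show "vm (x + y) z = vm x z + vm y z" "vm x (y + z) = vm x y + vm x z" for x y z by (rule vm_add)+
  show "vm (sc l x) y = sc (rho l) (vm x y)" "vm x (sc l y) = sc (rho (rho l)) (vm x y)" for l x y
    by (rule mk_injD; simp add: mk_sc mult_smult_left mult_smult_right)+
qed

definition T :: "('w \<Rightarrow> 'w) \<Rightarrow> 'v \<Rightarrow> 'v" where "T a = (\<lambda>v\<in>carrier V. mk (a (co v)))"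

definition U :: "('v \<Rightarrow> 'v) \<Rightarrow> 'w \<Rightarrow> 'w" where "U f = (\<lambda>x. co (f (mk x)))"

abbreviation EV where "EV \<equiv> End_alg V"

lemma EV_simps:
  "f \<otimes>\<^bsub>EV\<^esub> g = compose (carrier V) f g" "\<one>\<^bsub>EV\<^esub> = (\<lambda>v\<in>carrier V. v)" "\<zero>\<^bsub>EV\<^esub> = (\<lambda>v\<in>carrier V. \<zero>)"
  "f \<oplus>\<^bsub>EV\<^esub> g = (\<lambda>v\<in>carrier V. f v \<oplus> g v)" "l \<odot>\<^bsub>EV\<^esub> f = (\<lambda>v\<in>carrier V. l \<odot> f v)"
  by (simp_all add: End_alg_def)

lemma EV_D:
  assumes "f \<in> carrier EV"
  shows "v \<in> carrier V \<Longrightarrow> f v \<in> carrier V" "v \<in> carrier V \<Longrightarrow> w \<in> carrier V \<Longrightarrow> f (v \<oplus> w) = f v \<oplus> f w"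
    "v \<in> carrier V \<Longrightarrow> f (l \<odot> v) = l \<odot> f v" "f \<in> extensional (carrier V)"
  using assms by (auto simp: End_alg_def PiE_def)

lemma U_T [simp]: "U (T a) = a"
  by (simp add: U_def T_def fun_eq_iff)

lemma T_U [simp]: "f \<in> carrier EV \<Longrightarrow> T (U f) = f"
  using EV_D[of f] by (auto simp: U_def T_def fun_eq_iff extensional_def)

lemma U_lin [simp]: "f \<in> carrier EV \<Longrightarrow> C.lin (U f)"
  using EV_D[of f] by (simp add: U_def C.lin_def mk_add mk_sc co_add co_smult)

lemma T_closed [simp]: "C.lin a \<Longrightarrow> T a \<in> carrier EV"
  by (simp add: End_alg_def T_def co_add co_smult C.lin_add C.lin_sc mk_add mk_sc sm)

lemma U_inj: "f \<in> carrier EV \<Longrightarrow> g \<in> carrier EV \<Longrightarrow> U f = U g \<Longrightarrow> f = g"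
  by (metis T_U)

lemma T_add: "T (a + c) = T a \<oplus>\<^bsub>EV\<^esub> T c"
  by (auto simp: T_def EV_simps fun_eq_iff mk_add plus_fun_apply)

lemma T_mult: "T (a \<circ> c) = T a \<otimes>\<^bsub>EV\<^esub> T c"
  by (auto simp: T_def EV_simps fun_eq_iff compose_def o_apply)

lemma T_sca: "T (C.sca l a) = l \<odot>\<^bsub>EV\<^esub> T a"
  by (auto simp: T_def EV_simps fun_eq_iff C.sca_def mk_sc)

lemma mk_0: "mk 0 = \<zero>"
proof -
  have "mk 0 \<oplus> mk 0 = mk 0" using mk_add[of 0 0] by simp
  then show ?thesis by (simp add: V.add.r_cancel_one)
qed

lemma T_one: "T id = \<one>\<^bsub>EV\<^esub>"
  by (auto simp: T_def EV_simps fun_eq_iff id_apply)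

lemma T_zero: "T 0 = \<zero>\<^bsub>EV\<^esub>"
  by (auto simp: T_def EV_simps fun_eq_iff zero_fun_apply mk_0)

lemma T_ten: "T (C.ten x y) = rank_one V Q (mk x) (mk y)"
  by (auto simp: T_def rank_one_def C.ten_def fun_eq_iff mk_sc vb_def)

lemma T_inj: "T a = T c \<longleftrightarrow> a = c"
  by (metis U_T)

lemma EV_obtain:
  assumes "f \<in> carrier EV" obtains a where "C.lin a" "f = T a"
  using assms by (metis T_U U_lin)

lemma U_add: "f \<in> carrier EV \<Longrightarrow> g \<in> carrier EV \<Longrightarrow> U (f \<oplus>\<^bsub>EV\<^esub> g) = U f + U g"
  by (metis T_U U_T T_add)

lemma U_mult: "f \<in> carrier EV \<Longrightarrow> g \<in> carrier EV \<Longrightarrow> U (f \<otimes>\<^bsub>EV\<^esub> g) = U f \<circ> U g"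
  by (metis T_U U_T T_mult)

lemma EV_abelian: "abelian_group EV"
proof (rule abelian_groupI)
  show "\<zero>\<^bsub>EV\<^esub> \<in> carrier EV" unfolding T_zero[symmetric] by (rule T_closed) (rule C.lin_0)
next
  fix f assume "f \<in> carrier EV"
  then obtain a where a: "C.lin a" "f = T a" by (rule EV_obtain)
  show "\<zero>\<^bsub>EV\<^esub> \<oplus>\<^bsub>EV\<^esub> f = f" unfolding a T_zero[symmetric] T_add[symmetric] by simp
  have "T (C.sca (- 1) a) \<oplus>\<^bsub>EV\<^esub> f = \<zero>\<^bsub>EV\<^esub>"
    unfolding a T_zero[symmetric] T_add[symmetric] T_inj
    by (simp add: C.sca_def fun_simps C.sc_minus_one)
  then show "\<exists>g\<in>carrier EV. g \<oplus>\<^bsub>EV\<^esub> f = \<zero>\<^bsub>EV\<^esub>" using a by (intro bexI[of _ "T (C.sca (- 1) a)"]) (simp_all add: C.lin_sca)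
next
  fix f g assume "f \<in> carrier EV" "g \<in> carrier EV"
  then obtain a c where a: "C.lin a" "f = T a" and c: "C.lin c" "g = T c" by (elim EV_obtain)
  show "f \<oplus>\<^bsub>EV\<^esub> g \<in> carrier EV" unfolding a c T_add[symmetric] using a c by (simp add: C.lin_plus)
  show "f \<oplus>\<^bsub>EV\<^esub> g = g \<oplus>\<^bsub>EV\<^esub> f" unfolding a c T_add[symmetric] by (simp add: add.commute)
  fix h assume "h \<in> carrier EV"
  then obtain d where d: "C.lin d" "h = T d" by (elim EV_obtain)
  show "f \<oplus>\<^bsub>EV\<^esub> g \<oplus>\<^bsub>EV\<^esub> h = f \<oplus>\<^bsub>EV\<^esub> (g \<oplus>\<^bsub>EV\<^esub> h)"
    unfolding a c d T_add[symmetric] by (simp add: add.assoc)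
qed

lemma adjoint_T:
  assumes a: "C.lin a"
  shows "adjoint V Q (T a) = T (C.adj a)"
  unfolding adjoint_def
proof (rule the_equality)
  show "T (C.adj a) \<in> carrier EV \<and> (\<forall>x\<in>carrier V. \<forall>y\<in>carrier V. polar V Q (T a x) y = polar V Q x (T (C.adj a) y))"
  proof (intro conjI ballI)
    fix x y assume xy: "x \<in> carrier V" "y \<in> carrier V"
    have "vb (a (co x)) (co y) = vb (co x) (C.adj a (co y))" by (rule C.adj_iff[OF a])
    then show "polar V Q (T a x) y = polar V Q x (T (C.adj a) y)" using xy by (simp add: vb_def T_def)
  qed simp
next
  fix g assume g: "g \<in> carrier EV \<and> (\<forall>x\<in>carrier V. \<forall>y\<in>carrier V. polar V Q (T a x) y = polar V Q x (g y))"
  then obtain c where c: "C.lin c" "g = T c" by (elim conjE EV_obtain)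
  have "vb (a x) y = vb x (c y)" for x y
    using g[THEN conjunct2, rule_format, of "mk x" "mk y"] by (simp add: c T_def vb_def)
  then have "c = C.adj a" by (rule C.adj_unique[OF a])
  then show "g = T (C.adj a)" using c by simp
qed

sublocale K: closed_module EV "adjoint V Q"
proof
  show "a \<oplus>\<^bsub>EV\<^esub> c \<in> carrier EV" if "a \<in> carrier EV" "c \<in> carrier EV" for a c
    using abelian_monoid.a_closed[OF abelian_group.axioms(1)[OF EV_abelian] that] .
  show "l \<odot>\<^bsub>EV\<^esub> a \<in> carrier EV" if "a \<in> carrier EV" for a l
    using that by (elim EV_obtain) (simp add: C.lin_sca flip: T_sca)
qed

end

lemma twisted_square_simps:
  "carrier (twisted_square E) = carrier E \<times> carrier E"
  "p \<oplus>\<^bsub>twisted_square E\<^esub> q = (fst p \<oplus>\<^bsub>E\<^esub> fst q, snd p \<oplus>\<^bsub>E\<^esub> snd q)"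
  "p \<otimes>\<^bsub>twisted_square E\<^esub> q = (fst p \<otimes>\<^bsub>E\<^esub> fst q, snd p \<otimes>\<^bsub>E\<^esub> snd q)"
  "\<one>\<^bsub>twisted_square E\<^esub> = (\<one>\<^bsub>E\<^esub>, \<one>\<^bsub>E\<^esub>)"
  "l \<odot>\<^bsub>twisted_square E\<^esub> p = (rho l \<odot>\<^bsub>E\<^esub> fst p, rho (rho l) \<odot>\<^bsub>E\<^esub> snd p)"
  by (auto simp: twisted_square_def ring.defs RDirProd_def DirProd_def monoid.defs split_def)

locale graded_coords = coords V Q mk sc n e e' + G: comm_group G
  for V :: "('k::alg_closed_field triple, 'v) module" (structure) and Q
    and mk :: "'w::ab_group_add \<Rightarrow> 'v" and sc n e e'
    and G :: "('g, 'm) monoid_scheme" +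
  fixes S :: "('k, 'v \<Rightarrow> 'v) trialitarian_data" and D and \<omega> :: 'k and h :: 'g
  assumes arises: "arises_from S V Q" and grading: "trialitarian_grading G S D"
    and \<omega>: "\<omega> ^ 3 = 1" "\<omega> \<noteq> 1" and h: "h \<in> carrier G" "group.ord G h = 3"
    and L1: "{l. l \<odot>\<^bsub>End_alg V\<^esub> \<one>\<^bsub>End_alg V\<^esub> \<in> D \<one>\<^bsub>G\<^esub>} = range diag"
    and Lh: "{l. l \<odot>\<^bsub>End_alg V\<^esub> \<one>\<^bsub>End_alg V\<^esub> \<in> D h} = range (\<lambda>c. diag c * (1, \<omega>, \<omega>\<^sup>2))"
    and Lhh: "{l. l \<odot>\<^bsub>End_alg V\<^esub> \<one>\<^bsub>End_alg V\<^esub> \<in> D (h \<otimes>\<^bsub>G\<^esub> h)} = range (\<lambda>c. diag c * ((1, \<omega>, \<omega>\<^sup>2) * (1, \<omega>, \<omega>\<^sup>2)))"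
begin

lemma S_simps: "E_alg S = EV" "E_inv S = adjoint V Q"
  using arises by (simp_all add: arises_from_def)

abbreviation Cl0 where "Cl0 \<equiv> clifford EV (adjoint V Q)"

abbreviation kap where "kap \<equiv> kappa EV (adjoint V Q)"

lemma alpha: "E_map S \<in> alg_iso Cl0 (twisted_square EV)"
  using arises unfolding arises_from_def alpha_iso_def by (simp add: S_simps)

lemma alpha_hom: "E_map S \<in> ring_hom Cl0 (twisted_square EV)"
  using alpha by (simp add: alg_iso_def ring_iso_def)

lemma alpha_surj: "E_map S ` carrier Cl0 = carrier EV \<times> carrier EV"
  using alpha by (simp add: alg_iso_def ring_iso_def bij_betw_def twisted_square_simps)

lemma alpha_closed: "z \<in> carrier Cl0 \<Longrightarrow> E_map S z \<in> carrier EV \<times> carrier EV"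
  using alpha_surj by blast

lemma alpha_rank_one: "x \<in> carrier V \<Longrightarrow> y \<in> carrier V \<Longrightarrow>
   E_map S (kap (rank_one V Q x y)) = (\<lambda>v\<in>carrier V. x \<otimes> (v \<otimes> y), \<lambda>v\<in>carrier V. (y \<otimes> v) \<otimes> x)"
  using arises unfolding arises_from_def by (simp add: S_simps)

lemma alpha_kap_closed: "f \<in> carrier EV \<Longrightarrow> E_map S (kap f) \<in> carrier EV \<times> carrier EV"
  by (intro alpha_closed K.kappa_closed)

lemma alpha_kap_add: "f \<in> carrier EV \<Longrightarrow> g \<in> carrier EV \<Longrightarrow>
    E_map S (kap (f \<oplus>\<^bsub>EV\<^esub> g)) = E_map S (kap f) \<oplus>\<^bsub>twisted_square EV\<^esub> E_map S (kap g)"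
  unfolding K.kappa_add by (rule ring_hom_add[OF alpha_hom]) (auto intro: K.kappa_closed)

lemma lin_additive_sum:
  fixes H :: "('w \<Rightarrow> 'w) \<Rightarrow> 'w \<Rightarrow> 'w"
  assumes H: "\<And>a c. C.lin a \<Longrightarrow> C.lin c \<Longrightarrow> H (a + c) = H a + H c"
    and f: "\<And>i. i \<in> F \<Longrightarrow> C.lin (f i)"
  shows "H (sum f F) = (\<Sum>i\<in>F. H (f i))"
  using f
proof (induction F rule: infinite_finite_induct)
  case (insert x F)
  have "C.lin (f x)" "C.lin (sum f F)" using insert.prems by (auto intro: C.lin_sumI)
  then show ?case using insert by (simp add: H)
qed (use H[of 0 0] in simp_all)

text \<open>Both sides are additive and agree on rank one operators, where \<alpha> is prescribed;
  every linear operator is a sum of these.\<close>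

lemma alpha_T:
  assumes a: "C.lin a"
  shows "U (fst (E_map S (kap (T a)))) = C.\<Phi> a id" "U (snd (E_map S (kap (T a)))) = C.\<alpha>\<^sub>2 a"
proof -
  have closed: "fst (E_map S (kap (T a))) \<in> carrier EV" "snd (E_map S (kap (T a))) \<in> carrier EV" if "C.lin a" for a
    using alpha_kap_closed[OF T_closed[OF that]] by auto
  have add: "U (fst (E_map S (kap (T (a + c))))) = U (fst (E_map S (kap (T a)))) + U (fst (E_map S (kap (T c))))"
      "U (snd (E_map S (kap (T (a + c))))) = U (snd (E_map S (kap (T a)))) + U (snd (E_map S (kap (T c))))"
    if "C.lin a" "C.lin c" for a c
    unfolding T_add alpha_kap_add[OF T_closed[OF that(1)] T_closed[OF that(2)]] twisted_square_simps
    using that by (simp_all add: U_add closed)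
  have ten: "U (fst (E_map S (kap (T (C.ten x y))))) = C.\<Phi> (C.ten x y) id"
     "U (snd (E_map S (kap (T (C.ten x y))))) = C.\<alpha>\<^sub>2 (C.ten x y)" for x y
    by (simp_all add: T_ten alpha_rank_one C.\<Phi>_ten C.\<alpha>\<^sub>2_ten)
      (simp_all add: U_def fun_eq_iff id_apply vm_def mult_closed)
  have "U (fst (E_map S (kap (T (\<Sum>i<n. C.ten (a (e i)) (e' i)))))) = (\<Sum>i<n. C.\<Phi> (C.ten (a (e i)) (e' i)) id)"
    by (subst lin_additive_sum[of "\<lambda>a. U (fst (E_map S (kap (T a))))"]) (simp_all add: add ten)
  also have "\<dots> = C.\<Phi> (\<Sum>i<n. C.ten (a (e i)) (e' i)) id" by (simp add: C.\<Phi>_sum_left)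
  finally show "U (fst (E_map S (kap (T a)))) = C.\<Phi> a id" by (simp only: C.ten_expand[OF a])
  have "U (snd (E_map S (kap (T (\<Sum>i<n. C.ten (a (e i)) (e' i)))))) = (\<Sum>i<n. C.\<alpha>\<^sub>2 (C.ten (a (e i)) (e' i)))"
    by (subst lin_additive_sum[of "\<lambda>a. U (snd (E_map S (kap (T a))))"]) (simp_all add: add ten)
  also have "\<dots> = C.\<alpha>\<^sub>2 (\<Sum>i<n. C.ten (a (e i)) (e' i))" by (simp add: C.\<alpha>\<^sub>2_sum)
  finally show "U (snd (E_map S (kap (T a)))) = C.\<alpha>\<^sub>2 a" by (simp only: C.ten_expand[OF a])
qed

text \<open>Surjectivity of \<alpha> writes (T a, T a) as the image of a Clifford element z.
  Induction over z applies because \<open>kappa\<close> generates, and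
  \<open>\<alpha>\<^sub>2\<close> is the second component on generators.\<close>

lemma alpha_generates:
  assumes B: "id \<in> B" "\<And>a c. a \<in> B \<Longrightarrow> c \<in> B \<Longrightarrow> a + c \<in> B" "\<And>l a. a \<in> B \<Longrightarrow> C.sca l a \<in> B"
      "\<And>a c. C.lin a \<Longrightarrow> c \<in> B \<Longrightarrow> C.\<alpha>\<^sub>2 a \<circ> c \<in> B" and a: "C.lin a"
  shows "a \<in> B"
proof -
  have "(T a, T a) \<in> E_map S ` carrier Cl0" unfolding alpha_surj using a by simp
  then obtain z where z: "z \<in> carrier Cl0" "E_map S z = (T a, T a)" by force
  \<comment> \<open>Stability of B under left composition passes to products of Clifford elements,
    which membership in B would not; it is applied to \<open>id\<close> at the end.\<close>
  have "\<forall>c\<in>B. U (snd (E_map S z)) \<circ> c \<in> B"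
    using z(1)
  proof (rule K.clifford_induct)
    fix l
    interpret Cl: ring Cl0 by (rule K.clifford_ring)
    have "E_map S (l \<odot>\<^bsub>Cl0\<^esub> \<one>\<^bsub>Cl0\<^esub>) = l \<odot>\<^bsub>twisted_square EV\<^esub> \<one>\<^bsub>twisted_square EV\<^esub>"
      using alpha ring_hom_one[OF alpha_hom] Cl.one_closed by (simp add: alg_iso_def)
    then have eq: "U (snd (E_map S (l \<odot>\<^bsub>Cl0\<^esub> \<one>\<^bsub>Cl0\<^esub>))) = C.sca (rho (rho l)) id"
      by (simp only: twisted_square_simps snd_conv T_one[symmetric] T_sca[symmetric] U_T)
    show "\<forall>c\<in>B. U (snd (E_map S (l \<odot>\<^bsub>Cl0\<^esub> \<one>\<^bsub>Cl0\<^esub>))) \<circ> c \<in> B"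
      unfolding eq using B(3) by (simp add: C.sca_comp)
  next
    fix f assume "f \<in> carrier EV"
    then obtain a where a: "C.lin a" "f = T a" by (rule EV_obtain)
    show "\<forall>c\<in>B. U (snd (E_map S (kap f))) \<circ> c \<in> B"
      unfolding a(2) alpha_T(2)[OF a(1)] using B(4) a(1) by blast
  next
    fix x y assume xy: "x \<in> carrier Cl0" "y \<in> carrier Cl0"
      and IH: "\<forall>c\<in>B. U (snd (E_map S x)) \<circ> c \<in> B" "\<forall>c\<in>B. U (snd (E_map S y)) \<circ> c \<in> B"
    have cl: "snd (E_map S x) \<in> carrier EV" "snd (E_map S y) \<in> carrier EV"
      using alpha_closed[OF xy(1)] alpha_closed[OF xy(2)] by (simp_all add: mem_Times_iff)
    have "U (snd (E_map S (x \<oplus>\<^bsub>Cl0\<^esub> y))) = U (snd (E_map S x)) + U (snd (E_map S y))"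
      using ring_hom_add[OF alpha_hom xy] U_add[OF cl] by (simp add: twisted_square_simps)
    then show "\<forall>c\<in>B. U (snd (E_map S (x \<oplus>\<^bsub>Cl0\<^esub> y))) \<circ> c \<in> B"
      using B(2) IH by (simp add: C.comp_add_distrib)
    have "U (snd (E_map S (x \<otimes>\<^bsub>Cl0\<^esub> y))) = U (snd (E_map S x)) \<circ> U (snd (E_map S y))"
      using ring_hom_mult[OF alpha_hom xy] U_mult[OF cl] by (simp add: twisted_square_simps)
    then show "\<forall>c\<in>B. U (snd (E_map S (x \<otimes>\<^bsub>Cl0\<^esub> y))) \<circ> c \<in> B"
      using IH by (simp add: comp_assoc)
  qed
  from bspec[OF this B(1)] show ?thesis by (simp add: z(2) o_def id_def)
qed

lemma D_grading: "alg_grading G EV D"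
  using grading by (simp add: trialitarian_grading_def S_simps)

lemma D_EV: "g \<in> carrier G \<Longrightarrow> f \<in> D g \<Longrightarrow> f \<in> carrier EV"
  using D_grading unfolding alg_grading_alt by blast

lemma D_alpha:
  assumes g: "g \<in> carrier G" "f \<in> D g"
  shows "fst (E_map S (kap f)) \<in> D g" "snd (E_map S (kap f)) \<in> D g"
proof -
  obtain DC where DC: "kap ` D g \<subseteq> DC g" "E_map S ` DC g \<subseteq> D g \<times> D g"
    using grading[unfolded trialitarian_grading_def S_simps, THEN conjunct2, THEN conjunct2] g(1)
    by (elim exE conjE) (rule that, (erule bspec, assumption)+)
  have "E_map S (kap f) \<in> D g \<times> D g" using DC g(2) by blast
  then show "fst (E_map S (kap f)) \<in> D g" "snd (E_map S (kap f)) \<in> D g" by auto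
qed

definition DW :: "'g \<Rightarrow> ('w \<Rightarrow> 'w) set" where "DW g = {a. C.lin a \<and> T a \<in> D g}"

lemma DW_U: "g \<in> carrier G \<Longrightarrow> f \<in> D g \<Longrightarrow> U f \<in> DW g"
  using D_EV[of g f] by (simp add: DW_def)

sublocale R: graded_cyclic_comp sc vb vm n e e' G DW \<omega> h
proof (unfold_locales)
  have D: "D g \<subseteq> carrier EV \<and> \<zero>\<^bsub>EV\<^esub> \<in> D g \<and>
        (\<forall>x\<in>D g. \<forall>y\<in>D g. x \<oplus>\<^bsub>EV\<^esub> y \<in> D g) \<and> (\<forall>c. \<forall>x\<in>D g. diag c \<odot>\<^bsub>EV\<^esub> x \<in> D g)" if "g \<in> carrier G" for g
    using D_grading that unfolding alg_grading_alt by blast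
  show sca: "C.sca (diag s) a \<in> DW g" if "g \<in> carrier G" "a \<in> DW g" for g a s
    using that D by (simp add: DW_def C.lin_sca T_sca)
  show "DW g \<subseteq> Collect C.lin" for g by (auto simp: DW_def)
  show "0 \<in> DW g" if "g \<in> carrier G" for g using that D by (simp add: DW_def T_zero)
  show "a + c \<in> DW g" if "g \<in> carrier G" "a \<in> DW g" "c \<in> DW g" for g a c
    using that D by (simp add: DW_def T_add C.lin_plus)
  show "- a \<in> DW g" if "g \<in> carrier G" "a \<in> DW g" for g a
  proof -
    have "diag (- 1) + 1 = (0 :: 'k triple)" using diag_add[of "- 1" "1 :: 'k"] by simp
    then have "C.sca (diag (- 1)) a + a = 0" using C.sca_add_left[of "diag (- 1)" 1 a] by simp
    then have "- a = C.sca (diag (- 1)) a" by (metis add_eq_0_iff2)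
    then show ?thesis using sca[OF that] by simp
  qed
  show "\<exists>F u. finite F \<and> F \<subseteq> carrier G \<and> (\<forall>g\<in>F. u g \<in> DW g) \<and> a = sum u F" if "a \<in> Collect C.lin" for a
  proof -
    have "T a \<in> carrier EV" using that by simp
    from alg_grading_decomp[OF D_grading this] obtain F u
      where F: "finite F" "F \<subseteq> carrier G" "\<forall>g\<in>F. u g \<in> D g" "T a = finsum EV u F" by blast
    have "U (finsum EV u F) = (\<Sum>g\<in>F. U (u g))"
      using F D_EV by (intro finsum_to_class[OF EV_abelian]) (auto simp: U_add)
    then have "a = (\<Sum>g\<in>F. U (u g))" unfolding F(4)[symmetric] by simp
    then show ?thesis using F DW_U by (intro exI[of _ F] exI[of _ "\<lambda>g. U (u g)"]) auto
  qed
  show "u g = 0" if F: "finite F" "F \<subseteq> carrier G" "\<And>g. g \<in> F \<Longrightarrow> u g \<in> DW g" "sum u F = 0" "g \<in> F" for F u g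
  proof -
    have Tu: "T (u g) \<in> D g" "T (u g) \<in> carrier EV" if "g \<in> F" for g using F(3)[OF that] by (simp_all add: DW_def)
    have "U (finsum EV (\<lambda>g. T (u g)) F) = (\<Sum>g\<in>F. U (T (u g)))"
      using F(1) Tu by (intro finsum_to_class[OF EV_abelian]) (auto simp: U_add)
    then have "U (finsum EV (\<lambda>g. T (u g)) F) = U \<zero>\<^bsub>EV\<^esub>" using F(4) by (simp add: T_zero[symmetric])
    moreover have "finsum EV (\<lambda>g. T (u g)) F \<in> carrier EV"
      using Tu by (intro abelian_monoid.finsum_closed abelian_group.axioms EV_abelian) auto
    moreover have "\<zero>\<^bsub>EV\<^esub> \<in> carrier EV" using D[OF G.one_closed] by blast
    ultimately have "finsum EV (\<lambda>g. T (u g)) F = \<zero>\<^bsub>EV\<^esub>" by (metis U_inj)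
    from alg_grading_indep[OF EV_abelian D_grading F(1,2) Tu(1) this F(5)]
    show ?thesis by (simp add: T_zero[symmetric] T_inj)
  qed
  show "a \<circ> c \<in> DW (g \<otimes>\<^bsub>G\<^esub> k)" if "g \<in> carrier G" "k \<in> carrier G" "a \<in> DW g" "c \<in> DW k" for g k a c
    using that D_grading unfolding alg_grading_alt by (simp add: DW_def T_mult C.lin_comp)
  show "C.adj a \<in> DW g" if g: "g \<in> carrier G" "a \<in> DW g" for g a
  proof -
    have "adjoint V Q ` D g \<subseteq> D g" using grading g by (simp add: trialitarian_grading_def S_simps)
    then show ?thesis using g adjoint_T[of a] by (auto simp: DW_def)
  qed
  show "C.\<Phi> a id \<in> DW g" if g: "g \<in> carrier G" "a \<in> DW g" for g a
    using DW_U[OF g(1) D_alpha(1)[OF g(1), of "T a"]] alpha_T(1)[of a] g(2) by (simp add: DW_def)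
  show "C.\<alpha>\<^sub>2 a \<in> DW g" if g: "g \<in> carrier G" "a \<in> DW g" for g a
    using DW_U[OF g(1) D_alpha(2)[OF g(1), of "T a"]] alpha_T(2)[of a] g(2) by (simp add: DW_def)
  show "a \<in> B" if "id \<in> B" "\<And>a c. a \<in> B \<Longrightarrow> c \<in> B \<Longrightarrow> a + c \<in> B" "\<And>l a. a \<in> B \<Longrightarrow> C.sca l a \<in> B"
      "\<And>a c. C.lin a \<Longrightarrow> c \<in> B \<Longrightarrow> C.\<alpha>\<^sub>2 a \<circ> c \<in> B" "C.lin a" for B a
    using that by (rule alpha_generates)
  have id: "C.sca l id \<in> DW g \<longleftrightarrow> l \<odot>\<^bsub>EV\<^esub> \<one>\<^bsub>EV\<^esub> \<in> D g" for l g
    by (simp add: DW_def C.lin_sca T_sca T_one)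
  show "{l. C.sca l id \<in> DW \<one>\<^bsub>G\<^esub>} = range diag" unfolding id by (rule L1)
  show "{l. C.sca l id \<in> DW h} = range (\<lambda>c. diag c * (1, \<omega>, \<omega>\<^sup>2))" unfolding id by (rule Lh)
  show "{l. C.sca l id \<in> DW (h \<otimes>\<^bsub>G\<^esub> h)} = range (\<lambda>c. diag c * ((1, \<omega>, \<omega>\<^sup>2) * (1, \<omega>, \<omega>\<^sup>2)))" unfolding id by (rule Lhh)
qed (use \<omega> h in simp_all)

lemma triple_alg_abelian: "abelian_group (triple_alg :: ('k triple, 'k triple) module)"
  by (rule abelian_groupI)
    (auto simp: triple_alg_def ring.defs ring_of_type_algebra_def algebra_simps intro: exI[of _ "- _"])

theorem composition_grading_exists:
  "\<exists>DL DV. cyclic_composition_grading G V Q DL DV \<and> (\<forall>g\<in>carrier G. End_grading G V DV g = D g)"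
proof -
  obtain W where W: "direct_sum (carrier G) UNIV W"
    and LW: "\<And>g k l x. g \<in> carrier G \<Longrightarrow> k \<in> carrier G \<Longrightarrow> l \<in> R.LD g \<Longrightarrow> x \<in> W k \<Longrightarrow> sc l x \<in> W (g \<otimes>\<^bsub>G\<^esub> k)"
    and mW: "\<And>g k x y. g \<in> carrier G \<Longrightarrow> k \<in> carrier G \<Longrightarrow> x \<in> W g \<Longrightarrow> y \<in> W k \<Longrightarrow> vm x y \<in> W (g \<otimes>\<^bsub>G\<^esub> k)"
    and bW: "\<And>g k x y. g \<in> carrier G \<Longrightarrow> k \<in> carrier G \<Longrightarrow> x \<in> W g \<Longrightarrow> y \<in> W k \<Longrightarrow> vb x y \<in> R.LD (g \<otimes>\<^bsub>G\<^esub> k)"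
    and DW: "\<And>g. g \<in> carrier G \<Longrightarrow> DW g = {a. C.lin a \<and> (\<forall>k\<in>carrier G. a ` W k \<subseteq> W (g \<otimes>\<^bsub>G\<^esub> k))}"
    using R.composition_grading by (elim exE conjE) (rule that; simp)
  define DV where "DV g = mk ` W g" for g
  have V_gr: "alg_grading G V DV"
    unfolding DV_def
  proof (rule alg_grading_class[OF V.abelian_group_axioms mk_bij mk_add W])
    fix g c x assume g: "g \<in> carrier G" and x: "x \<in> W g"
    have "sc (diag c) x \<in> W (\<one>\<^bsub>G\<^esub> \<otimes>\<^bsub>G\<^esub> g)" using g x R.LD_diag by (intro LW) auto
    then have "mk (sc (diag c) x) \<in> mk ` W g" using g by simp
    then show "diag c \<odot> mk x \<in> mk ` W g" by (simp add: mk_sc)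
  next
    fix g k x y assume "g \<in> carrier G" "k \<in> carrier G" "x \<in> W g" "y \<in> W k"
    then have "mk (vm x y) \<in> mk ` W (g \<otimes>\<^bsub>G\<^esub> k)" by (intro imageI mW)
    then show "mk x \<otimes> mk y \<in> mk ` W (g \<otimes>\<^bsub>G\<^esub> k)" by simp
  qed
  have "alg_grading G (triple_alg :: ('k triple, 'k triple) module) (\<lambda>g. id ` R.LD g)"
  proof (rule alg_grading_class[OF triple_alg_abelian _ _ R.LD_direct_sum])
    show "bij_betw id UNIV (carrier (triple_alg :: ('k triple, 'k triple) module))"
      by (simp add: triple_alg_def ring.defs ring_of_type_algebra_def)
    show "id (x + y) = id x \<oplus>\<^bsub>triple_alg\<^esub> id y" for x y :: "'k triple"
      by (simp add: triple_alg_def ring.defs ring_of_type_algebra_def id_apply)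
    show "diag c \<odot>\<^bsub>triple_alg\<^esub> id x \<in> id ` R.LD g" if "g \<in> carrier G" "x \<in> R.LD g" for g c x
      using R.LD_mult[OF G.one_closed that(1) R.LD_diag that(2)] that(1)
      by (simp add: triple_alg_def ring.defs id_apply)
    show "id x \<otimes>\<^bsub>triple_alg\<^esub> id y \<in> id ` R.LD (g \<otimes>\<^bsub>G\<^esub> k)"
      if "g \<in> carrier G" "k \<in> carrier G" "x \<in> R.LD g" "y \<in> R.LD k" for g k x y
      using R.LD_mult[OF that] by (simp add: triple_alg_def ring.defs ring_of_type_algebra_def id_apply)
  qed
  then have L_gr: "alg_grading G triple_alg R.LD" by (simp add: id_apply)
  have "cyclic_composition_grading G V Q R.LD DV"
    unfolding cyclic_composition_grading_def
  proof (intro conjI ballI V_gr L_gr)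
    show "rho ` R.LD g \<subseteq> R.LD g" if "g \<in> carrier G" for g using R.LD_rho[OF that] by blast
  next
    fix g k l v assume gk: "g \<in> carrier G" "k \<in> carrier G" "l \<in> R.LD g" "v \<in> DV k"
    then obtain x where x: "x \<in> W k" "v = mk x" by (auto simp: DV_def)
    have "mk (sc l x) \<in> mk ` W (g \<otimes>\<^bsub>G\<^esub> k)" using gk x by (intro imageI LW)
    then show "l \<odot> v \<in> DV (g \<otimes>\<^bsub>G\<^esub> k)" by (simp add: DV_def mk_sc x)
  next
    fix g k v w assume gk: "g \<in> carrier G" "k \<in> carrier G" "v \<in> DV g" "w \<in> DV k"
    then obtain x y where "x \<in> W g" "v = mk x" "y \<in> W k" "w = mk y" by (auto simp: DV_def)
    then show "polar V Q v w \<in> R.LD (g \<otimes>\<^bsub>G\<^esub> k)" using bW gk by (simp add: vb_def)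
  qed
  moreover have "End_grading G V DV g = D g" if g: "g \<in> carrier G" for g
  proof -
    have "f \<in> End_grading G V DV g \<longleftrightarrow> f \<in> D g" if f: "f \<in> carrier EV" for f
    proof -
      obtain a where a: "C.lin a" "f = T a" using f by (rule EV_obtain)
      have "f ` DV k = mk ` a ` W k" for k
        unfolding a(2) DV_def image_image by (rule image_cong) (simp_all add: T_def)
      moreover have "mk ` A \<subseteq> mk ` B \<longleftrightarrow> A \<subseteq> B" for A B
        using mk_injD by blast
      ultimately have "f \<in> End_grading G V DV g \<longleftrightarrow> (\<forall>k\<in>carrier G. a ` W k \<subseteq> W (g \<otimes>\<^bsub>G\<^esub> k))"
        using f by (simp add: End_grading_def DV_def)
      also have "\<dots> \<longleftrightarrow> a \<in> DW g" using DW[OF g] a(1) by blast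
      also have "\<dots> \<longleftrightarrow> f \<in> D g" using a by (simp add: DW_def)
      finally show ?thesis .
    qed
    moreover have "End_grading G V DV g \<subseteq> carrier EV" by (auto simp: End_grading_def)
    ultimately show ?thesis using D_EV[OF g] by blast
  qed
  ultimately show ?thesis by blast
qed

end

lemma (in coords) EV_faithful: "l \<odot>\<^bsub>EV\<^esub> \<one>\<^bsub>EV\<^esub> = m \<odot>\<^bsub>EV\<^esub> \<one>\<^bsub>EV\<^esub> \<longleftrightarrow> l = m"
  unfolding T_one[symmetric] T_sca[symmetric] T_inj by (rule C.sca_id_eq)

lemma (in coords) EV_scalar_mult: "(l \<odot>\<^bsub>EV\<^esub> \<one>\<^bsub>EV\<^esub>) \<otimes>\<^bsub>EV\<^esub> (m \<odot>\<^bsub>EV\<^esub> \<one>\<^bsub>EV\<^esub>) = (l * m) \<odot>\<^bsub>EV\<^esub> \<one>\<^bsub>EV\<^esub>"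
  unfolding T_one[symmetric] T_sca[symmetric] T_mult[symmetric] T_inj
  by (simp add: C.sca_comp C.sca_sca)

text \<open>The index type \<open>8\<close> makes the coordinate vectors a whole type with pointwise
  addition; \<beta> matches its elements with the natural numbers in
  \<open>free_of_rank\<close>.\<close>

lemma coords_exist:
  fixes V :: "('k::alg_closed_field triple, 'v) module"
  assumes cca: "cyclic_composition_algebra V Q" and rank: "free_of_rank V 8"
  shows "\<exists>(mk :: (8 \<Rightarrow> 'k triple) \<Rightarrow> 'v) sc e e'. coords V Q mk sc 8 e e'"
proof -
  interpret cyclic_composition_algebra V Q by (rule cca)
  interpret V: abelian_group V using module by (rule module.axioms)
  note sm = module_smult[OF module]
  obtain bs :: "nat \<Rightarrow> 'v" where bs: "bs \<in> {..<8} \<rightarrow> carrier V"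
    and ex1: "\<forall>v\<in>carrier V. \<exists>!c. c \<in> {..<8} \<rightarrow>\<^sub>E UNIV \<and> v = (\<Oplus>\<^bsub>V\<^esub>i\<in>{..<8}. c i \<odot>\<^bsub>V\<^esub> bs i)"
    using rank unfolding free_of_rank_def by (elim bexE) (rule that)
  note ex1 = bspec[OF ex1]
  have "card {..<8 :: nat} = card (UNIV :: 8 set)" by simp
  then obtain \<beta> where \<beta>: "bij_betw \<beta> {..<8 :: nat} (UNIV :: 8 set)"
    using finite_same_card_bij[of "{..<8 :: nat}" "UNIV :: 8 set"] by auto
  define mk where "mk x = (\<Oplus>\<^bsub>V\<^esub>i\<in>{..<8}. x (\<beta> i) \<odot>\<^bsub>V\<^esub> bs i)" for x :: "8 \<Rightarrow> 'k triple"
  have bsI: "bs i \<in> carrier V" if "i < 8" for i using bs that by (simp add: Pi_iff)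
  have t: "l \<odot>\<^bsub>V\<^esub> bs i \<in> carrier V" if "i < 8" for i l by (intro sm(1) bsI that)
  have V_sum: "(\<Oplus>\<^bsub>V\<^esub>i\<in>{..<8::nat}. f i) = (\<Oplus>\<^bsub>V\<^esub>i\<in>{..<8}. g i)"
    if "\<And>i. i < 8 \<Longrightarrow> f i = g i" "\<And>i. i < 8 \<Longrightarrow> g i \<in> carrier V" for f g :: "nat \<Rightarrow> 'v"
    using that by (intro V.finsum_cong') (simp_all add: Pi_iff)
  have mk_closed: "mk x \<in> carrier V" for x unfolding mk_def by (intro V.finsum_closed Pi_I) (simp add: t)
  have mk_add: "mk (x + y) = mk x \<oplus>\<^bsub>V\<^esub> mk y" for x y
  proof -
    have "mk (x + y) = (\<Oplus>\<^bsub>V\<^esub>i\<in>{..<8}. x (\<beta> i) \<odot>\<^bsub>V\<^esub> bs i \<oplus>\<^bsub>V\<^esub> y (\<beta> i) \<odot>\<^bsub>V\<^esub> bs i)"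
      unfolding mk_def by (rule V_sum) (simp_all add: plus_fun_apply sm(3) t bsI)
    also have "\<dots> = mk x \<oplus>\<^bsub>V\<^esub> mk y" unfolding mk_def by (intro V.finsum_addf) (simp_all add: Pi_iff t)
    finally show ?thesis .
  qed
  have mk_sc: "mk (\<lambda>j. l * x j) = l \<odot>\<^bsub>V\<^esub> mk x" for l x
  proof -
    have "l \<odot>\<^bsub>V\<^esub> mk x = (\<Oplus>\<^bsub>V\<^esub>i\<in>{..<8}. l \<odot>\<^bsub>V\<^esub> (x (\<beta> i) \<odot>\<^bsub>V\<^esub> bs i))"
      unfolding mk_def by (intro finsum_hom[OF V.abelian_group_axioms V.abelian_group_axioms, of "\<lambda>v. l \<odot>\<^bsub>V\<^esub> v"])
        (simp_all add: sm t)
    also have "\<dots> = mk (\<lambda>j. l * x j)"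
      unfolding mk_def by (rule V_sum) (simp_all add: sm(4) sm(1)[OF t] bsI)
    finally show ?thesis by simp
  qed
  have inj: "x = y" if "mk x = mk y" for x y
  proof
    fix j
    obtain i where i: "i < 8" "j = \<beta> i" using \<beta> by (metis bij_betw_def UNIV_I imageE lessThan_iff)
    have rep: "(\<lambda>i\<in>{..<8}. x (\<beta> i)) \<in> {..<8} \<rightarrow>\<^sub>E UNIV \<and> mk x = (\<Oplus>\<^bsub>V\<^esub>i\<in>{..<8}. (\<lambda>i\<in>{..<8}. x (\<beta> i)) i \<odot>\<^bsub>V\<^esub> bs i)" for x
      unfolding mk_def by (intro conjI V_sum) (simp_all add: t)
    have "(\<lambda>i\<in>{..<8}. x (\<beta> i)) = (\<lambda>i\<in>{..<8}. y (\<beta> i))"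
    proof (rule ex1E[OF ex1[OF mk_closed[of x]]])
      fix c assume c: "\<forall>d. d \<in> {..<8} \<rightarrow>\<^sub>E UNIV \<and> mk x = (\<Oplus>\<^bsub>V\<^esub>i\<in>{..<8}. d i \<odot>\<^bsub>V\<^esub> bs i) \<longrightarrow> d = c"
      show ?thesis by (rule trans[OF mp[OF spec[OF c] rep[of x]] mp[OF spec[OF c] rep[of y, folded that], symmetric]])
    qed
    from fun_cong[OF this, of i] show "x j = y j" using i by simp
  qed
  have surj: "\<exists>x. mk x = v" if v: "v \<in> carrier V" for v
  proof -
    obtain c where c: "v = (\<Oplus>\<^bsub>V\<^esub>i\<in>{..<8}. c i \<odot>\<^bsub>V\<^esub> bs i)"
      using ex1[OF v] by (elim ex1E conjE) (rule that)
    have "mk (\<lambda>j. c (inv_into {..<8} \<beta> j)) = v"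
      unfolding mk_def c using \<beta> by (intro V_sum) (simp_all add: bij_betw_def inv_into_f_f t)
    then show ?thesis by blast
  qed
  have bij: "bij_betw mk UNIV (carrier V)"
    using inj surj mk_closed unfolding bij_betw_def inj_on_def by blast
  define co where "co = inv_into UNIV mk"
  have co_mk: "co (mk x) = x" for x using bij by (simp add: co_def bij_betw_def inv_f_f)
  have mk_co: "mk (co v) = v" if "v \<in> carrier V" for v using bij that by (simp add: co_def bij_betw_def f_inv_into_f)
  have co_add: "co (v \<oplus>\<^bsub>V\<^esub> w) = co v + co w" if "v \<in> carrier V" "w \<in> carrier V" for v w
    using that by (intro inj) (simp add: mk_co mk_add)
  have co_sc: "co (l \<odot>\<^bsub>V\<^esub> v) = (\<lambda>j. l * co v j)" if "v \<in> carrier V" for l v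
    using that by (intro inj) (simp add: mk_co mk_sc sm)
  \<comment> \<open>Nonsingularity represents each coordinate functional by a vector; these vectors
    are the dual family.\<close>
  have "\<exists>x. x \<in> carrier V \<and> (\<forall>y\<in>carrier V. co y (\<beta> i) = polar V Q x y)" for i
  proof -
    have "(\<forall>x\<in>carrier V. \<forall>y\<in>carrier V. co (x \<oplus>\<^bsub>V\<^esub> y) (\<beta> i) = co x (\<beta> i) + co y (\<beta> i)) \<and>
      (\<forall>l. \<forall>x\<in>carrier V. co (l \<odot>\<^bsub>V\<^esub> x) (\<beta> i) = l * co x (\<beta> i))"
      by (simp add: co_add co_sc plus_fun_apply)
    from nonsing[unfolded nonsingular_def, rule_format, OF this] show ?thesis by blast
  qed
  then obtain p where p: "\<And>i. p i \<in> carrier V" "\<And>i y. y \<in> carrier V \<Longrightarrow> polar V Q (p i) y = co y (\<beta> i)" by metis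
  define e where "e i = (\<lambda>j. if j = \<beta> i then 1 else 0 :: 'k triple)" for i
  define e' where "e' i = co (p i)" for i
  have pol: "polar V Q (mk (e' i)) (mk v) = v (\<beta> i)" for i v
    using p mk_closed by (simp add: e'_def mk_co co_mk)
  have "coords V Q mk (\<lambda>l x j. l * x j) 8 e e'"
  proof unfold_locales
    show "bij_betw mk UNIV (carrier V)" by (rule bij)
    show "mk (x + y) = mk x \<oplus>\<^bsub>V\<^esub> mk y" for x y by (rule mk_add)
    show "mk (\<lambda>j. l * x j) = l \<odot>\<^bsub>V\<^esub> mk x" for l x by (rule mk_sc)
    show "(\<Sum>i<8. (\<lambda>j. polar V Q (mk (e' i)) (mk v) * e i j)) = v" for v
    proof
      fix j
      have "(\<Sum>i<8. (\<lambda>j. polar V Q (mk (e' i)) (mk v) * e i j)) j = (\<Sum>i<8. v (\<beta> i) * (if j = \<beta> i then 1 else 0))"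
        unfolding sum_fun_apply pol e_def ..
      also have "\<dots> = (\<Sum>k\<in>UNIV. v k * (if j = k then 1 else 0))"
        by (rule sum.reindex_bij_betw[OF \<beta>])
      also have "\<dots> = v j" by (simp add: if_distrib sum.delta cong: if_cong)
      finally show "(\<Sum>i<8. (\<lambda>j. polar V Q (mk (e' i)) (mk v) * e i j)) j = v j" .
    qed
    show "\<exists>x y. polar V Q (mk x) (mk y) = 1"
      by (intro exI[of _ "e' 0"] exI[of _ "e 0"]) (simp only: pol e_def if_True refl)
  qed
  then show ?thesis by blast
qed

section \<open>Transport along isomorphisms of trialitarian algebras\<close>

text \<open>(1, \<omega>, \<omega>^2) is an eigenvector of \<rho> for \<omega>. Its image is an
  eigenvector of \<rho> or of \<rho>^2 for the same value, which fixes it up to a factor; in the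
  second case \<omega>' is \<omega>^2.\<close>

lemma tau_xi:
  fixes \<tau> :: "'k::field triple \<Rightarrow> 'k triple"
  assumes \<tau>: "\<And>l m. \<tau> (l * m) = \<tau> l * \<tau> m" "\<And>c. \<tau> (diag c) = diag c" "bij \<tau>"
    and comm: "\<tau> \<circ> rho = rho \<circ> \<tau> \<or> \<tau> \<circ> rho = rho \<circ> rho \<circ> \<tau>"
    and \<omega>: "\<omega> ^ 3 = 1" "\<omega> \<noteq> 1"
  shows "\<exists>\<omega>' x. \<omega>' ^ 3 = 1 \<and> \<omega>' \<noteq> 1 \<and> x \<noteq> 0 \<and> \<tau> (1, \<omega>, \<omega>\<^sup>2) = diag x * (1, \<omega>', \<omega>'\<^sup>2)"
proof -
  obtain x y z where xyz: "\<tau> (1, \<omega>, \<omega>\<^sup>2) = (x, y, z)" by (cases "\<tau> (1, \<omega>, \<omega>\<^sup>2)")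
  have w: "\<omega> * (\<omega> * \<omega>) = 1" using \<omega>(1) by (simp only: power3_eq_cube mult.assoc)
  have "rho (1, \<omega>, \<omega>\<^sup>2) = diag \<omega> * (1, \<omega>, \<omega>\<^sup>2)"
    using w by (simp add: diag_def power2_eq_square)
  then have eq: "\<tau> (rho (1, \<omega>, \<omega>\<^sup>2)) = (\<omega> * x, \<omega> * y, \<omega> * z)"
    by (simp only: \<tau> xyz) (simp add: diag_def)
  \<comment> \<open>A vanishing first entry would make the image 0, against bijectivity of
    \<tau>.\<close>
  have x0: "x \<noteq> 0" if "y = a * x" "z = c * x" for a c
  proof
    assume "x = 0"
    then have "\<tau> (1, \<omega>, \<omega>\<^sup>2) = 0" using that xyz by (simp add: triple_zero)
    also have "\<dots> = \<tau> 0" using \<tau>(2)[of 0] by simp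
    finally have "(1, \<omega>, \<omega>\<^sup>2) = (0 :: 'k triple)" by (rule injD[OF bij_is_inj[OF \<tau>(3)]])
    then show False by (simp add: triple_zero)
  qed
  show ?thesis
    using comm
  proof
    assume "\<tau> \<circ> rho = rho \<circ> \<tau>"
    then have "rho (\<tau> (1, \<omega>, \<omega>\<^sup>2)) = (\<omega> * x, \<omega> * y, \<omega> * z)" using eq by (metis o_def)
    then have *: "y = \<omega> * x" "z = \<omega> * y" unfolding xyz rho.simps prod.inject by blast+
    then have z: "z = \<omega>\<^sup>2 * x" by (simp only: power2_eq_square mult.assoc)
    have "\<tau> (1, \<omega>, \<omega>\<^sup>2) = diag x * (1, \<omega>, \<omega>\<^sup>2)"
      unfolding xyz diag_def triple_times *(1) z by (simp add: mult.commute)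
    then show ?thesis using x0[OF *(1) z] \<omega> by blast
  next
    assume "\<tau> \<circ> rho = rho \<circ> rho \<circ> \<tau>"
    then have "rho (rho (\<tau> (1, \<omega>, \<omega>\<^sup>2))) = (\<omega> * x, \<omega> * y, \<omega> * z)" using eq by (metis o_def)
    then have *: "z = \<omega> * x" "y = \<omega> * z" unfolding xyz rho.simps prod.inject by blast+
    then have y: "y = \<omega>\<^sup>2 * x" by (simp only: power2_eq_square mult.assoc)
    have w4: "(\<omega>\<^sup>2)\<^sup>2 = \<omega>" using w by (simp only: power2_eq_square mult.assoc mult_1_right)
    have "\<tau> (1, \<omega>, \<omega>\<^sup>2) = diag x * (1, \<omega>\<^sup>2, (\<omega>\<^sup>2)\<^sup>2)"
      unfolding xyz diag_def triple_times *(1) y w4 by (simp add: mult.commute)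
    moreover have "(\<omega>\<^sup>2) ^ 3 = 1" using \<omega>(1) by (metis power_mult mult.commute power_one)
    moreover have "\<omega>\<^sup>2 \<noteq> 1"
    proof
      assume "\<omega>\<^sup>2 = 1"
      then have "\<omega> * 1 = 1" using w by (simp only: power2_eq_square)
      then show False using \<omega>(2) by simp
    qed
    ultimately show ?thesis using x0[OF y *(1)] by blast
  qed
qed

lemma range_diag_mult:
  fixes x :: "'k::field"
  assumes "x \<noteq> 0"
  shows "range (\<lambda>c. diag c * (diag x * m)) = range (\<lambda>c. diag c * m)"
proof
  show "range (\<lambda>c. diag c * (diag x * m)) \<subseteq> range (\<lambda>c. diag c * m)"
    by (auto simp: mult.assoc[symmetric] diag_mult[symmetric])
  show "range (\<lambda>c. diag c * m) \<subseteq> range (\<lambda>c. diag c * (diag x * m))"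
  proof
    fix l assume "l \<in> range (\<lambda>c. diag c * m)"
    then obtain c where c: "l = diag c * m" by blast
    have "diag (c / x) * (diag x * m) = diag (c / x * x) * m" by (simp only: diag_mult mult.assoc)
    then have "l = diag (c / x) * (diag x * m)" using assms c by simp
    then show "l \<in> range (\<lambda>c. diag c * (diag x * m))" by blast
  qed
qed

text \<open>Gradings are functions on the whole type, while the gradings compared at the end are
  known to agree only on the group.\<close>

lemma alg_grading_cong:
  assumes "comm_group G" and eq: "\<And>g. g \<in> carrier G \<Longrightarrow> D g = D' g" and gr: "alg_grading G A D"
  shows "alg_grading G A D'"
proof -
  interpret comm_group G by fact
  have "decomposition G A D = decomposition G A D'"
    using PiE_cong[of "carrier G" D D', OF eq] by (simp add: decomposition_def fun_eq_iff)
  moreover have "D (g \<otimes>\<^bsub>G\<^esub> h) = D' (g \<otimes>\<^bsub>G\<^esub> h)" if "g \<in> carrier G" "h \<in> carrier G" for g h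
    using that by (intro eq) simp
  ultimately show ?thesis using gr unfolding alg_grading_alt by (simp add: eq)
qed

lemma trialitarian_grading_cong:
  assumes G: "comm_group G" and eq: "\<And>g. g \<in> carrier G \<Longrightarrow> D g = D' g" and gr: "trialitarian_grading G S D"
  shows "trialitarian_grading G S D'"
proof -
  have "alg_grading G (E_alg S) D'"
    by (rule alg_grading_cong[OF G eq]) (use gr in \<open>simp_all add: trialitarian_grading_def\<close>)
  then show ?thesis using gr unfolding trialitarian_grading_def by (simp add: eq)
qed

text \<open>The grading of the Clifford algebra is carried over by Cl(\<phi>), which is part of the
  notion of isomorphism. A flip of the two factors does no harm, since the degree condition treats
  them alike; on L the map \<tau> may replace \<omega> by \<omega>^2.\<close>

lemma trialitarian_grading_iso:
  fixes S :: "('k::alg_closed_field, 'e) trialitarian_data" and V :: "('k triple, 'v) module"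
    and mk :: "'w::ab_group_add \<Rightarrow> 'v"
  assumes G: "comm_group G" and S: "L_algebra (E_alg S)" and coords: "coords V Q mk sc n e e'" and S': "E_alg S' = End_alg V" "E_inv S' = adjoint V Q"
    and iso: "trialitarian_iso S S' \<phi>" and gr: "trialitarian_grading G S D" and III: "type_III G S D"
  shows "trialitarian_grading G S' (\<lambda>g. \<phi> ` D g) \<and> type_III G S' (\<lambda>g. \<phi> ` D g)"
proof -
  interpret coords V Q mk sc n e e' by (rule coords)
  let ?E = "E_alg S"
  interpret G: comm_group G by (rule G)
  interpret E: ring ?E using S by (simp add: L_algebra_def)
  have modE: "Module.module triple_ring ?E" using S by (simp add: L_algebra_def)
  note smE = module_smult[OF modE]
  interpret C1: closed_module ?E "E_inv S"
    by unfold_locales (auto intro: smE)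
  have \<phi>: "\<phi> \<in> ring_iso ?E EV" "\<And>c a. a \<in> carrier ?E \<Longrightarrow> \<phi> (diag c \<odot>\<^bsub>?E\<^esub> a) = diag c \<odot>\<^bsub>EV\<^esub> \<phi> a"
    "\<And>a. a \<in> carrier ?E \<Longrightarrow> \<phi> (E_inv S a) = adjoint V Q (\<phi> a)"
    using iso unfolding trialitarian_iso_def S' by blast+
  obtain \<tau> f where \<tau>: "bij \<tau>" "\<And>l. \<phi> (l \<odot>\<^bsub>?E\<^esub> \<one>\<^bsub>?E\<^esub>) = \<tau> l \<odot>\<^bsub>EV\<^esub> \<one>\<^bsub>EV\<^esub>"
    and f: "is_clifford_map ?E (E_inv S) EV (adjoint V Q) \<tau> \<phi> f"
    and cases: "\<tau> \<circ> rho = rho \<circ> \<tau> \<and> (\<forall>c\<in>carrier (Cl S). E_map S' (f c) = map_prod \<phi> \<phi> (E_map S c)) \<or>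
      \<tau> \<circ> rho = rho \<circ> rho \<circ> \<tau> \<and> (\<forall>c\<in>carrier (Cl S). E_map S' (f c) = prod.swap (map_prod \<phi> \<phi> (E_map S c)))"
    using iso unfolding trialitarian_iso_def S' by (elim conjE exE) (rule that, assumption, erule spec, assumption, assumption)
  have hom: "\<phi> \<in> ring_hom ?E EV" and bij: "bij_betw \<phi> (carrier ?E) (carrier EV)" using \<phi>(1) by (auto simp: ring_iso_def)
  have fhom: "f \<in> ring_hom (Cl S) (clifford EV (adjoint V Q))"
    and fbij: "bij_betw f (carrier (Cl S)) (carrier (clifford EV (adjoint V Q)))"
    and f_scalar: "\<And>l. f (l \<odot>\<^bsub>Cl S\<^esub> \<one>\<^bsub>Cl S\<^esub>) = \<tau> l \<odot>\<^bsub>clifford EV (adjoint V Q)\<^esub> \<one>\<^bsub>clifford EV (adjoint V Q)\<^esub>"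
    and f_kappa: "\<And>a. a \<in> carrier ?E \<Longrightarrow> f (kappa ?E (E_inv S) a) = kappa EV (adjoint V Q) (\<phi> a)"
    using f by (auto simp: is_clifford_map_def ring_iso_def)
  have \<tau>_diag: "\<tau> (diag c) = diag c" for c
  proof -
    have "\<tau> (diag c) \<odot>\<^bsub>EV\<^esub> \<one>\<^bsub>EV\<^esub> = diag c \<odot>\<^bsub>EV\<^esub> \<one>\<^bsub>EV\<^esub>"
      unfolding \<tau>(2)[symmetric] \<phi>(2)[OF E.one_closed] ring_hom_one[OF hom] ..
    then show ?thesis by (simp only: EV_faithful)
  qed
  have one_sc: "l \<odot>\<^bsub>?E\<^esub> \<one>\<^bsub>?E\<^esub> \<in> carrier ?E" for l by (rule smE) simp
  have \<tau>_mult: "\<tau> (l * m) = \<tau> l * \<tau> m" for l m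
  proof -
    have "(l \<odot>\<^bsub>?E\<^esub> \<one>\<^bsub>?E\<^esub>) \<otimes>\<^bsub>?E\<^esub> (m \<odot>\<^bsub>?E\<^esub> \<one>\<^bsub>?E\<^esub>) = l \<odot>\<^bsub>?E\<^esub> (\<one>\<^bsub>?E\<^esub> \<otimes>\<^bsub>?E\<^esub> (m \<odot>\<^bsub>?E\<^esub> \<one>\<^bsub>?E\<^esub>))"
      using S one_sc[of m] E.one_closed unfolding L_algebra_def by blast
    also have "\<dots> = (l * m) \<odot>\<^bsub>?E\<^esub> \<one>\<^bsub>?E\<^esub>" using one_sc by (simp add: smE(4))
    finally have "\<tau> (l * m) \<odot>\<^bsub>EV\<^esub> \<one>\<^bsub>EV\<^esub> = (\<tau> l \<odot>\<^bsub>EV\<^esub> \<one>\<^bsub>EV\<^esub>) \<otimes>\<^bsub>EV\<^esub> (\<tau> m \<odot>\<^bsub>EV\<^esub> \<one>\<^bsub>EV\<^esub>)"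
      unfolding \<tau>(2)[symmetric] ring_hom_mult[OF hom one_sc one_sc, symmetric] by simp
    then show ?thesis unfolding EV_scalar_mult EV_faithful .
  qed
  have E_gr: "alg_grading G ?E D" and D_inv: "\<And>g. g \<in> carrier G \<Longrightarrow> E_inv S ` D g \<subseteq> D g"
    using gr by (simp_all add: trialitarian_grading_def)
  have DE: "D g \<subseteq> carrier ?E" if "g \<in> carrier G" for g
    using E_gr that unfolding alg_grading_alt by blast
  have gr1: "alg_grading G EV (\<lambda>g. \<phi> ` D g)"
    by (rule alg_grading_iso[OF E.is_abelian_group EV_abelian E_gr bij])
      (simp_all add: ring_hom_add[OF hom] ring_hom_mult[OF hom] \<phi>(2))
  obtain DC where DC: "alg_grading G (Cl S) DC" "\<And>g. g \<in> carrier G \<Longrightarrow> kappa ?E (E_inv S) ` D g \<subseteq> DC g"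
    "\<And>g. g \<in> carrier G \<Longrightarrow> E_map S ` DC g \<subseteq> D g \<times> D g"
    using gr unfolding trialitarian_grading_def by (elim conjE exE) (rule that, assumption, (erule bspec, assumption)+)
  have f_sc: "f (diag c \<odot>\<^bsub>Cl S\<^esub> x) = diag c \<odot>\<^bsub>clifford EV (adjoint V Q)\<^esub> f x" if "x \<in> carrier (Cl S)" for c x
    by (subst C1.clifford_smult, subst K.clifford_smult)
      (simp only: ring_hom_mult[OF fhom C1.clifford_smult_one_closed that] f_scalar \<tau>_diag)
  have gr2: "alg_grading G (clifford EV (adjoint V Q)) (\<lambda>g. f ` DC g)"
    by (rule alg_grading_iso[OF ring.is_abelian_group[OF C1.clifford_ring] ring.is_abelian_group[OF K.clifford_ring] DC(1) fbij])
      (simp_all add: ring_hom_add[OF fhom] ring_hom_mult[OF fhom] f_sc)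
  have "trialitarian_grading G S' (\<lambda>g. \<phi> ` D g)"
    unfolding trialitarian_grading_def S'
  proof (intro conjI ballI gr1 exI[of _ "\<lambda>g. f ` DC g"] gr2)
    fix g assume g: "g \<in> carrier G"
    show "adjoint V Q ` \<phi> ` D g \<subseteq> \<phi> ` D g"
    proof safe
      fix a assume "a \<in> D g"
      then have "a \<in> carrier ?E" "E_inv S a \<in> D g" using DE[OF g] D_inv[OF g] by blast+
      then show "adjoint V Q (\<phi> a) \<in> \<phi> ` D g" by (simp flip: \<phi>(3))
    qed
    show "kappa EV (adjoint V Q) ` \<phi> ` D g \<subseteq> f ` DC g"
    proof safe
      fix a assume "a \<in> D g"
      then have "a \<in> carrier ?E" "kappa ?E (E_inv S) a \<in> DC g" using DE[OF g] DC(2)[OF g] by blast+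
      then show "kappa EV (adjoint V Q) (\<phi> a) \<in> f ` DC g" by (simp flip: f_kappa)
    qed
    show "E_map S' ` f ` DC g \<subseteq> \<phi> ` D g \<times> \<phi> ` D g"
    proof
      fix p assume "p \<in> E_map S' ` f ` DC g"
      then obtain z where z: "z \<in> DC g" "p = E_map S' (f z)" by blast
      have zc: "z \<in> carrier (Cl S)" using DC(1) z g unfolding alg_grading_alt by blast
      obtain a c where ac: "E_map S z = (a, c)" "a \<in> D g" "c \<in> D g" using DC(3)[OF g] z by (cases "E_map S z") blast
      have "p = (\<phi> a, \<phi> c) \<or> p = (\<phi> c, \<phi> a)" using cases zc z(2) ac(1) by auto
      then show "p \<in> \<phi> ` D g \<times> \<phi> ` D g" using ac by blast
    qed
  qed
  moreover have "type_III G S' (\<lambda>g. \<phi> ` D g)"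
  proof -
    obtain \<omega> h where \<omega>: "\<omega> ^ 3 = 1" "\<omega> \<noteq> 1" and h: "h \<in> carrier G" "group.ord G h = 3"
      and L: "{l. l \<odot>\<^bsub>?E\<^esub> \<one>\<^bsub>?E\<^esub> \<in> D \<one>\<^bsub>G\<^esub>} = range diag"
        "{l. l \<odot>\<^bsub>?E\<^esub> \<one>\<^bsub>?E\<^esub> \<in> D h} = range (\<lambda>c. diag c * (1, \<omega>, \<omega>\<^sup>2))"
        "{l. l \<odot>\<^bsub>?E\<^esub> \<one>\<^bsub>?E\<^esub> \<in> D (h \<otimes>\<^bsub>G\<^esub> h)} = range (\<lambda>c. diag c * ((1, \<omega>, \<omega>\<^sup>2) * (1, \<omega>, \<omega>\<^sup>2)))"
      using III unfolding type_III_def Let_def by (elim exE conjE) (rule that)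
    obtain \<omega>' x where \<omega>': "\<omega>' ^ 3 = 1" "\<omega>' \<noteq> 1" and x: "x \<noteq> 0" "\<tau> (1, \<omega>, \<omega>\<^sup>2) = diag x * (1, \<omega>', \<omega>'\<^sup>2)"
      using tau_xi[OF \<tau>_mult \<tau>_diag \<tau>(1) _ \<omega>] cases by blast
    have tr: "{l. l \<odot>\<^bsub>EV\<^esub> \<one>\<^bsub>EV\<^esub> \<in> \<phi> ` D g} = \<tau> ` {l. l \<odot>\<^bsub>?E\<^esub> \<one>\<^bsub>?E\<^esub> \<in> D g}" if Dg: "D g \<subseteq> carrier ?E" for g
    proof (intro equalityI subsetI)
      fix l assume "l \<in> \<tau> ` {l. l \<odot>\<^bsub>?E\<^esub> \<one>\<^bsub>?E\<^esub> \<in> D g}"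
      then obtain m where "l = \<tau> m" "m \<odot>\<^bsub>?E\<^esub> \<one>\<^bsub>?E\<^esub> \<in> D g" by blast
      then show "l \<in> {l. l \<odot>\<^bsub>EV\<^esub> \<one>\<^bsub>EV\<^esub> \<in> \<phi> ` D g}" by (simp flip: \<tau>(2))
    next
      fix l assume "l \<in> {l. l \<odot>\<^bsub>EV\<^esub> \<one>\<^bsub>EV\<^esub> \<in> \<phi> ` D g}"
      then obtain a where a: "a \<in> D g" "l \<odot>\<^bsub>EV\<^esub> \<one>\<^bsub>EV\<^esub> = \<phi> a" by blast
      obtain m where m: "l = \<tau> m" using \<tau>(1) by (metis bij_pointE)
      have "\<phi> (m \<odot>\<^bsub>?E\<^esub> \<one>\<^bsub>?E\<^esub>) = \<phi> a" using a(2) m \<tau>(2)[of m] by simp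
      then have "m \<odot>\<^bsub>?E\<^esub> \<one>\<^bsub>?E\<^esub> = a"
        using bij one_sc[of m] a(1) Dg unfolding bij_betw_def inj_on_def by blast
      then show "l \<in> \<tau> ` {l. l \<odot>\<^bsub>?E\<^esub> \<one>\<^bsub>?E\<^esub> \<in> D g}" using a(1) m by blast
    qed
    have image: "\<tau> ` range (\<lambda>c. diag c * m) = range (\<lambda>c. diag c * \<tau> m)" for m
      by (simp add: image_image \<tau>_mult \<tau>_diag)
    have xi2: "\<tau> ((1, \<omega>, \<omega>\<^sup>2) * (1, \<omega>, \<omega>\<^sup>2)) = diag x * (diag x * ((1, \<omega>', \<omega>'\<^sup>2) * (1, \<omega>', \<omega>'\<^sup>2)))"
      unfolding \<tau>_mult x(2) by (simp only: ac_simps)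
    have in_carr: "D \<one>\<^bsub>G\<^esub> \<subseteq> carrier ?E" "D h \<subseteq> carrier ?E" "D (h \<otimes>\<^bsub>G\<^esub> h) \<subseteq> carrier ?E"
      using G.one_closed G.m_closed[OF h(1) h(1)] h(1) by (simp_all only: DE)
    have L': "{l. l \<odot>\<^bsub>EV\<^esub> \<one>\<^bsub>EV\<^esub> \<in> \<phi> ` D \<one>\<^bsub>G\<^esub>} = range diag"
      "{l. l \<odot>\<^bsub>EV\<^esub> \<one>\<^bsub>EV\<^esub> \<in> \<phi> ` D h} = range (\<lambda>c. diag c * (1, \<omega>', \<omega>'\<^sup>2))"
      "{l. l \<odot>\<^bsub>EV\<^esub> \<one>\<^bsub>EV\<^esub> \<in> \<phi> ` D (h \<otimes>\<^bsub>G\<^esub> h)} = range (\<lambda>c. diag c * ((1, \<omega>', \<omega>'\<^sup>2) * (1, \<omega>', \<omega>'\<^sup>2)))"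
      unfolding tr[OF in_carr(1)] tr[OF in_carr(2)] tr[OF in_carr(3)] L image xi2
      unfolding x(2) range_diag_mult[OF x(1)] by (simp_all add: image_image \<tau>_diag)
    show ?thesis unfolding type_III_def Let_def S'
      by (intro exI[of _ \<omega>'] exI[of _ h] conjI \<omega>' h L')
  qed
  ultimately show ?thesis ..
qed

section \<open>Realization of the graded algebra as an endomorphism algebra\<close>

theorem theorem12:
  fixes G :: "('g, 'm) monoid_scheme"
    and S :: "('k::alg_closed_field, 'e) trialitarian_data"
    and D :: "'g \<Rightarrow> 'e set"
  assumes "CHAR('k) \<noteq> 2" and "CHAR('k) \<noteq> 3"
    and "comm_group G"
    and "trialitarian_algebra S"
    and "trialitarian_grading G S D"
    and "type_III G S D"
  shows "\<exists>(V :: ('k triple, nat \<Rightarrow> 'k triple) module) Q DL DV S' \<phi>.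
    cyclic_composition_algebra V Q \<and> free_of_rank V 8 \<and>
    cyclic_composition_grading G V Q DL DV \<and>
    arises_from S' V Q \<and>
    trialitarian_grading G S' (End_grading G V DV) \<and>
    graded_trialitarian_iso G S D S' (End_grading G V DV) \<phi>"
proof -
  obtain V :: "('k triple, nat \<Rightarrow> 'k triple) module" and Q S' \<phi>
    where V: "cyclic_composition_algebra V Q" "free_of_rank V 8" and arises: "arises_from S' V Q"
      and iso: "trialitarian_iso S S' \<phi>"
    using assms(4) unfolding trialitarian_algebra_def by blast
  obtain mk :: "(8 \<Rightarrow> 'k triple) \<Rightarrow> nat \<Rightarrow> 'k triple" and sc e e' where coords: "coords V Q mk sc 8 e e'"
    using coords_exist[OF V] by blast
  have S: "L_algebra (E_alg S)" using assms(4) by (simp add: trialitarian_algebra_def)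
  have S': "E_alg S' = End_alg V" "E_inv S' = adjoint V Q" using arises by (simp_all add: arises_from_def)
  have gr: "trialitarian_grading G S' (\<lambda>g. \<phi> ` D g)" and III: "type_III G S' (\<lambda>g. \<phi> ` D g)"
    using trialitarian_grading_iso[OF assms(3) S coords S' iso assms(5,6)] by blast+
  obtain \<omega> h where "\<omega> ^ 3 = 1" "\<omega> \<noteq> 1" "h \<in> carrier G" "group.ord G h = 3"
      "{l. l \<odot>\<^bsub>End_alg V\<^esub> \<one>\<^bsub>End_alg V\<^esub> \<in> \<phi> ` D \<one>\<^bsub>G\<^esub>} = range diag"
      "{l. l \<odot>\<^bsub>End_alg V\<^esub> \<one>\<^bsub>End_alg V\<^esub> \<in> \<phi> ` D h} = range (\<lambda>c. diag c * (1, \<omega>, \<omega>\<^sup>2))"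
      "{l. l \<odot>\<^bsub>End_alg V\<^esub> \<one>\<^bsub>End_alg V\<^esub> \<in> \<phi> ` D (h \<otimes>\<^bsub>G\<^esub> h)} = range (\<lambda>c. diag c * ((1, \<omega>, \<omega>\<^sup>2) * (1, \<omega>, \<omega>\<^sup>2)))"
    using III unfolding type_III_def Let_def S' by (elim exE conjE) (rule that)
  then have "graded_coords V Q mk sc 8 e e' G S' (\<lambda>g. \<phi> ` D g) \<omega> h"
    using coords assms(3) arises gr by (intro graded_coords.intro graded_coords_axioms.intro)
  from graded_coords.composition_grading_exists[OF this] obtain DL DV
    where DV: "cyclic_composition_grading G V Q DL DV" "\<And>g. g \<in> carrier G \<Longrightarrow> End_grading G V DV g = \<phi> ` D g"
    by blast
  have "trialitarian_grading G S' (End_grading G V DV)"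
    by (rule trialitarian_grading_cong[OF assms(3) _ gr]) (simp add: DV(2))
  moreover have "graded_trialitarian_iso G S D S' (End_grading G V DV) \<phi>"
    unfolding graded_trialitarian_iso_def using iso DV(2) by simp
  ultimately show ?thesis using V arises DV(1) by blast
qed

end
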